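(* Let $N\ge3$, $a<\frac{N-2}{2}$, $a\le b<a+1$, $p=\frac{2N}{N-2(1+a-b)}$. Let $K\in L^\infty(\mathbb{R}^N)\cap C^1(\mathbb{R}^N)$ be such that $x\mapsto\nabla K(x)\cdot x$ is bounded on $\mathbb{R}^N$, and let $u\in\mathcal{D}^{1,2}_a(\mathbb{R}^N)$ be a weak positive solution of $$-\operatorname{div}(|x|^{-2a}\nabla u)=K(x)\frac{u^{p-1}}{|x|^{bp}},\qquad x\in\mathbb{R}^N.$$ Then $$\int_{\mathbb{R}^N}(\nabla K(x)\cdot x)\frac{u^p}{|x|^{bp}}\,dx=0.$$
   Context: $\mathcal{D}^{1,2}_a(\mathbb{R}^N)$ is the completion of $C_0^\infty(\mathbb{R}^N)$ with respect to the norm $\big(\int_{\mathbb{R}^N}|x|^{-2a}|\nabla u|^2dx\big)^{1/2}$. *)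

theory Defs
  imports "HOL-Analysis.Analysis"
begin

definition pderivative :: "'n \<Rightarrow> (real ^ 'n \<Rightarrow> real) \<Rightarrow> real ^ 'n \<Rightarrow> real"
  where "pderivative i f x = frechet_derivative f (at x) (axis i 1)"

definition grad :: "(real ^ 'n \<Rightarrow> real) \<Rightarrow> real ^ 'n \<Rightarrow> real ^ 'n"
  where "grad f x = (\<chi> i. pderivative i f x)"

lemma GDERIV_grad:
  fixes f :: "real ^ 'n \<Rightarrow> real"
  assumes "f differentiable (at x)"
  shows "GDERIV f x :> grad f x"
proof -
  let ?D = "frechet_derivative f (at x)"
  have D: "(f has_derivative ?D) (at x)"
    using assms by (simp add: frechet_derivative_works)
  then have lin: "linear ?D"
    by (rule has_derivative_linear)
  have "?D h = inner h (grad f x)" for h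
  proof -
    have "?D h = ?D (\<Sum>i\<in>UNIV. h $ i *s axis i 1)"
      by (simp add: basis_expansion)
    also have "\<dots> = (\<Sum>i\<in>UNIV. h $ i * ?D (axis i 1))"
      by (simp add: linear_sum[OF lin] linear_cmul[OF lin] scalar_mult_eq_scaleR)
    also have "\<dots> = inner h (grad f x)"
      by (simp add: inner_vec_def grad_def pderivative_def)
    finally show ?thesis .
  qed
  then have "?D = (\<lambda>h. inner h (grad f x))" by blast
  with D show ?thesis unfolding gderiv_def by simp
qed

primrec Ck :: "nat \<Rightarrow> (real ^ 'n \<Rightarrow> real) \<Rightarrow> bool"
  where
    "Ck 0 f \<longleftrightarrow> continuous_on UNIV f"
  | "Ck (Suc k) f \<longleftrightarrow> (\<forall>x. f differentiable (at x)) \<and> (\<forall>i. Ck k (pderivative i f))"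

definition Cc_infinity :: "(real ^ 'n \<Rightarrow> real) set"
  where "Cc_infinity = {f. (\<forall>k. Ck k f) \<and> compact (closure {x. f x \<noteq> 0})}"

definition L_infinity :: "(real ^ 'n \<Rightarrow> real) set"
  where "L_infinity = {f \<in> borel_measurable lebesgue. \<exists>C. AE x in lebesgue. \<bar>f x\<bar> \<le> C}"

definition D_norm :: "real \<Rightarrow> (real ^ 'n \<Rightarrow> real) \<Rightarrow> real"
  where "D_norm a f = sqrt (LINT x|lebesgue. norm x powr (- 2 * a) * (norm (grad f x))\<^sup>2)"

definition D_Cauchy :: "real \<Rightarrow> (nat \<Rightarrow> real ^ 'n \<Rightarrow> real) \<Rightarrow> bool"
  where "D_Cauchy a \<phi> \<longleftrightarrow>
    range \<phi> \<subseteq> Cc_infinity \<and>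
    (\<forall>e>0. \<exists>M. \<forall>m\<ge>M. \<forall>n\<ge>M. D_norm a (\<lambda>x. \<phi> m x - \<phi> n x) < e)"

text \<open>
  The completion of the test functions under \<^const>\<open>D_norm\<close>, realised as a space of functions.
  For dimension \<open>N \<ge> 3\<close> and \<open>a < (N - 2) / 2\<close>, the Hardy and Caffarelli--Kohn--Nirenberg
  inequalities show that a Cauchy sequence converges in a weighted Lebesgue space, hence along
  a subsequence almost everywhere; two Cauchy sequences with almost everywhere limits are
  equivalent iff these limits agree almost everywhere. So the elements of the completion are
  exactly the almost everywhere limits of Cauchy sequences, modulo equality almost everywhere.
\<close>

definition D12 :: "real \<Rightarrow> (real ^ 'n \<Rightarrow> real) set"
  where "D12 a = {u \<in> borel_measurable lebesgue.
    \<exists>\<phi>. D_Cauchy a \<phi> \<and> (AE x in lebesgue. (\<lambda>n. \<phi> n x) \<longlonglongrightarrow> u x)}"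

text \<open>
  The gradient on \<^const>\<open>D12\<close> is the continuous extension of \<^const>\<open>grad\<close> from the test functions,
  with values in the vector fields square integrable with weight \<open>|x|\<^bsup>-2a\<^esup>\<close>. It is unique up to null
  sets; away from the origin it is the distributional gradient. It is not defined as the
  distributional gradient on the whole space because for very negative \<open>a\<close> neither the function
  nor the field need be locally integrable near the origin.
\<close>

definition is_D12_gradient ::
    "real \<Rightarrow> (real ^ 'n \<Rightarrow> real) \<Rightarrow> (real ^ 'n \<Rightarrow> real ^ 'n) \<Rightarrow> bool"
  where "is_D12_gradient a u g \<longleftrightarrow>
    g \<in> borel_measurable lebesgue \<and>
    (\<exists>\<phi>. D_Cauchy a \<phi> \<and> (AE x in lebesgue. (\<lambda>n. \<phi> n x) \<longlonglongrightarrow> u x) \<and>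
      (\<lambda>n. \<integral>\<^sup>+x. ennreal (norm x powr (- 2 * a) * (norm (grad (\<phi> n) x - g x))\<^sup>2) \<partial>lebesgue)
        \<longlonglongrightarrow> 0)"

text \<open>
  Weak solutions in \<^const>\<open>D12\<close> of \<open>- div (|x|\<^bsup>-2a\<^esup> \<nabla>u) = f\<close>. The left integrand is integrable by
  the Cauchy--Schwarz inequality, as \<open>|x|\<^bsup>-2a\<^esup>\<close> is locally integrable. The right one is in the
  use below, where \<open>f\<close> is \<open>K u\<^bsup>p-1\<^esup> / |x|\<^bsup>bp\<^esup>\<close>, by the Caffarelli--Kohn--Nirenberg and Hoelder
  inequalities. So no integral takes the default value for non-integrable functions.
\<close>

definition weak_solution :: "real \<Rightarrow> (real ^ 'n \<Rightarrow> real) \<Rightarrow> (real ^ 'n \<Rightarrow> real) \<Rightarrow> bool"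
  where "weak_solution a u f \<longleftrightarrow>
    u \<in> D12 a \<and>
    (\<exists>g. is_D12_gradient a u g \<and>
      (\<forall>v\<in>Cc_infinity.
        (LINT x|lebesgue. norm x powr (- 2 * a) * inner (g x) (grad v x)) =
        (LINT x|lebesgue. f x * v x)))"

end

theory Submission
  imports Defs
begin

text \<open>
  The equation is the Euler--Lagrange equation of
  \<open>J(v) = 1/2 \<integral> |x|\<^bsup>-2a\<^esup> |\<nabla>v|\<^sup>2 - 1/p \<integral> K v\<^bsup>p\<^esup> / |x|\<^bsup>bp\<^esup>\<close>. The dilations
  \<open>v\<^sub>l(x) = l\<^bsup>s\<^esup> v(l x)\<close> with \<open>s = (N - 2 - 2a)/2\<close> leave the quadratic part unchanged, and
  they change the other part only by replacing \<open>K(x)\<close> with \<open>K(x/l)\<close>. So the derivative of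
  \<open>J(u\<^sub>l)\<close> at \<open>l = 1\<close> is a multiple of the integral in question, and it should vanish
  because \<open>u\<close> is a critical point. What has to be proved is that the curve \<open>l \<mapsto> u\<^sub>l\<close> is
  regular enough at \<open>l = 1\<close>. Regularity theory for \<open>u\<close> is avoided: the equation itself
  forces the curve to be Lipschitz in the energy norm.

  Let \<open>w = u\<^sub>l\<close>, \<open>d = w - u\<close> and let \<open>E\<close> be the energy of \<open>d\<close>. The function \<open>w\<close> solves the
  equation with coefficient \<open>K(l x)\<close>, and \<open>u\<close>, \<open>w\<close> have the same energy. Testing the two
  equations with \<open>d\<close> gives \<open>\<integral> K(l x) w\<^bsup>p-1\<^esup> d / |x|\<^bsup>bp\<^esup> = E/2 = - \<integral> K u\<^bsup>p-1\<^esup> d / |x|\<^bsup>bp\<^esup>\<close>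
  (\<open>energy_identities\<close>). Adding up, \<open>E\<close> is bounded by multiples of
  \<open>\<integral> (u\<^bsup>p-2\<^esup> + w\<^bsup>p-2\<^esup>) d\<^sup>2 / |x|\<^bsup>bp\<^esup>\<close> and of \<open>(l - 1) \<surd>E\<close>. The potential \<open>u\<^bsup>p-2\<^esup> / |x|\<^bsup>bp\<^esup>\<close>
  has the critical growth, so that the first integral is only bounded by a multiple of \<open>E\<close>;
  but outside a set on which \<open>\<integral> u\<^bsup>p\<^esup> / |x|\<^bsup>bp\<^esup>\<close> is small, the potential is at most
  \<open>M |x|\<^bsup>-2a-2\<^esup>\<close>, and \<open>\<integral> |x|\<^bsup>-2a-2\<^esup> d\<^sup>2 = O((l - 1)\<^sup>2)\<close> holds for every element of the space
  (\<open>dilation_difference\<close>). The small part is absorbed by \<open>E\<close>. This yields \<open>E = O((l - 1)\<^sup>2)\<close>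
  (\<open>energy_Lipschitz\<close>). Expanding \<open>w\<^bsup>p\<^esup>\<close> around \<open>u\<close> to second order in the identity
  \<open>\<integral> K(l x) w\<^bsup>p\<^esup> / |x|\<^bsup>bp\<^esup> = \<integral> K u\<^bsup>p\<^esup> / |x|\<^bsup>bp\<^esup>\<close> gives
  \<open>\<integral> (K(l x) - K(x)) u\<^bsup>p\<^esup> / |x|\<^bsup>bp\<^esup> = O((l - 1)\<^sup>2)\<close> (\<open>K_increment_bound\<close>); division by
  \<open>l - 1\<close> and dominated convergence finish the proof.

  The space is understood through the Hardy and Caffarelli--Kohn--Nirenberg inequalities.
  Hardy's inequality and the bound for \<open>d\<close> come from integration along rays
  (\<open>wint_radial_average\<close>). The Caffarelli--Kohn--Nirenberg inequality is the Sobolev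
  inequality for \<open>|x|\<^bsup>-a\<^esup> \<phi>\<close>, interpolated with Hardy's. The Sobolev inequality is obtained
  from a weak estimate on superlevel sets (\<open>weak_isoperimetric\<close>), which averages the
  fundamental theorem of calculus over all directions, applied to truncations at dyadic
  levels.
\<close>

section \<open>Lebesgue measure under dilations and translations\<close>

lemma nn_integral_affine:
  fixes f :: "real ^ 'n \<Rightarrow> ennreal"
  assumes [measurable]: "f \<in> borel_measurable borel" and c: "c \<noteq> 0"
  shows "(\<integral>\<^sup>+x. f (t + c *\<^sub>R x) \<partial>lborel) = ennreal (\<bar>c\<bar> powr - real CARD('n)) * (\<integral>\<^sup>+x. f x \<partial>lborel)"
proof -
  have "(\<integral>\<^sup>+x. f x \<partial>lborel) = ennreal (\<bar>c\<bar> ^ CARD('n)) * (\<integral>\<^sup>+x. f (t + c *\<^sub>R x) \<partial>lborel)"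
    using c by (subst lborel_affine[of c t])
       (simp_all add: nn_integral_density nn_integral_distr nn_integral_cmult)
  moreover have "ennreal (\<bar>c\<bar> powr - real CARD('n)) * ennreal (\<bar>c\<bar> ^ CARD('n)) = 1"
    using c by (simp add: ennreal_mult[symmetric] powr_minus powr_realpow)
  ultimately show ?thesis
    by (simp add: mult.assoc[symmetric])
qed

lemma nn_integral_dilation:
  fixes f :: "real ^ 'n \<Rightarrow> ennreal"
  assumes "f \<in> borel_measurable borel" and c: "c > 0"
  shows "(\<integral>\<^sup>+x. f (c *\<^sub>R x) \<partial>lborel) = ennreal (c powr - real CARD('n)) * (\<integral>\<^sup>+x. f x \<partial>lborel)"
  using nn_integral_affine[OF assms(1), of c 0] c by simp

lemma nn_integral_shift:
  fixes f :: "'a::euclidean_space \<Rightarrow> ennreal"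
  assumes [measurable]: "f \<in> borel_measurable borel"
  shows "(\<integral>\<^sup>+x. f (x + y) \<partial>lborel) = (\<integral>\<^sup>+x. f x \<partial>lborel)"
proof -
  have "(\<integral>\<^sup>+x. f x \<partial>lborel) = (\<integral>\<^sup>+x. f x \<partial>distr lborel borel ((+) y))"
    by (simp add: lborel_distr_plus)
  also have "\<dots> = (\<integral>\<^sup>+x. f (x + y) \<partial>lborel)"
    by (subst nn_integral_distr) (auto simp: add.commute)
  finally show ?thesis by simp
qed

lemma lborel_dilation:
  assumes c: "c > 0"
  shows "distr lborel borel (\<lambda>x::real^'n. c *\<^sub>R x) = density lborel (\<lambda>_. ennreal (c powr - real CARD('n)))"
proof (rule measure_eqI)
  fix A assume "A \<in> sets (distr lborel borel (\<lambda>x::real^'n. c *\<^sub>R x))"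
  then have [measurable]: "A \<in> sets borel" by simp
  have "emeasure (distr lborel borel (\<lambda>x::real^'n. c *\<^sub>R x)) A
      = (\<integral>\<^sup>+x. indicator A x \<partial>distr lborel borel (\<lambda>x::real^'n. c *\<^sub>R x))"
    by simp
  also have "\<dots> = (\<integral>\<^sup>+x. indicator A (c *\<^sub>R x) \<partial>lborel)"
    by (subst nn_integral_distr) auto
  also have "\<dots> = ennreal (c powr - real CARD('n)) * (\<integral>\<^sup>+x. indicator A x \<partial>lborel)"
    by (rule nn_integral_dilation) (use c in auto)
  finally show "emeasure (distr lborel borel (\<lambda>x::real^'n. c *\<^sub>R x)) A
      = emeasure (density lborel (\<lambda>_. ennreal (c powr - real CARD('n)))) A"
    by (simp add: emeasure_density nn_integral_cmult)
qed simp

lemma integral_dilation: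
  fixes f :: "real ^ 'n \<Rightarrow> real"
  assumes [measurable]: "f \<in> borel_measurable borel" and c: "c > 0"
  shows "(\<integral>x. f (c *\<^sub>R x) \<partial>lborel) = c powr - real CARD('n) * (\<integral>x. f x \<partial>lborel)"
proof -
  have "(\<integral>x. f (c *\<^sub>R x) \<partial>lborel) = (\<integral>x. f x \<partial>distr lborel borel (\<lambda>x::real^'n. c *\<^sub>R x))"
    by (subst integral_distr) auto
  also have "\<dots> = c powr - real CARD('n) * (\<integral>x. f x \<partial>lborel)"
    unfolding lborel_dilation[OF c] by (subst integral_density) auto
  finally show ?thesis .
qed

lemma AE_dilation:
  assumes "AE x in lborel. P (x::real^'n)" and c: "c > 0"
  shows "AE x in lborel. P (c *\<^sub>R x)"
proof -
  obtain S where S: "{x. \<not> P x} \<subseteq> S" "S \<in> sets borel" "emeasure lborel S = 0"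
    using AE_E[OF assms(1)] by auto
  have [measurable]: "S \<in> sets borel" by fact
  have "(\<integral>\<^sup>+x. indicator S (c *\<^sub>R x) \<partial>lborel) = 0"
    by (subst nn_integral_dilation) (use c S in auto)
  then have "AE x in lborel. (indicator S (c *\<^sub>R x) :: ennreal) = 0"
    by (subst (asm) nn_integral_0_iff_AE) auto
  then show ?thesis
    by eventually_elim (use S in \<open>auto simp: indicator_def split: if_splits\<close>)
qed

section \<open>Hoelder's inequality and the fundamental theorem of calculus\<close>

text \<open>
  Stated with real upper bounds of the two integrals, so that real powers of the bounds make
  sense. Young's inequality is applied pointwise to \<open>X/A\<close> and \<open>Y/B\<close>.
\<close>

lemma Hoelder_nn_integral:
  fixes X Y :: "'a \<Rightarrow> real"
  assumes [measurable]: "X \<in> borel_measurable M" "Y \<in> borel_measurable M"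
    and XY: "\<And>x. X x \<ge> 0" "\<And>x. Y x \<ge> 0"
    and \<alpha>: "0 < \<alpha>" "0 < \<beta>" "\<alpha> + \<beta> = 1" and AB: "A \<ge> 0" "B \<ge> 0"
    and X: "(\<integral>\<^sup>+x. X x \<partial>M) \<le> ennreal A" and Y: "(\<integral>\<^sup>+x. Y x \<partial>M) \<le> ennreal B"
  shows "(\<integral>\<^sup>+x. X x powr \<alpha> * Y x powr \<beta> \<partial>M) \<le> ennreal (A powr \<alpha> * B powr \<beta>)"
proof (cases "A = 0 \<or> B = 0")
  case True
  have "AE x in M. X x powr \<alpha> * Y x powr \<beta> = 0"
  proof (cases "A = 0")
    case True
    then have "(\<integral>\<^sup>+x. X x \<partial>M) = 0" using X by simp
    then have "AE x in M. ennreal (X x) = 0"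
      by (subst (asm) nn_integral_0_iff_AE) auto
    then show ?thesis by eventually_elim (use XY(1) in \<open>simp add: ennreal_eq_0_iff antisym\<close>)
  next
    case False
    then have "(\<integral>\<^sup>+x. Y x \<partial>M) = 0" using Y True by simp
    then have "AE x in M. ennreal (Y x) = 0"
      by (subst (asm) nn_integral_0_iff_AE) auto
    then show ?thesis by eventually_elim (use XY(2) in \<open>simp add: ennreal_eq_0_iff antisym\<close>)
  qed
  then have "(\<integral>\<^sup>+x. X x powr \<alpha> * Y x powr \<beta> \<partial>M) = 0"
    by (subst nn_integral_0_iff_AE) auto
  then show ?thesis by simp
next
  case False
  then have pos: "A > 0" "B > 0" using AB by auto
  define c where "c = A powr \<alpha> * B powr \<beta>"
  have c: "c > 0" using pos by (simp add: c_def)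
  have "X x powr \<alpha> * Y x powr \<beta> \<le> (c * \<alpha> / A) * X x + (c * \<beta> / B) * Y x" for x
  proof -
    have "(X x / A) powr \<alpha> * (Y x / B) powr \<beta> \<le> \<alpha> * (X x / A) + \<beta> * (Y x / B)"
    proof (cases "X x = 0 \<or> Y x = 0")
      case True
      then show ?thesis using XY[of x] pos \<alpha> by auto
    next
      case False
      then show ?thesis
        by (intro Youngs_inequality_0) (use XY[of x] pos \<alpha> in \<open>auto simp: less_le\<close>)
    qed
    then have "c * ((X x / A) powr \<alpha> * (Y x / B) powr \<beta>) \<le> c * (\<alpha> * (X x / A) + \<beta> * (Y x / B))"
      using c by (intro mult_left_mono) auto
    also have "c * ((X x / A) powr \<alpha> * (Y x / B) powr \<beta>) = X x powr \<alpha> * Y x powr \<beta>"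
      using XY[of x] pos by (simp add: c_def powr_divide)
    finally show ?thesis by (simp add: algebra_simps)
  qed
  then have "(\<integral>\<^sup>+x. X x powr \<alpha> * Y x powr \<beta> \<partial>M)
      \<le> (\<integral>\<^sup>+x. ennreal (c * \<alpha> / A) * X x + ennreal (c * \<beta> / B) * Y x \<partial>M)"
    using c pos \<alpha> XY by (intro nn_integral_mono) (simp add: ennreal_mult[symmetric] ennreal_plus[symmetric] del: ennreal_plus)
  also have "\<dots> = ennreal (c * \<alpha> / A) * (\<integral>\<^sup>+x. X x \<partial>M) + ennreal (c * \<beta> / B) * (\<integral>\<^sup>+x. Y x \<partial>M)"
    by (subst nn_integral_add) (auto simp: nn_integral_cmult)
  also have "\<dots> \<le> ennreal (c * \<alpha> / A) * ennreal A + ennreal (c * \<beta> / B) * ennreal B"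
    by (intro add_mono mult_left_mono X Y) auto
  also have "\<dots> = ennreal (c * \<alpha> + c * \<beta>)"
    using c pos \<alpha> by (simp add: ennreal_mult[symmetric] ennreal_plus[symmetric] del: ennreal_plus)
  also have "c * \<alpha> + c * \<beta> = c" using \<alpha> by (metis distrib_left mult.right_neutral)
  finally show ?thesis by (simp add: c_def)
qed

lemma nn_integral_abs_FTC:
  fixes F f :: "real \<Rightarrow> real"
  assumes "a \<le> b" "\<And>x. a \<le> x \<Longrightarrow> x \<le> b \<Longrightarrow> (F has_vector_derivative f x) (at x within {a .. b})"
    and cont: "continuous_on {a .. b} f"
  shows "ennreal \<bar>F b - F a\<bar> \<le> (\<integral>\<^sup>+x. indicator {a..b} x * ennreal \<bar>f x\<bar> \<partial>lborel)"
proof -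
  let ?f = "\<lambda>x. indicator {a..b} x *\<^sub>R f x"
  have H: "has_bochner_integral lborel ?f (F b - F a)"
    by (rule has_bochner_integral_FTC_Icc[OF assms])
  then have "ennreal (norm (integral\<^sup>L lborel ?f)) \<le> (\<integral>\<^sup>+x. ennreal (norm (?f x)) \<partial>lborel)"
    by (intro integral_norm_bound_ennreal) (simp add: has_bochner_integral_iff)
  also have "(\<integral>\<^sup>+x. ennreal (norm (?f x)) \<partial>lborel) = (\<integral>\<^sup>+x. indicator {a..b} x * ennreal \<bar>f x\<bar> \<partial>lborel)"
    by (intro nn_integral_cong) (auto simp: indicator_def)
  finally show ?thesis using H by (simp add: has_bochner_integral_iff)
qed

section \<open>Integrals with a power weight\<close>

text \<open>
  Every norm of the problem comes from an integral with weight \<open>|x|\<^bsup>c\<^esup>\<close>. The value \<open>0\<close> that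
  the weight has at the origin is a convention about a null set.
\<close>

definition wint :: "real \<Rightarrow> (real ^ 'n \<Rightarrow> real) \<Rightarrow> ennreal"
  where "wint c f = (\<integral>\<^sup>+x. ennreal (norm x powr c * f x) \<partial>lborel)"

abbreviation energy :: "real \<Rightarrow> (real ^ 'n \<Rightarrow> real ^ 'n) \<Rightarrow> ennreal"
  where "energy a G \<equiv> wint (- 2 * a) (\<lambda>x. (norm (G x))\<^sup>2)"

lemma wint_mono: "(\<And>x. x \<noteq> 0 \<Longrightarrow> f x \<le> g x) \<Longrightarrow> wint c f \<le> wint c g"
  unfolding wint_def
  by (intro nn_integral_mono ennreal_leI) (metis mult_left_mono mult_zero_left norm_zero order_refl powr_0 powr_ge_zero)

lemma wint_cmult:
  assumes [measurable]: "f \<in> borel_measurable borel" and "k \<ge> 0"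
  shows "wint c (\<lambda>x. k * f x) = ennreal k * wint c f"
proof -
  have "ennreal (norm x powr c * (k * f x)) = ennreal k * ennreal (norm x powr c * f x)" for x
    using assms(2) by (simp add: ennreal_mult'[symmetric] mult.left_commute)
  then show ?thesis unfolding wint_def by (simp add: nn_integral_cmult)
qed

lemma wint_add:
  assumes [measurable]: "f \<in> borel_measurable borel" "g \<in> borel_measurable borel"
    and "\<And>x. f x \<ge> 0" "\<And>x. g x \<ge> 0"
  shows "wint c (\<lambda>x. f x + g x) = wint c f + wint c g"
proof -
  have "ennreal (norm x powr c * (f x + g x)) = ennreal (norm x powr c * f x) + ennreal (norm x powr c * g x)" for x
    using assms by (simp add: ennreal_plus[symmetric] distrib_left del: ennreal_plus)
  then show ?thesis unfolding wint_def by (simp add: nn_integral_add)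
qed

lemma wint_dilation:
  fixes f :: "real ^ 'n \<Rightarrow> real"
  assumes [measurable]: "f \<in> borel_measurable borel" and r: "r > 0"
  shows "wint c (\<lambda>x. f (r *\<^sub>R x)) = ennreal (r powr (- real CARD('n) - c)) * wint c f"
proof -
  have "wint c (\<lambda>x. f (r *\<^sub>R x)) = (\<integral>\<^sup>+x. ennreal (r powr - c) * ennreal (norm (r *\<^sub>R x) powr c * f (r *\<^sub>R x)) \<partial>lborel)"
    unfolding wint_def using r
    by (intro nn_integral_cong) (simp add: ennreal_mult'[symmetric] powr_mult powr_minus mult.assoc[symmetric])
  also have "\<dots> = ennreal (r powr - c) * (\<integral>\<^sup>+x. ennreal (norm (r *\<^sub>R x) powr c * f (r *\<^sub>R x)) \<partial>lborel)"
    by (rule nn_integral_cmult) simp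
  also have "(\<integral>\<^sup>+x. ennreal (norm (r *\<^sub>R x) powr c * f (r *\<^sub>R x)) \<partial>lborel)
      = ennreal (r powr - real CARD('n)) * wint c f"
    unfolding wint_def by (rule nn_integral_dilation[OF _ r, of "\<lambda>x. ennreal (norm x powr c * f x)"]) simp
  finally have "wint c (\<lambda>x. f (r *\<^sub>R x)) = ennreal (r powr - c * r powr - real CARD('n)) * wint c f"
    by (simp add: mult.assoc[symmetric] ennreal_mult'[symmetric])
  also have "r powr - c * r powr - real CARD('n) = r powr (- real CARD('n) - c)"
    by (subst powr_add[symmetric], rule arg_cong[of _ _ "\<lambda>e. r powr e"]) simp
  finally show ?thesis .
qed

section \<open>Functions of class \<open>C\<^sup>1\<close> off the origin\<close>

text \<open>
  The pair \<open>(\<phi>, \<nabla>\<phi>)\<close> for functions that may be singular at the origin: besides the test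
  functions, this covers \<open>|x|\<^bsup>-a\<^esup> \<phi>\<close>, to which the Sobolev inequality is applied.
\<close>

definition punctured_C1 :: "(real ^ 'n \<Rightarrow> real) \<Rightarrow> (real ^ 'n \<Rightarrow> real ^ 'n) \<Rightarrow> bool"
  where "punctured_C1 \<phi> G \<longleftrightarrow>
    (\<forall>x. x \<noteq> 0 \<longrightarrow> (\<phi> has_derivative (\<lambda>h. inner (G x) h)) (at x)) \<and>
    continuous_on (- {0}) G \<and> (\<exists>R. \<forall>x. norm x > R \<longrightarrow> \<phi> x = 0)"

lemma punctured_C1_measurable:
  assumes "punctured_C1 \<phi> G"
  shows "\<phi> \<in> borel_measurable borel" "G \<in> borel_measurable borel"
proof -
  have "continuous_on (- {0}) \<phi>"
    using assms unfolding punctured_C1_def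
    by (intro continuous_at_imp_continuous_on ballI has_derivative_continuous) auto
  then show "\<phi> \<in> borel_measurable borel"
    by (intro borel_measurable_continuous_countable_exceptions[of "{0}"]) auto
  show "G \<in> borel_measurable borel"
    using assms unfolding punctured_C1_def
    by (intro borel_measurable_continuous_countable_exceptions[of "{0}"]) auto
qed

lemma punctured_C1_segment:
  fixes x z :: "real ^ 'n"
  assumes \<phi>: "punctured_C1 \<phi> G" and "\<alpha> \<le> \<beta>"
    and ne: "\<And>r. \<alpha> \<le> r \<Longrightarrow> r \<le> \<beta> \<Longrightarrow> x + r *\<^sub>R z \<noteq> 0"
  shows "ennreal \<bar>\<phi> (x + \<beta> *\<^sub>R z) - \<phi> (x + \<alpha> *\<^sub>R z)\<bar>
    \<le> (\<integral>\<^sup>+r. indicator {\<alpha>..\<beta>} r * ennreal (norm (G (x + r *\<^sub>R z)) * norm z) \<partial>lborel)"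
proof -
  have d: "((\<lambda>r. \<phi> (x + r *\<^sub>R z)) has_vector_derivative inner (G (x + r *\<^sub>R z)) z) (at r within {\<alpha>..\<beta>})"
    if "\<alpha> \<le> r" "r \<le> \<beta>" for r
  proof -
    have "(\<phi> has_derivative (\<lambda>h. inner (G (x + r *\<^sub>R z)) h)) (at (x + r *\<^sub>R z))"
      using \<phi> ne[OF that] by (simp add: punctured_C1_def)
    moreover have "((\<lambda>r. x + r *\<^sub>R z) has_derivative (\<lambda>h. h *\<^sub>R z)) (at r within {\<alpha>..\<beta>})"
      by (auto intro!: derivative_eq_intros)
    ultimately have "((\<lambda>r. \<phi> (x + r *\<^sub>R z)) has_derivative (\<lambda>h. inner (G (x + r *\<^sub>R z)) (h *\<^sub>R z)))
        (at r within {\<alpha>..\<beta>})"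
      using has_derivative_compose by blast
    then show ?thesis by (simp add: has_vector_derivative_def)
  qed
  have c: "continuous_on {\<alpha>..\<beta>} (\<lambda>r. inner (G (x + r *\<^sub>R z)) z)"
  proof -
    have "continuous_on {\<alpha>..\<beta>} (\<lambda>r. G (x + r *\<^sub>R z))"
      by (rule continuous_on_compose2[of "- {0}" G]) (use \<phi> ne in \<open>auto simp: punctured_C1_def intro!: continuous_intros\<close>)
    then show ?thesis by (intro continuous_intros)
  qed
  have "ennreal \<bar>\<phi> (x + \<beta> *\<^sub>R z) - \<phi> (x + \<alpha> *\<^sub>R z)\<bar>
      \<le> (\<integral>\<^sup>+r. indicator {\<alpha>..\<beta>} r * ennreal \<bar>inner (G (x + r *\<^sub>R z)) z\<bar> \<partial>lborel)"
    by (rule nn_integral_abs_FTC[OF \<open>\<alpha> \<le> \<beta>\<close> d c])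
  also have "\<dots> \<le> (\<integral>\<^sup>+r. indicator {\<alpha>..\<beta>} r * ennreal (norm (G (x + r *\<^sub>R z)) * norm z) \<partial>lborel)"
    by (intro nn_integral_mono mult_left_mono ennreal_leI Cauchy_Schwarz_ineq2) auto
  finally show ?thesis .
qed

text \<open>
  Fatou's lemma in the form in which estimates for test functions pass to their limits.
\<close>

lemma nn_integral_Fatou_bound:
  fixes f :: "nat \<Rightarrow> 'a \<Rightarrow> real"
  assumes [measurable]: "\<And>n. f n \<in> borel_measurable M" "F \<in> borel_measurable M"
    and lim: "AE x in M. (\<lambda>n. f n x) \<longlonglongrightarrow> F x"
    and le: "\<forall>\<^sub>F n in sequentially. (\<integral>\<^sup>+x. ennreal (f n x) \<partial>M) \<le> ennreal (c n)" and c: "c \<longlonglongrightarrow> C"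
  shows "(\<integral>\<^sup>+x. ennreal (F x) \<partial>M) \<le> ennreal C"
proof -
  have "(\<integral>\<^sup>+x. ennreal (F x) \<partial>M) = (\<integral>\<^sup>+x. liminf (\<lambda>n. ennreal (f n x)) \<partial>M)"
  proof (rule nn_integral_cong_AE)
    show "AE x in M. ennreal (F x) = liminf (\<lambda>n. ennreal (f n x))"
      using lim by eventually_elim (rule lim_imp_Liminf[symmetric], auto intro: tendsto_ennrealI)
  qed
  also have "\<dots> \<le> liminf (\<lambda>n. \<integral>\<^sup>+x. ennreal (f n x) \<partial>M)"
    by (rule nn_integral_liminf) auto
  also have "\<dots> \<le> liminf (\<lambda>n. ennreal (c n))"
    by (rule Liminf_mono) (use le in auto)
  also have "\<dots> = ennreal C"
    by (rule lim_imp_Liminf) (use c in \<open>auto intro: tendsto_ennrealI\<close>)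
  finally show ?thesis .
qed

section \<open>Integration along rays and Hardy's inequality\<close>

text \<open>
  If \<open>f\<close> is dominated by an average of the dilates of \<open>h\<close>, then Tonelli's theorem bounds the
  weighted integral of \<open>f\<close> by that of \<open>h\<close>, because each dilate of \<open>h\<close> has an explicit power
  of \<open>r\<close> times the weighted integral of \<open>h\<close>.
\<close>

lemma wint_radial_average:
  fixes f h :: "real ^ 'n \<Rightarrow> real"
  assumes [measurable]: "h \<in> borel_measurable borel" "\<rho> \<in> borel_measurable borel"
    and h: "\<And>x. h x \<ge> 0" and \<rho>: "\<And>r. \<rho> r \<ge> 0" "\<And>r. r \<le> 0 \<Longrightarrow> \<rho> r = 0"
    and f: "\<And>x. x \<noteq> 0 \<Longrightarrow> ennreal (f x) \<le> A * (\<integral>\<^sup>+r. ennreal (\<rho> r * h (r *\<^sub>R x)) \<partial>lborel)"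
  shows "wint c f \<le> A * (\<integral>\<^sup>+r. ennreal (\<rho> r * r powr (- real CARD('n) - c)) \<partial>lborel) * wint c h"
proof -
  have "wint c f \<le> (\<integral>\<^sup>+x. A * (\<integral>\<^sup>+r. ennreal (norm x powr c * (\<rho> r * h (r *\<^sub>R x))) \<partial>lborel) \<partial>lborel)"
    unfolding wint_def
  proof (rule nn_integral_mono)
    fix x :: "real^'n"
    show "ennreal (norm x powr c * f x) \<le> A * (\<integral>\<^sup>+r. ennreal (norm x powr c * (\<rho> r * h (r *\<^sub>R x))) \<partial>lborel)"
    proof (cases "x = 0")
      case False
      have "ennreal (norm x powr c * f x) = ennreal (norm x powr c) * ennreal (f x)"
        by (simp add: ennreal_mult')
      also have "\<dots> \<le> ennreal (norm x powr c) * (A * (\<integral>\<^sup>+r. ennreal (\<rho> r * h (r *\<^sub>R x)) \<partial>lborel))"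
        by (intro mult_left_mono f False) auto
      also have "\<dots> = A * (ennreal (norm x powr c) * (\<integral>\<^sup>+r. ennreal (\<rho> r * h (r *\<^sub>R x)) \<partial>lborel))"
        by (simp add: mult.left_commute)
      also have "ennreal (norm x powr c) * (\<integral>\<^sup>+r. ennreal (\<rho> r * h (r *\<^sub>R x)) \<partial>lborel)
          = (\<integral>\<^sup>+r. ennreal (norm x powr c * (\<rho> r * h (r *\<^sub>R x))) \<partial>lborel)"
        by (subst nn_integral_cmult[symmetric]) (auto simp: ennreal_mult')
      finally show ?thesis .
    qed simp
  qed
  also have "\<dots> = A * (\<integral>\<^sup>+x. (\<integral>\<^sup>+r. ennreal (norm x powr c * (\<rho> r * h (r *\<^sub>R x))) \<partial>lborel) \<partial>lborel)"
    by (rule nn_integral_cmult) measurable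
  also have "(\<integral>\<^sup>+x. (\<integral>\<^sup>+r. ennreal (norm x powr c * (\<rho> r * h (r *\<^sub>R x))) \<partial>lborel) \<partial>lborel)
      = (\<integral>\<^sup>+r. (\<integral>\<^sup>+x. ennreal (norm x powr c * (\<rho> r * h (r *\<^sub>R x))) \<partial>lborel) \<partial>lborel)"
    by (rule lborel_pair.Fubini') measurable
  also have "\<dots> = (\<integral>\<^sup>+r. ennreal (\<rho> r * r powr (- real CARD('n) - c)) * wint c h \<partial>lborel)"
  proof (rule nn_integral_cong)
    fix r :: real
    show "(\<integral>\<^sup>+x. ennreal (norm x powr c * (\<rho> r * h (r *\<^sub>R x))) \<partial>lborel)
        = ennreal (\<rho> r * r powr (- real CARD('n) - c)) * wint c h"
    proof (cases "r > 0")
      case True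
      have "(\<integral>\<^sup>+x. ennreal (norm x powr c * (\<rho> r * h (r *\<^sub>R x))) \<partial>lborel)
          = wint c (\<lambda>x. \<rho> r * h (r *\<^sub>R x))" by (simp add: wint_def)
      also have "\<dots> = ennreal (\<rho> r) * wint c (\<lambda>x. h (r *\<^sub>R x))"
        by (rule wint_cmult) (use \<rho> in auto)
      also have "\<dots> = ennreal (\<rho> r) * (ennreal (r powr (- real CARD('n) - c)) * wint c h)"
        by (simp add: wint_dilation True)
      finally show ?thesis by (simp add: ennreal_mult' \<rho> mult.assoc)
    qed (use \<rho> in auto)
  qed
  also have "\<dots> = (\<integral>\<^sup>+r. ennreal (\<rho> r * r powr (- real CARD('n) - c)) \<partial>lborel) * wint c h"
    by (rule nn_integral_multc) measurable
  finally show ?thesis by (simp add: mult.assoc)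
qed

lemma nn_integral_powr_tail:
  assumes "e > 0" "\<rho> > 0"
  shows "(\<integral>\<^sup>+r. ennreal (indicator {\<rho>..} r * r powr (- 1 - e)) \<partial>lborel) = ennreal (\<rho> powr - e / e)"
proof -
  have "(\<integral>\<^sup>+r. ennreal (r powr (- 1 - e)) * indicator {\<rho>..} r \<partial>lborel) = 0 - (- (\<rho> powr - e) / e)"
  proof (rule nn_integral_FTC_atLeast)
    have "((\<lambda>r::real. r powr - e) \<longlongrightarrow> 0) at_top"
      using assms by (intro tendsto_neg_powr filterlim_ident) auto
    then have "((\<lambda>r::real. - (r powr - e) / e) \<longlongrightarrow> - 0 / e) at_top"
      by (intro tendsto_intros) (use assms in auto)
    then show "((\<lambda>r::real. - (r powr - e) / e) \<longlongrightarrow> 0) at_top" by simp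
  next
    fix x :: real assume "\<rho> \<le> x"
    then show "((\<lambda>r. - (r powr - e) / e) has_real_derivative x powr (- 1 - e)) (at x)"
      using assms by (auto intro!: derivative_eq_intros simp: field_simps) (rule arg_cong[of _ _ "\<lambda>t. x powr t"], simp)
  qed auto
  moreover have "(\<integral>\<^sup>+r. ennreal (indicator {\<rho>..} r * r powr (- 1 - e)) \<partial>lborel)
      = (\<integral>\<^sup>+r. ennreal (r powr (- 1 - e)) * indicator {\<rho>..} r \<partial>lborel)"
    by (intro nn_integral_cong) (auto simp: indicator_def)
  ultimately show ?thesis by simp
qed

lemma wint_radius_gradient:
  fixes G :: "real ^ 'n \<Rightarrow> real ^ 'n"
  shows "wint (- 2 * a - 2) (\<lambda>x. (norm x * norm (G x))\<^sup>2) = energy a G"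
  unfolding wint_def
proof (intro nn_integral_cong)
  fix x :: "real^'n"
  have "norm x powr (- 2 * a - 2) * (norm x)\<^sup>2 = norm x powr (- 2 * a)" 
  proof (cases "x = 0")
    case False
    then have "(norm x)\<^sup>2 = norm x powr 2" by (simp add: powr_numeral)
    then have "norm x powr (- 2 * a - 2) * (norm x)\<^sup>2 = norm x powr (- 2 * a - 2 + 2)"
      by (simp only: powr_add)
    then show ?thesis by simp
  qed simp
  then show "ennreal (norm x powr (- 2 * a - 2) * (norm x * norm (G x))\<^sup>2) = ennreal (norm x powr (- 2 * a) * (norm (G x))\<^sup>2)"
    by (simp add: power_mult_distrib mult.assoc[symmetric])
qed

text \<open>
  For \<open>x \<noteq> 0\<close> the value \<open>\<phi> x\<close> is minus the integral of the radial derivative along the ray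
  from \<open>x\<close> to infinity. The Cauchy--Schwarz inequality with the factors \<open>r\<^bsup>(-1-s)/2\<^esup>\<close> and
  \<open>r\<^bsup>(s-1)/2\<^esup>\<close> makes both resulting radial integrals equal to \<open>1/s\<close>.
\<close>

lemma Hardy_inequality:
  fixes \<phi> :: "real ^ 'n \<Rightarrow> real"
  assumes \<phi>: "punctured_C1 \<phi> G" and s: "s = (real CARD('n) - 2 - 2 * a) / 2" "s > 0"
  shows "wint (- 2 * a - 2) (\<lambda>x. (\<phi> x)\<^sup>2) \<le> ennreal (1 / s\<^sup>2) * energy a G"
proof -
  note [measurable] = punctured_C1_measurable[OF \<phi>]
  define k where "k x = norm x * norm (G x)" for x
  have [measurable]: "k \<in> borel_measurable borel" unfolding k_def by measurable
  obtain R where R: "\<And>x. norm x > R \<Longrightarrow> \<phi> x = 0" using \<phi> unfolding punctured_C1_def by auto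
  have "wint (- 2 * a - 2) (\<lambda>x. (\<phi> x)\<^sup>2)
      \<le> ennreal (1 / s) * (\<integral>\<^sup>+r. ennreal ((indicator {1..} r * r powr (s - 1)) * r powr (- real CARD('n) - (- 2 * a - 2))) \<partial>lborel)
        * wint (- 2 * a - 2) (\<lambda>x. (k x)\<^sup>2)"
  proof (rule wint_radial_average)
    fix x :: "real^'n" assume x: "x \<noteq> 0"
    \<comment> \<open>a point of the ray beyond the support\<close>
    define \<beta> where "\<beta> = max 1 ((\<bar>R\<bar> + 1) / norm x)"
    have "\<beta> \<ge> 1" by (simp add: \<beta>_def)
    have "R < \<bar>R\<bar> + 1" by simp
    also have "\<bar>R\<bar> + 1 \<le> \<beta> * norm x" using x by (auto simp: \<beta>_def max_def field_simps)
    finally have "\<phi> (\<beta> *\<^sub>R x) = 0" using \<open>\<beta> \<ge> 1\<close> by (intro R) auto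
    then have "ennreal \<bar>\<phi> x\<bar> \<le> (\<integral>\<^sup>+r. indicator {1..\<beta>} r * ennreal (norm (G (r *\<^sub>R x)) * norm x) \<partial>lborel)"
      using punctured_C1_segment[OF \<phi> \<open>\<beta> \<ge> 1\<close>, of 0 x] x by auto
    also have "\<dots> \<le> (\<integral>\<^sup>+r. ennreal (indicator {1..} r * r powr ((- 1 - s) / 2)) * ennreal (indicator {1..} r * (r powr ((s - 1) / 2) * k (r *\<^sub>R x))) \<partial>lborel)"
    proof (rule nn_integral_mono)
      fix r :: real
      have "r powr ((- 1 - s) / 2) * (r powr ((s - 1) / 2) * k (r *\<^sub>R x)) = norm (G (r *\<^sub>R x)) * norm x" if "r \<ge> 1"
      proof -
        have "r powr ((- 1 - s) / 2) * r powr ((s - 1) / 2) = r powr - 1"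
          by (simp add: powr_add[symmetric] field_simps)
        also have "r powr - 1 = 1 / r" using that by (simp add: powr_minus_divide)
        finally show ?thesis using that by (simp add: k_def mult.assoc[symmetric])
      qed
      then show "indicator {1..\<beta>} r * ennreal (norm (G (r *\<^sub>R x)) * norm x)
          \<le> ennreal (indicator {1..} r * r powr ((- 1 - s) / 2)) * ennreal (indicator {1..} r * (r powr ((s - 1) / 2) * k (r *\<^sub>R x)))"
        by (auto simp: indicator_def ennreal_mult'[symmetric])
    qed
    finally have "(ennreal \<bar>\<phi> x\<bar>)\<^sup>2 \<le> (\<integral>\<^sup>+r. ennreal (indicator {1..} r * r powr ((- 1 - s) / 2)) * ennreal (indicator {1..} r * (r powr ((s - 1) / 2) * k (r *\<^sub>R x))) \<partial>lborel)\<^sup>2"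
      by (rule power_mono) simp
    also have "\<dots> \<le> (\<integral>\<^sup>+r. (ennreal (indicator {1..} r * r powr ((- 1 - s) / 2)))\<^sup>2 \<partial>lborel)
       * (\<integral>\<^sup>+r. (ennreal (indicator {1..} r * (r powr ((s - 1) / 2) * k (r *\<^sub>R x))))\<^sup>2 \<partial>lborel)"
      by (rule Cauchy_Schwarz_nn_integral) measurable
    also have "(\<integral>\<^sup>+r. (ennreal (indicator {1..} r * r powr ((- 1 - s) / 2)))\<^sup>2 \<partial>lborel)
        = (\<integral>\<^sup>+r. ennreal (indicator {1..} r * r powr (- 1 - s)) \<partial>lborel)"
    proof (rule nn_integral_cong)
      fix r :: real
      have "(r powr ((- 1 - s) / 2))\<^sup>2 = r powr (- 1 - s)"
        by (simp add: power2_eq_square powr_add[symmetric])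
      then show "(ennreal (indicator {1..} r * r powr ((- 1 - s) / 2)))\<^sup>2 = ennreal (indicator {1..} r * r powr (- 1 - s))"
        by (auto simp: indicator_def ennreal_power)
    qed
    also have "\<dots> = ennreal (1 / s)"
      using nn_integral_powr_tail[OF s(2), of 1] by simp
    also have "(\<integral>\<^sup>+r. (ennreal (indicator {1..} r * (r powr ((s - 1) / 2) * k (r *\<^sub>R x))))\<^sup>2 \<partial>lborel)
        = (\<integral>\<^sup>+r. ennreal ((indicator {1..} r * r powr (s - 1)) * (k (r *\<^sub>R x))\<^sup>2) \<partial>lborel)"
    proof (rule nn_integral_cong)
      fix r :: real
      have "(r powr ((s - 1) / 2))\<^sup>2 = r powr (s - 1)"
        by (simp add: power2_eq_square powr_add[symmetric])
      then show "(ennreal (indicator {1..} r * (r powr ((s - 1) / 2) * k (r *\<^sub>R x))))\<^sup>2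
         = ennreal ((indicator {1..} r * r powr (s - 1)) * (k (r *\<^sub>R x))\<^sup>2)"
        by (auto simp: indicator_def ennreal_power power_mult_distrib k_def)
    qed
    finally show "ennreal ((\<phi> x)\<^sup>2) \<le> ennreal (1 / s) * (\<integral>\<^sup>+r. ennreal ((indicator {1..} r * r powr (s - 1)) * (k (r *\<^sub>R x))\<^sup>2) \<partial>lborel)"
      by (simp add: ennreal_power)
  qed (auto simp: indicator_def)
  also have "(\<integral>\<^sup>+r. ennreal ((indicator {1..} r * r powr (s - 1)) * r powr (- real CARD('n) - (- 2 * a - 2))) \<partial>lborel)
      = (\<integral>\<^sup>+r. ennreal (indicator {1..} r * r powr (- 1 - s)) \<partial>lborel)"
  proof -
    have "s - 1 + (- real CARD('n) - (- 2 * a - 2)) = - 1 - s" using s(1) by (simp add: field_simps)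
    then have "r powr (s - 1) * r powr (- real CARD('n) - (- 2 * a - 2)) = r powr (- 1 - s)" for r
      by (simp only: powr_add[symmetric])
    then show ?thesis by (simp only: mult.assoc)
  qed
  also have "\<dots> = ennreal (1 / s)"
    using nn_integral_powr_tail[OF s(2), of 1] by simp
  also have "ennreal (1 / s) * ennreal (1 / s) = ennreal (1 / s\<^sup>2)"
    using s(2) by (simp add: ennreal_mult'[symmetric] power2_eq_square)
  also have "wint (- 2 * a - 2) (\<lambda>x. (k x)\<^sup>2) = energy a G"
    unfolding k_def by (rule wint_radius_gradient)
  finally show ?thesis .
qed

text \<open>
  The derivative of \<open>r\<^bsup>s\<^esup> \<phi>(r x)\<close> in \<open>r\<close> is \<open>r\<^bsup>s-1\<^esup>\<close> times the dilate of \<open>s \<phi> + x \<bullet> \<nabla>\<phi>\<close>,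
  whose norm in \<open>L\<^sup>2(|x|\<^bsup>-2a-2\<^esup>)\<close> is controlled by Hardy's inequality; the exponent \<open>s\<close>
  makes these dilations isometries of that space.
\<close>

lemma dilation_difference:
  fixes \<phi> :: "real ^ 'n \<Rightarrow> real"
  assumes \<phi>: "punctured_C1 \<phi> G" and s: "s = (real CARD('n) - 2 - 2 * a) / 2" "s > 0" and l: "l \<ge> 1"
  shows "wint (- 2 * a - 2) (\<lambda>x. (l powr s * \<phi> (l *\<^sub>R x) - \<phi> x)\<^sup>2)
    \<le> ennreal (4 * (l - 1)\<^sup>2) * energy a G"
proof -
  note [measurable] = punctured_C1_measurable[OF \<phi>]
  define k where "k x = s * \<bar>\<phi> x\<bar> + norm x * norm (G x)" for x
  have [measurable]: "k \<in> borel_measurable borel" unfolding k_def by measurable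
  have k0: "k x \<ge> 0" for x using s by (simp add: k_def)
  let ?c = "- 2 * a - 2"
  have av: "wint ?c (\<lambda>x. (l powr s * \<phi> (l *\<^sub>R x) - \<phi> x)\<^sup>2)
      \<le> ennreal (l - 1) * (\<integral>\<^sup>+r. ennreal ((indicator {1..l} r * r powr (2 * s - 2)) * r powr (- real CARD('n) - ?c)) \<partial>lborel)
        * wint ?c (\<lambda>x. (k x)\<^sup>2)"
  proof (rule wint_radial_average)
    fix x :: "real^'n" assume x: "x \<noteq> 0"
    define f' where "f' r = r powr (s - 1) * (s * \<phi> (r *\<^sub>R x) + inner (G (r *\<^sub>R x)) (r *\<^sub>R x))" for r
    have nz: "r *\<^sub>R x \<in> - {0}" if "r \<in> {1..l}" for r using that x by auto
    have dphi: "(\<phi> has_derivative (\<lambda>h. inner (G y) h)) (at y)" if "y \<noteq> 0" for y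
      using \<phi> that by (simp add: punctured_C1_def)
    have "continuous_on (- {0}) \<phi>"
      using dphi by (intro continuous_at_imp_continuous_on ballI has_derivative_continuous) auto
    then have c1: "continuous_on {1..l} (\<lambda>r. \<phi> (r *\<^sub>R x))"
      by (rule continuous_on_compose2) (use nz in \<open>auto intro!: continuous_intros\<close>)
    have c2: "continuous_on {1..l} (\<lambda>r. G (r *\<^sub>R x))"
      by (rule continuous_on_compose2[of "- {0}" G]) (use \<phi> nz in \<open>auto simp: punctured_C1_def intro!: continuous_intros\<close>)
    have cf: "continuous_on {1..l} f'" unfolding f'_def
      by (intro continuous_intros c1 c2) auto
    have df: "((\<lambda>r. r powr s * \<phi> (r *\<^sub>R x)) has_vector_derivative f' r) (at r within {1..l})"
      if r: "1 \<le> r" "r \<le> l" for r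
    proof -
      have "((\<lambda>r. r *\<^sub>R x) has_derivative (\<lambda>h. h *\<^sub>R x)) (at r)"
        by (auto intro!: derivative_eq_intros)
      from has_derivative_compose[OF this dphi] nz[of r] r
      have "((\<lambda>r. \<phi> (r *\<^sub>R x)) has_derivative (\<lambda>h. inner (G (r *\<^sub>R x)) (h *\<^sub>R x))) (at r)" by auto
      then have "((\<lambda>r. \<phi> (r *\<^sub>R x)) has_real_derivative (inner (G (r *\<^sub>R x)) x)) (at r)"
        unfolding has_field_derivative_def by (rule has_derivative_eq_rhs) (simp add: fun_eq_iff)
      note d1 = this
      have d2: "((\<lambda>r. r powr s) has_real_derivative s * r powr (s - 1)) (at r)"
        using r by (auto intro!: derivative_eq_intros)
      have "((\<lambda>r. r powr s * \<phi> (r *\<^sub>R x)) has_real_derivative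
          (s * r powr (s - 1)) * \<phi> (r *\<^sub>R x) + inner (G (r *\<^sub>R x)) x * r powr s) (at r)"
        by (rule DERIV_mult[OF d2 d1])
      moreover have "r powr s = r powr (s - 1) * r" using r by (simp add: powr_diff)
      ultimately show ?thesis
        unfolding has_real_derivative_iff_has_vector_derivative f'_def
        by (auto intro: has_vector_derivative_at_within simp: algebra_simps)
    qed
    have "ennreal \<bar>l powr s * \<phi> (l *\<^sub>R x) - \<phi> x\<bar> \<le> (\<integral>\<^sup>+r. indicator {1..l} r * ennreal \<bar>f' r\<bar> \<partial>lborel)"
      using nn_integral_abs_FTC[OF l df cf] by simp
    also have "\<dots> \<le> (\<integral>\<^sup>+r. indicator {1..l} r * ennreal (indicator {1..l} r * (r powr (s - 1) * k (r *\<^sub>R x))) \<partial>lborel)"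
    proof (rule nn_integral_mono)
      fix r :: real
      have "\<bar>f' r\<bar> \<le> r powr (s - 1) * k (r *\<^sub>R x)"
      proof -
        have "\<bar>s * \<phi> (r *\<^sub>R x) + inner (G (r *\<^sub>R x)) (r *\<^sub>R x)\<bar> \<le> k (r *\<^sub>R x)"
        proof -
          have "\<bar>s * \<phi> (r *\<^sub>R x)\<bar> = s * \<bar>\<phi> (r *\<^sub>R x)\<bar>" using s(2) by (simp add: abs_mult)
          moreover have "\<bar>inner (G (r *\<^sub>R x)) (r *\<^sub>R x)\<bar> \<le> norm (r *\<^sub>R x) * norm (G (r *\<^sub>R x))"
            using Cauchy_Schwarz_ineq2[of "G (r *\<^sub>R x)" "r *\<^sub>R x"] by (simp only: mult.commute)
          ultimately show ?thesis unfolding k_def by linarith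
        qed
        then show ?thesis by (simp add: f'_def abs_mult mult_left_mono)
      qed
      then show "indicator {1..l} r * ennreal \<bar>f' r\<bar> \<le> indicator {1..l} r * ennreal (indicator {1..l} r * (r powr (s - 1) * k (r *\<^sub>R x)))"
        by (auto simp: indicator_def intro: ennreal_leI)
    qed
    finally have "(ennreal \<bar>l powr s * \<phi> (l *\<^sub>R x) - \<phi> x\<bar>)\<^sup>2 \<le> (\<integral>\<^sup>+r. indicator {1..l} r * ennreal (indicator {1..l} r * (r powr (s - 1) * k (r *\<^sub>R x))) \<partial>lborel)\<^sup>2"
      by (rule power_mono) simp
    also have "\<dots> \<le> (\<integral>\<^sup>+r. (indicator {1..l} r)\<^sup>2 \<partial>lborel) * (\<integral>\<^sup>+r. (ennreal (indicator {1..l} r * (r powr (s - 1) * k (r *\<^sub>R x))))\<^sup>2 \<partial>lborel)"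
      by (rule Cauchy_Schwarz_nn_integral) measurable
    also have "(\<integral>\<^sup>+r. (indicator {1..l} r)\<^sup>2 \<partial>lborel) = (\<integral>\<^sup>+r. indicator {1..l} r \<partial>lborel)"
      by (intro nn_integral_cong) (auto simp: indicator_def)
    also have "\<dots> = ennreal (l - 1)" using l by simp
    also have "(\<integral>\<^sup>+r. (ennreal (indicator {1..l} r * (r powr (s - 1) * k (r *\<^sub>R x))))\<^sup>2 \<partial>lborel)
      = (\<integral>\<^sup>+r. ennreal ((indicator {1..l} r * r powr (2 * s - 2)) * (k (r *\<^sub>R x))\<^sup>2) \<partial>lborel)"
    proof (rule nn_integral_cong)
      fix r :: real
      have "(r powr (s - 1))\<^sup>2 = r powr (2 * s - 2)"
        by (simp add: power2_eq_square powr_add[symmetric])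
      then show "(ennreal (indicator {1..l} r * (r powr (s - 1) * k (r *\<^sub>R x))))\<^sup>2
         = ennreal ((indicator {1..l} r * r powr (2 * s - 2)) * (k (r *\<^sub>R x))\<^sup>2)"
        by (auto simp: indicator_def ennreal_power power_mult_distrib k0)
    qed
    finally show "ennreal ((l powr s * \<phi> (l *\<^sub>R x) - \<phi> x)\<^sup>2) \<le> ennreal (l - 1) *
        (\<integral>\<^sup>+r. ennreal ((indicator {1..l} r * r powr (2 * s - 2)) * (k (r *\<^sub>R x))\<^sup>2) \<partial>lborel)"
      by (simp add: ennreal_power)
  qed (auto simp: indicator_def)
  have "(\<integral>\<^sup>+r. ennreal ((indicator {1..l} r * r powr (2 * s - 2)) * r powr (- real CARD('n) - ?c)) \<partial>lborel)
      \<le> (\<integral>\<^sup>+r. indicator {1..l} r \<partial>lborel)"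
  proof (rule nn_integral_mono)
    fix r :: real
    have "2 * s - 2 + (- real CARD('n) - ?c) = - 2" using s(1) by (simp add: field_simps)
    then have "r powr (2 * s - 2) * r powr (- real CARD('n) - ?c) = r powr - 2"
      by (simp only: powr_add[symmetric])
    moreover have "r powr - 2 \<le> 1" if "1 \<le> r" using that powr_mono[of "-2" 0 r] by simp
    ultimately show "ennreal ((indicator {1..l} r * r powr (2 * s - 2)) * r powr (- real CARD('n) - ?c)) \<le> indicator {1..l} r"
      by (auto simp: indicator_def mult.assoc)
  qed
  also have "(\<integral>\<^sup>+r. indicator {1..l} r \<partial>lborel) = ennreal (l - 1)" using l by simp
  finally have weight: "(\<integral>\<^sup>+r. ennreal ((indicator {1..l} r * r powr (2 * s - 2)) * r powr (- real CARD('n) - ?c)) \<partial>lborel)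
      \<le> ennreal (l - 1)" .
  have "wint ?c (\<lambda>x. (k x)\<^sup>2) \<le> wint ?c (\<lambda>x. 2 * s\<^sup>2 * (\<phi> x)\<^sup>2 + 2 * (norm x * norm (G x))\<^sup>2)"
  proof (rule wint_mono)
    fix x :: "real^'n"
    show "(k x)\<^sup>2 \<le> 2 * s\<^sup>2 * (\<phi> x)\<^sup>2 + 2 * (norm x * norm (G x))\<^sup>2"
      using sum_squares_bound[of "s * \<bar>\<phi> x\<bar>" "norm x * norm (G x)"]
      by (simp add: k_def power2_sum power_mult_distrib algebra_simps)
  qed
  also have "\<dots> = ennreal (2 * s\<^sup>2) * wint ?c (\<lambda>x. (\<phi> x)\<^sup>2) + ennreal 2 * wint ?c (\<lambda>x. (norm x * norm (G x))\<^sup>2)"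
    by (subst wint_add) (auto simp: wint_cmult simp del: ennreal_numeral)
  also have "\<dots> \<le> ennreal (2 * s\<^sup>2) * (ennreal (1 / s\<^sup>2) * energy a G) + ennreal 2 * energy a G"
    unfolding wint_radius_gradient by (intro add_mono mult_left_mono Hardy_inequality[OF \<phi> s]) auto
  also have "\<dots> = ennreal 4 * energy a G"
  proof -
    have "ennreal (2 * s\<^sup>2) * ennreal (1 / s\<^sup>2) = ennreal 2"
      using s(2) by (subst ennreal_mult'[symmetric]) auto
    then have 1: "ennreal (2 * s\<^sup>2) * (ennreal (1 / s\<^sup>2) * energy a G)
        = ennreal 2 * energy a G"
      by (simp only: mult.assoc[symmetric])
    have 2: "ennreal 2 + ennreal 2 = ennreal 4" by (subst ennreal_plus[symmetric]) auto
    show ?thesis unfolding 1 2[symmetric] distrib_right ..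
  qed
  finally have slope: "wint ?c (\<lambda>x. (k x)\<^sup>2) \<le> ennreal 4 * energy a G" .
  have "wint ?c (\<lambda>x. (l powr s * \<phi> (l *\<^sub>R x) - \<phi> x)\<^sup>2)
      \<le> ennreal (l - 1) * ennreal (l - 1) * (ennreal 4 * energy a G)"
    by (rule order_trans[OF av]) (intro mult_mono weight slope order_refl, auto)
  also have "\<dots> = (ennreal (l - 1) * ennreal (l - 1) * ennreal 4) * energy a G"
    by (rule mult.assoc[symmetric])
  also have "ennreal (l - 1) * ennreal (l - 1) * ennreal 4 = ennreal ((l - 1) * (l - 1) * 4)"
    using l by (subst ennreal_mult'[symmetric], simp)+ (rule refl)
  also have "(l - 1) * (l - 1) * 4 = 4 * (l - 1)\<^sup>2" by (simp add: power2_eq_square)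
  finally show ?thesis .
qed

section \<open>A weak isoperimetric inequality\<close>

lemma AE_notin_span_singleton:
  fixes z :: "'a::euclidean_space"
  assumes "DIM('a) \<ge> 2"
  shows "AE x in lborel. x \<notin> span {z}"
proof -
  have "dim (span {z}) \<le> 1"
    using dim_le_card[of "{z}" "{z}"] by (simp add: dim_span span_superset)
  then have "negligible (span {z})"
    using assms by (intro negligible_lowdim) auto
  then have "AE x in lebesgue. x \<notin> span {z}"
    by (simp add: negligible_iff_null_sets AE_not_in)
  then show ?thesis by (simp add: AE_completion_iff)
qed

text \<open>
  The ray from \<open>x\<close> in direction \<open>z\<close> misses the origin and leaves the support of \<open>F\<close>.
\<close>

lemma ray_average_bound:
  fixes F :: "real ^ 'n \<Rightarrow> real"
  assumes F: "punctured_C1 F G" and z: "z \<noteq> 0" "norm z \<le> 1" and x: "x \<notin> span {z}"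
  shows "ennreal \<bar>F x\<bar> \<le> (\<integral>\<^sup>+r. indicator {0..} r * ennreal (norm (G (x + r *\<^sub>R z))) \<partial>lborel)"
proof -
  obtain R where R: "\<And>x. norm x > R \<Longrightarrow> F x = 0" using F unfolding punctured_C1_def by auto
  \<comment> \<open>far enough along the ray to be outside the support\<close>
  define \<beta> where "\<beta> = (\<bar>R\<bar> + 1 + norm x) / norm z"
  have "\<beta> \<ge> 0" by (simp add: \<beta>_def)
  have "\<bar>R\<bar> + 1 + norm x = norm (\<beta> *\<^sub>R z)" using z \<open>\<beta> \<ge> 0\<close> by (simp add: \<beta>_def)
  also have "\<dots> \<le> norm (x + \<beta> *\<^sub>R z) + norm x"
    using norm_triangle_ineq4[of "x + \<beta> *\<^sub>R z" x] by simp
  finally have "F (x + \<beta> *\<^sub>R z) = 0" by (intro R) linarith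
  moreover have "x + r *\<^sub>R z \<noteq> 0" for r
  proof
    assume "x + r *\<^sub>R z = 0"
    then have "x = (- r) *\<^sub>R z" by (simp add: eq_neg_iff_add_eq_0)
    with x show False by (metis span_base span_mul insertI1)
  qed
  ultimately have "ennreal \<bar>F x\<bar> \<le> (\<integral>\<^sup>+r. indicator {0..\<beta>} r * ennreal (norm (G (x + r *\<^sub>R z)) * norm z) \<partial>lborel)"
    using punctured_C1_segment[OF F \<open>\<beta> \<ge> 0\<close>, of x z] by simp
  also have "\<dots> \<le> (\<integral>\<^sup>+r. indicator {0..} r * ennreal (norm (G (x + r *\<^sub>R z))) \<partial>lborel)"
  proof (rule nn_integral_mono)
    fix r
    have "norm (G (x + r *\<^sub>R z)) * norm z \<le> norm (G (x + r *\<^sub>R z)) * 1"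
      using z by (intro mult_left_mono) auto
    then show "indicator {0..\<beta>} r * ennreal (norm (G (x + r *\<^sub>R z)) * norm z)
        \<le> indicator {0..} r * ennreal (norm (G (x + r *\<^sub>R z)))"
      by (auto simp: indicator_def intro: ennreal_leI)
  qed
  finally show ?thesis .
qed

text \<open>
  The two bounds in the minimum balance at the radius \<open>\<rho> = (e/b)\<^bsup>1/N\<^esup>\<close>.
\<close>

lemma nn_integral_min_powr:
  assumes "N \<ge> 2" "b > 0" "e > 0"
  shows "(\<integral>\<^sup>+r. indicator {0..} r * ennreal (min b (e * r powr - N)) \<partial>lborel) \<le> ennreal (2 * b * (e / b) powr (1 / N))"
proof -
  define \<rho> where "\<rho> = (e / b) powr (1 / N)"
  have \<rho>: "\<rho> > 0" using assms by (simp add: \<rho>_def)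
  have "\<rho> powr N = e / b" using assms by (simp add: \<rho>_def powr_powr)
  then have e: "e * \<rho> powr (1 - N) = b * \<rho>"
    using assms \<rho> by (simp add: powr_diff field_simps)
  have "(\<integral>\<^sup>+r. indicator {0..} r * ennreal (min b (e * r powr - N)) \<partial>lborel)
      \<le> (\<integral>\<^sup>+r. ennreal b * indicator {0..\<rho>} r + ennreal e * ennreal (indicator {\<rho>..} r * r powr (- 1 - (N - 1))) \<partial>lborel)"
  proof (rule nn_integral_mono)
    fix r
    show "indicator {0..} r * ennreal (min b (e * r powr - N))
        \<le> ennreal b * indicator {0..\<rho>} r + ennreal e * ennreal (indicator {\<rho>..} r * r powr (- 1 - (N - 1)))"
    proof (cases "0 \<le> r \<and> r \<le> \<rho>")
      case True
      then have "indicator {0..} r * ennreal (min b (e * r powr - N)) \<le> ennreal b * indicator {0..\<rho>} r"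
        by (auto intro: ennreal_leI)
      then show ?thesis by (rule order_trans) simp
    next
      case False
      then show ?thesis using assms \<rho>
        by (auto simp: indicator_def ennreal_mult'[symmetric] intro!: ennreal_leI)
    qed
  qed
  also have "\<dots> = ennreal b * ennreal \<rho> + ennreal e * ennreal (\<rho> powr - (N - 1) / (N - 1))"
    using nn_integral_powr_tail[of "N - 1" \<rho>] \<rho> assms
    by (subst nn_integral_add) (auto simp: nn_integral_cmult simp del: minus_diff_eq diff_diff_eq2)
  also have "\<dots> = ennreal (b * \<rho> + e * (\<rho> powr (1 - N) / (N - 1)))"
    using assms \<rho> by (simp add: ennreal_mult'[symmetric] ennreal_plus[symmetric] del: ennreal_plus)
  also have "\<dots> \<le> ennreal (2 * b * \<rho>)"
  proof (rule ennreal_leI)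
    have "e * (\<rho> powr (1 - N) / (N - 1)) = b * \<rho> / (N - 1)" using e by simp
    also have "\<dots> \<le> b * \<rho> / 1" using assms \<rho> by (intro divide_left_mono) auto
    finally show "b * \<rho> + e * (\<rho> powr (1 - N) / (N - 1)) \<le> 2 * b * \<rho>" by (simp add: mult.commute)
  qed
  finally show ?thesis by (simp add: \<rho>_def)
qed

text \<open>
  Applied to a smoothed indicator function of \<open>E\<close>, this is the isoperimetric inequality with
  a non-optimal constant. For \<open>x \<in> E\<close> the integral of \<open>|G|\<close> over almost every ray from \<open>x\<close>
  is at least \<open>1\<close>. Averaging over \<open>x \<in> E\<close> and over the directions in the unit ball, of
  measure \<open>b\<close>, and exchanging the order of integration, the contribution of the point
  \<open>y = x + r z\<close> at distance parameter \<open>r\<close> is \<open>|G y|\<close> times the measure of those \<open>z\<close> in the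
  ball with \<open>y - r z \<in> E\<close>. This measure is at most \<open>min b (e r\<^bsup>-N\<^esup>)\<close>, where \<open>e\<close> is the
  measure of \<open>E\<close>, and its integral over \<open>r\<close> is of the order \<open>b (e/b)\<^bsup>1/N\<^esup>\<close>.
\<close>

lemma weak_isoperimetric:
  fixes F :: "real ^ 'n \<Rightarrow> real"
  defines "N \<equiv> real CARD('n)" and "b \<equiv> measure lborel (ball (0::real^'n) 1)"
  assumes F: "punctured_C1 F G" and n: "CARD('n) \<ge> 2"
    and E [measurable]: "E \<in> sets borel" and e: "emeasure lborel E = ennreal e" "e \<ge> 0"
    and F1: "\<And>x. x \<in> E \<Longrightarrow> 1 \<le> \<bar>F x\<bar>"
    and I: "(\<integral>\<^sup>+x. ennreal (norm (G x)) \<partial>lborel) \<le> ennreal I" "I \<ge> 0"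
  shows "e powr (1 - 1 / N) \<le> 2 * b powr (- 1 / N) * I"
proof (cases "e = 0")
  case False
  with e have "e > 0" by simp
  note [measurable] = punctured_C1_measurable[OF F]
  have N: "N \<ge> 2" using n by (simp add: N_def)
  let ?B = "ball (0::real^'n) 1"
  have [measurable]: "?B \<in> sets borel" by simp
  have B: "emeasure lborel ?B = ennreal b"
    unfolding b_def by (rule emeasure_eq_ennreal_measure) (use emeasure_bounded_finite[of ?B] in auto)
  have "b > 0" unfolding b_def by (simp add: content_ball_pos)
  let ?g = "\<lambda>x. ennreal (norm (G x))"
  let ?ray = "\<lambda>x z. \<integral>\<^sup>+r. indicator {0..} r * ?g (x + r *\<^sub>R z) \<partial>lborel"
  let ?mass = "\<lambda>r z. \<integral>\<^sup>+y. indicator E (y + (- r) *\<^sub>R z) * ?g y \<partial>lborel"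
  have "ennreal b * ennreal e = (\<integral>\<^sup>+z. indicator ?B z * (\<integral>\<^sup>+x. indicator E x \<partial>lborel) \<partial>lborel)"
    using B e(1) by (subst nn_integral_multc) auto
  also have "\<dots> \<le> (\<integral>\<^sup>+z. indicator ?B z * (\<integral>\<^sup>+x. indicator E x * ?ray x z \<partial>lborel) \<partial>lborel)"
  proof (rule nn_integral_mono_AE)
    have "AE z in lborel. z \<noteq> (0::real^'n)" by (rule AE_lborel_singleton)
    then show "AE z in lborel. indicator ?B z * (\<integral>\<^sup>+x. indicator E x \<partial>lborel)
      \<le> indicator ?B z * (\<integral>\<^sup>+x. indicator E x * ?ray x z \<partial>lborel)"
    proof eventually_elim
      case (elim z)
      show ?case
      proof (cases "z \<in> ?B")
        case True
        have "AE x in lborel. x \<notin> span {z}" by (rule AE_notin_span_singleton) (use n in simp)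
        then have "AE x in lborel. indicator E x \<le> indicator E x * ?ray x z"
        proof eventually_elim
          case (elim x)
          show ?case
          proof (cases "x \<in> E")
            case True
            have "1 \<le> ennreal \<bar>F x\<bar>" using F1[OF True] by simp
            also have "\<dots> \<le> ?ray x z"
              by (rule ray_average_bound[OF F \<open>z \<noteq> 0\<close> _ elim]) (use \<open>z \<in> ?B\<close> in auto)
            finally show ?thesis using True by simp
          qed simp
        qed
        then show ?thesis by (intro mult_left_mono nn_integral_mono_AE) auto
      qed simp
    qed
  qed
  also have "\<dots> = (\<integral>\<^sup>+z. indicator ?B z * (\<integral>\<^sup>+r. indicator {0..} r * (\<integral>\<^sup>+x. indicator E x * ?g (x + r *\<^sub>R z) \<partial>lborel) \<partial>lborel) \<partial>lborel)"
  proof (intro nn_integral_cong arg_cong2[where f="(*)"] refl)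
    fix z :: "real^'n"
    have "(\<integral>\<^sup>+x. indicator E x * ?ray x z \<partial>lborel)
        = (\<integral>\<^sup>+x. (\<integral>\<^sup>+r. indicator {0..} r * (indicator E x * ?g (x + r *\<^sub>R z)) \<partial>lborel) \<partial>lborel)"
      by (subst nn_integral_cmult[symmetric]) (auto simp: mult.left_commute)
    also have "\<dots> = (\<integral>\<^sup>+r. (\<integral>\<^sup>+x. indicator {0..} r * (indicator E x * ?g (x + r *\<^sub>R z)) \<partial>lborel) \<partial>lborel)"
      by (rule lborel_pair.Fubini') measurable
    also have "\<dots> = (\<integral>\<^sup>+r. indicator {0..} r * (\<integral>\<^sup>+x. indicator E x * ?g (x + r *\<^sub>R z) \<partial>lborel) \<partial>lborel)"
      by (subst nn_integral_cmult) auto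
    finally show "(\<integral>\<^sup>+x. indicator E x * ?ray x z \<partial>lborel) = \<dots>" .
  qed
  also have "\<dots> = (\<integral>\<^sup>+z. indicator ?B z * (\<integral>\<^sup>+r. indicator {0..} r * ?mass r z \<partial>lborel) \<partial>lborel)"
  proof -
    have "(\<integral>\<^sup>+x. indicator E x * ?g (x + r *\<^sub>R z) \<partial>lborel) = ?mass r z" for z :: "real^'n" and r :: real
      using nn_integral_shift[of "\<lambda>y. indicator E (y + (- r) *\<^sub>R z) * ?g y" "r *\<^sub>R z"] by simp
    then show ?thesis by (simp only:)
  qed
  also have "\<dots> = (\<integral>\<^sup>+r. indicator {0..} r * (\<integral>\<^sup>+z. indicator ?B z * ?mass r z \<partial>lborel) \<partial>lborel)"
  proof -
    have "(\<integral>\<^sup>+z. indicator ?B z * (\<integral>\<^sup>+r. indicator {0..} r * ?mass r z \<partial>lborel) \<partial>lborel)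
        = (\<integral>\<^sup>+z. (\<integral>\<^sup>+r. indicator {0..} r * (indicator ?B z * ?mass r z) \<partial>lborel) \<partial>lborel)"
      by (subst nn_integral_cmult[symmetric]) (auto simp: mult.left_commute)
    also have "\<dots> = (\<integral>\<^sup>+r. (\<integral>\<^sup>+z. indicator {0..} r * (indicator ?B z * ?mass r z) \<partial>lborel) \<partial>lborel)"
      by (rule lborel_pair.Fubini') measurable
    also have "\<dots> = (\<integral>\<^sup>+r. indicator {0..} r * (\<integral>\<^sup>+z. indicator ?B z * ?mass r z \<partial>lborel) \<partial>lborel)"
      by (subst nn_integral_cmult) auto
    finally show ?thesis .
  qed
  also have "\<dots> \<le> (\<integral>\<^sup>+r. (indicator {0..} r * ennreal (min b (e * r powr - N))) * ennreal I \<partial>lborel)"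
  proof (rule nn_integral_mono_AE)
    have "AE r in lborel. r \<noteq> (0::real)" by (rule AE_lborel_singleton)
    then show "AE r in lborel. indicator {0..} r * (\<integral>\<^sup>+z. indicator ?B z * ?mass r z \<partial>lborel)
        \<le> (indicator {0..} r * ennreal (min b (e * r powr - N))) * ennreal I"
    proof eventually_elim
      case (elim r)
      show ?case
      proof (cases "r > 0")
        case True
        have "(\<integral>\<^sup>+z. indicator ?B z * ?mass r z \<partial>lborel)
            = (\<integral>\<^sup>+z. (\<integral>\<^sup>+y. (indicator ?B z * indicator E (y + (- r) *\<^sub>R z)) * ?g y \<partial>lborel) \<partial>lborel)"
          by (subst nn_integral_cmult[symmetric]) (auto simp: mult.assoc)
        also have "\<dots> = (\<integral>\<^sup>+y. (\<integral>\<^sup>+z. (indicator ?B z * indicator E (y + (- r) *\<^sub>R z)) * ?g y \<partial>lborel) \<partial>lborel)"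
          by (rule lborel_pair.Fubini') measurable
        also have "\<dots> = (\<integral>\<^sup>+y. (\<integral>\<^sup>+z. (indicator ?B z * indicator E (y + (- r) *\<^sub>R z)) \<partial>lborel) * ?g y \<partial>lborel)"
          by (subst nn_integral_multc) auto
        also have "\<dots> \<le> (\<integral>\<^sup>+y. ennreal (min b (e * r powr - N)) * ?g y \<partial>lborel)"
        proof (intro nn_integral_mono mult_right_mono)
          fix y :: "real^'n"
          have "(\<integral>\<^sup>+z. (indicator ?B z * indicator E (y + (- r) *\<^sub>R z)) \<partial>lborel) \<le> (\<integral>\<^sup>+z. indicator ?B z \<partial>lborel)"
            by (intro nn_integral_mono) (auto simp: indicator_def)
          also have "\<dots> = ennreal b" using B by simp
          finally have 1: "(\<integral>\<^sup>+z. (indicator ?B z * indicator E (y + (- r) *\<^sub>R z)) \<partial>lborel) \<le> ennreal b" .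
          have "(\<integral>\<^sup>+z. (indicator ?B z * indicator E (y + (- r) *\<^sub>R z)) \<partial>lborel) \<le> (\<integral>\<^sup>+z. indicator E (y + (- r) *\<^sub>R z) \<partial>lborel)"
            by (intro nn_integral_mono) (auto simp: indicator_def)
          also have "\<dots> = ennreal (r powr - N) * ennreal e"
            using nn_integral_affine[of "indicator E" "- r" y] True e by (simp add: N_def)
          also have "\<dots> = ennreal (e * r powr - N)" by (simp add: ennreal_mult'' mult.commute)
          finally show "(\<integral>\<^sup>+z. (indicator ?B z * indicator E (y + (- r) *\<^sub>R z)) \<partial>lborel) \<le> ennreal (min b (e * r powr - N))"
            using 1 by (simp add: min_def)
        qed simp
        also have "\<dots> = ennreal (min b (e * r powr - N)) * (\<integral>\<^sup>+y. ?g y \<partial>lborel)"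
          by (rule nn_integral_cmult) measurable
        also have "\<dots> \<le> ennreal (min b (e * r powr - N)) * ennreal I"
          by (intro mult_left_mono I) simp
        finally show ?thesis using True by simp
      qed (use elim in auto)
    qed
  qed
  also have "\<dots> = (\<integral>\<^sup>+r. indicator {0..} r * ennreal (min b (e * r powr - N)) \<partial>lborel) * ennreal I"
    by (rule nn_integral_multc) measurable
  also have "\<dots> \<le> ennreal (2 * b * (e / b) powr (1 / N)) * ennreal I"
    by (intro mult_right_mono nn_integral_min_powr N \<open>b > 0\<close> \<open>e > 0\<close>) simp
  finally have "ennreal (b * e) \<le> ennreal (2 * b * (e / b) powr (1 / N) * I)"
    using \<open>b > 0\<close> I(2) by (simp add: ennreal_mult')
  then have "b * e \<le> 2 * b * (e / b) powr (1 / N) * I"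
    using \<open>b > 0\<close> I(2) by (subst (asm) ennreal_le_iff) auto
  then have "e \<le> 2 * (e / b) powr (1 / N) * I" using \<open>b > 0\<close> by simp
  also have "(e / b) powr (1 / N) = e powr (1 / N) * b powr (- 1 / N)"
    using \<open>b > 0\<close> \<open>e > 0\<close> by (simp add: powr_divide powr_minus_divide)
  finally have "e * e powr (- (1 / N)) \<le> (2 * (e powr (1 / N) * b powr (- 1 / N)) * I) * e powr (- (1 / N))"
    by (rule mult_right_mono) simp
  also have "\<dots> = 2 * b powr (- 1 / N) * I"
    using \<open>e > 0\<close> by (simp add: powr_minus field_simps)
  also have "e * e powr (- (1 / N)) = e powr (1 - 1 / N)"
    using \<open>e > 0\<close> by (simp add: powr_diff powr_minus field_simps)
  finally show ?thesis .
qed (use I in auto)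

section \<open>Truncation at dyadic levels and the Sobolev inequality\<close>

lemma DERIV_max_square: "((\<lambda>y::real. (max 0 y)\<^sup>2) has_real_derivative 2 * max 0 y) (at y)"
proof -
  consider "y < 0" | "y > 0" | "y = 0" by linarith
  then show ?thesis
  proof cases
    case 1
    have "((\<lambda>y::real. 0) has_real_derivative 2 * max 0 y) (at y)" using 1 by simp
    then show ?thesis
      by (rule has_field_derivative_transform_within_open[where S="{..<0}"]) (use 1 in auto)
  next
    case 2
    have "((\<lambda>y::real. y\<^sup>2) has_real_derivative 2 * max 0 y) (at y)"
      using 2 by (auto intro!: derivative_eq_intros)
    then show ?thesis
      by (rule has_field_derivative_transform_within_open[where S="{0<..}"]) (use 2 in auto)
  next
    case 3
    have "((\<lambda>h::real. (max 0 h)\<^sup>2 / h) \<longlongrightarrow> 0) (at 0)"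
    proof (rule Lim_null_comparison)
      show "\<forall>\<^sub>F h in at 0. norm ((max 0 h)\<^sup>2 / h) \<le> \<bar>h::real\<bar>"
        by (rule always_eventually) (auto simp: max_def power2_eq_square)
      show "((\<lambda>h::real. \<bar>h\<bar>) \<longlongrightarrow> 0) (at 0)"
        by (rule tendsto_rabs_zero) (rule tendsto_ident_at)
    qed
    then show ?thesis using 3 by (simp add: has_field_derivative_iff)
  qed
qed

text \<open>
  A transition of class \<open>C\<^sup>1\<close> from \<open>0\<close> on \<open>y \<le> 0\<close> to \<open>1\<close> on \<open>y \<ge> 2\<close>, whose derivative is the
  tent function on \<open>[0, 2]\<close>.
\<close>

definition ramp :: "real \<Rightarrow> real"
  where "ramp y = ((max 0 y)\<^sup>2 - 2 * (max 0 (y - 1))\<^sup>2 + (max 0 (y - 2))\<^sup>2) / 2"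

definition tent :: "real \<Rightarrow> real"
  where "tent y = max 0 y - 2 * max 0 (y - 1) + max 0 (y - 2)"

lemma DERIV_ramp: "(ramp has_real_derivative tent y) (at y)"
proof -
  have *: "((\<lambda>y::real. (max 0 (y - c))\<^sup>2) has_real_derivative 2 * max 0 (y - c)) (at y)" for c
    using DERIV_shift[of "\<lambda>y. (max 0 y)\<^sup>2" "2 * max 0 (y - c)" y "- c"] DERIV_max_square[of "y - c"] by simp
  have "((\<lambda>y. ((max 0 y)\<^sup>2 - 2 * (max 0 (y - 1))\<^sup>2 + (max 0 (y - 2))\<^sup>2) / 2) has_real_derivative
      (2 * max 0 y - 2 * (2 * max 0 (y - 1)) + 2 * max 0 (y - 2)) / 2) (at y)"
    by (intro DERIV_cdivide DERIV_add DERIV_diff DERIV_cmult * DERIV_max_square)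
  then show ?thesis
    by (simp add: ramp_def[abs_def] tent_def algebra_simps add_divide_distrib diff_divide_distrib)
qed

lemma ramp_eq_0: "y \<le> 0 \<Longrightarrow> ramp y = 0"
  and ramp_eq_1: "y \<ge> 2 \<Longrightarrow> ramp y = 1"
  by (auto simp: ramp_def max_def power2_eq_square algebra_simps)

lemma tent_bounds: "0 \<le> tent y" "tent y \<le> 1"
  and tent_eq_0: "y \<le> 0 \<or> y \<ge> 2 \<Longrightarrow> tent y = 0"
  by (auto simp: tent_def max_def)

lemma continuous_on_tent: "continuous_on S tent"
  unfolding tent_def by (intro continuous_intros)

text \<open>
  Composing with \<open>(y/\<tau>)\<^sup>2\<close> truncates \<open>|v|\<close> between the levels \<open>\<tau>\<close> and \<open>2\<tau>\<close> without
  introducing the absolute value, which is not differentiable.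
\<close>

lemma punctured_C1_ramp:
  fixes v :: "real ^ 'n \<Rightarrow> real"
  assumes v: "punctured_C1 v V" and \<tau>: "\<tau> > 0"
  shows "punctured_C1 (\<lambda>x. ramp ((v x / \<tau>)\<^sup>2 - 1)) (\<lambda>x. (tent ((v x / \<tau>)\<^sup>2 - 1) * (2 * v x / \<tau>\<^sup>2)) *\<^sub>R V x)"
  unfolding punctured_C1_def
proof (intro conjI allI impI)
  fix x :: "real^'n" assume x: "x \<noteq> 0"
  have dv: "(v has_derivative (\<lambda>h. inner (V x) h)) (at x)" using v x by (simp add: punctured_C1_def)
  have dq: "((\<lambda>y. (y / \<tau>)\<^sup>2 - 1) has_real_derivative (2 * v x / \<tau>\<^sup>2)) (at (v x))"
    using \<tau> by (auto intro!: derivative_eq_intros simp: power2_eq_square field_simps)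
  have "((\<lambda>y. ramp ((y / \<tau>)\<^sup>2 - 1)) has_real_derivative tent ((v x / \<tau>)\<^sup>2 - 1) * (2 * v x / \<tau>\<^sup>2)) (at (v x))"
    by (rule DERIV_chain2[OF DERIV_ramp dq])
  then have "((\<lambda>y. ramp ((y / \<tau>)\<^sup>2 - 1)) has_derivative (\<lambda>h. tent ((v x / \<tau>)\<^sup>2 - 1) * (2 * v x / \<tau>\<^sup>2) * h)) (at (v x))"
    unfolding has_field_derivative_def .
  from has_derivative_compose[OF dv this]
  show "((\<lambda>x. ramp ((v x / \<tau>)\<^sup>2 - 1)) has_derivative inner ((tent ((v x / \<tau>)\<^sup>2 - 1) * (2 * v x / \<tau>\<^sup>2)) *\<^sub>R V x)) (at x)"
    by (rule has_derivative_eq_rhs) (simp only: fun_eq_iff inner_scaleR_left simp_thms)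
next
  have cv: "continuous_on (- {0}) v"
    using v unfolding punctured_C1_def
    by (intro continuous_at_imp_continuous_on ballI has_derivative_continuous) auto
  have cV: "continuous_on (- {0}) V" using v by (simp add: punctured_C1_def)
  have "continuous_on (- {0}) (\<lambda>x. tent ((v x / \<tau>)\<^sup>2 - 1))"
    unfolding divide_inverse by (rule continuous_on_compose2[OF continuous_on_tent[of UNIV]]) (auto intro!: continuous_intros cv)
  then show "continuous_on (- {0}) (\<lambda>x. (tent ((v x / \<tau>)\<^sup>2 - 1) * (2 * v x / \<tau>\<^sup>2)) *\<^sub>R V x)"
    unfolding divide_inverse by (intro continuous_intros cv cV)
next
  obtain R where R: "\<And>x. norm x > R \<Longrightarrow> v x = 0" using v unfolding punctured_C1_def by auto
  then show "\<exists>R. \<forall>x. R < norm x \<longrightarrow> ramp ((v x / \<tau>)\<^sup>2 - 1) = 0"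
    by (intro exI[of _ R]) (auto simp: ramp_eq_0)
qed

lemma superlevel_finite:
  fixes v :: "real ^ 'n \<Rightarrow> real"
  assumes v: "punctured_C1 v V" and t: "t \<ge> 0"
  shows "emeasure lborel {x. t < \<bar>v x\<bar>} = ennreal (measure lborel {x. t < \<bar>v x\<bar>})"
    and "{x. t < \<bar>v x\<bar>} \<in> sets borel"
    and "\<exists>B. \<forall>t\<ge>0. measure lborel {x. t < \<bar>v x\<bar>} \<le> B"
proof -
  note [measurable] = punctured_C1_measurable[OF v]
  obtain R where R: "\<And>x. norm x > R \<Longrightarrow> v x = 0" using v unfolding punctured_C1_def by auto
  have sub: "{x. t < \<bar>v x\<bar>} \<subseteq> cball 0 R" if "t \<ge> 0" for t
    using R that by (auto simp: not_less[symmetric])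
  have m: "{x. t < \<bar>v x\<bar>} \<in> sets borel" for t by measurable
  show "{x. t < \<bar>v x\<bar>} \<in> sets borel" by fact
  have fin: "emeasure lborel (cball (0::real^'n) R) < \<infinity>" by (rule emeasure_bounded_finite) simp
  show "emeasure lborel {x. t < \<bar>v x\<bar>} = ennreal (measure lborel {x. t < \<bar>v x\<bar>})"
    by (rule emeasure_eq_ennreal_measure) (use emeasure_mono[OF sub[OF t], of lborel] fin in \<open>auto simp: top_unique\<close>)
  show "\<exists>B. \<forall>t\<ge>0. measure lborel {x. t < \<bar>v x\<bar>} \<le> B"
    using sub m fin by (intro exI[of _ "measure lborel (cball (0::real^'n) R)"] allI impI measure_mono_fmeasurable) (auto simp: fmeasurable_def)
qed

lemma ennreal_le_of_square_le:
  assumes "x\<^sup>2 \<le> (ennreal c)\<^sup>2" and "c \<ge> 0"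
  shows "x \<le> ennreal c"
proof (cases x)
  case (real r)
  with assms have "ennreal (r\<^sup>2) \<le> ennreal (c\<^sup>2)" by (simp add: ennreal_power)
  then have "r\<^sup>2 \<le> c\<^sup>2" by (simp add: ennreal_le_iff)
  then have "r \<le> c" using assms(2) by (rule power2_le_imp_le)
  then show ?thesis using real by (simp add: ennreal_leI)
next
  case top
  with assms show ?thesis by (simp add: ennreal_power power2_eq_square top_unique ennreal_mult_eq_top_iff)
qed

text \<open>
  The isoperimetric inequality for the truncation, combined with the Cauchy--Schwarz
  inequality on the set where the truncation has a gradient; that set lies in \<open>{\<tau> < |v|}\<close>.
\<close>

lemma superlevel_decay:
  fixes v :: "real ^ 'n \<Rightarrow> real"
  defines "N \<equiv> real CARD('n)" and "b \<equiv> measure lborel (ball (0::real^'n) 1)"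
  defines "m \<equiv> (\<lambda>t. measure lborel {x. t < \<bar>v x\<bar>})"
  assumes v: "punctured_C1 v V" and n: "CARD('n) \<ge> 2" and \<tau>: "\<tau> > 0"
    and g: "(\<integral>\<^sup>+x. indicator {\<tau><..\<tau> * 2} \<bar>v x\<bar> * ennreal ((norm (V x))\<^sup>2) \<partial>lborel) \<le> ennreal g" "g \<ge> 0"
  shows "m (\<tau> * 2) powr (1 - 1 / N) \<le> 8 * b powr (- 1 / N) / \<tau> * sqrt (m \<tau> * g)"
proof -
  note [measurable] = punctured_C1_measurable[OF v]
  let ?F = "\<lambda>x. ramp ((v x / \<tau>)\<^sup>2 - 1)"
  let ?G = "\<lambda>x. (tent ((v x / \<tau>)\<^sup>2 - 1) * (2 * v x / \<tau>\<^sup>2)) *\<^sub>R V x"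
  let ?A = "\<lambda>x. indicator {\<tau><..\<tau> * 2} \<bar>v x\<bar> :: ennreal"
  have F: "punctured_C1 ?F ?G" by (rule punctured_C1_ramp[OF v \<tau>])
  have m0: "m t \<ge> 0" for t by (simp add: m_def)
  have "(\<integral>\<^sup>+x. ennreal (norm (?G x)) \<partial>lborel) \<le> (\<integral>\<^sup>+x. ennreal (4 / \<tau>) * (?A x * ennreal (norm (V x))) \<partial>lborel)"
  proof (rule nn_integral_mono)
    fix x
    show "ennreal (norm (?G x)) \<le> ennreal (4 / \<tau>) * (?A x * ennreal (norm (V x)))"
    proof (cases "\<bar>v x\<bar> \<in> {\<tau><..\<tau> * 2}")
      case True
      have "tent ((v x / \<tau>)\<^sup>2 - 1) * \<bar>2 * v x / \<tau>\<^sup>2\<bar> \<le> 1 * \<bar>2 * v x / \<tau>\<^sup>2\<bar>"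
        by (intro mult_right_mono tent_bounds) simp
      also have "\<dots> \<le> 4 / \<tau>"
        using True \<tau> by (simp add: abs_mult power2_eq_square field_simps)
      finally have "tent ((v x / \<tau>)\<^sup>2 - 1) * \<bar>2 * v x / \<tau>\<^sup>2\<bar> * norm (V x) \<le> 4 / \<tau> * norm (V x)"
        by (rule mult_right_mono) simp
      moreover have "norm (?G x) = tent ((v x / \<tau>)\<^sup>2 - 1) * \<bar>2 * v x / \<tau>\<^sup>2\<bar> * norm (V x)"
        by (simp only: norm_scaleR abs_mult[of "tent ((v x / \<tau>)\<^sup>2 - 1)"] abs_of_nonneg[OF tent_bounds(1)])
      ultimately have "ennreal (norm (?G x)) \<le> ennreal (4 / \<tau> * norm (V x))"
        by (intro ennreal_leI) (simp only:)
      also have "\<dots> = ennreal (4 / \<tau>) * (?A x * ennreal (norm (V x)))"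
        using True \<tau> by (simp add: ennreal_mult''[symmetric])
      finally show ?thesis .
    next
      case False
      have "tent ((v x / \<tau>)\<^sup>2 - 1) = 0"
      proof (rule tent_eq_0)
        consider "\<bar>v x\<bar> \<le> \<tau>" | "\<bar>v x\<bar> \<ge> \<tau> * 2" using False by force
        then show "(v x / \<tau>)\<^sup>2 - 1 \<le> 0 \<or> (v x / \<tau>)\<^sup>2 - 1 \<ge> 2"
        proof cases
          case 1
          then have "\<bar>v x / \<tau>\<bar> \<le> 1" using \<tau> by simp
          then have "(v x / \<tau>)\<^sup>2 \<le> 1" by (simp only: abs_square_le_1)
          then show ?thesis by simp
        next
          case 2
          then have "2 \<le> \<bar>v x / \<tau>\<bar>" using \<tau> by (simp add: field_simps)
          then have "2\<^sup>2 \<le> \<bar>v x / \<tau>\<bar>\<^sup>2" by (intro power_mono) auto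
          then have "4 \<le> (v x / \<tau>)\<^sup>2" by (simp only: power2_abs) simp
          then show ?thesis by linarith
        qed
      qed
      then show ?thesis by simp
    qed
  qed
  also have "\<dots> = ennreal (4 / \<tau>) * (\<integral>\<^sup>+x. ?A x * ennreal (norm (V x)) \<partial>lborel)"
    by (rule nn_integral_cmult) measurable
  finally have G: "(\<integral>\<^sup>+x. ennreal (norm (?G x)) \<partial>lborel)
      \<le> ennreal (4 / \<tau>) * (\<integral>\<^sup>+x. ?A x * ennreal (norm (V x)) \<partial>lborel)" .
  have sq: "(\<integral>\<^sup>+x. ?A x * ennreal (norm (V x)) \<partial>lborel) \<le> ennreal (sqrt (m \<tau> * g))"
  proof -
    have "(\<integral>\<^sup>+x. ?A x * (?A x * ennreal (norm (V x))) \<partial>lborel)\<^sup>2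
        \<le> (\<integral>\<^sup>+x. (?A x)\<^sup>2 \<partial>lborel) * (\<integral>\<^sup>+x. (?A x * ennreal (norm (V x)))\<^sup>2 \<partial>lborel)"
      by (rule Cauchy_Schwarz_nn_integral) measurable
    also have "(\<integral>\<^sup>+x. ?A x * (?A x * ennreal (norm (V x))) \<partial>lborel) = (\<integral>\<^sup>+x. ?A x * ennreal (norm (V x)) \<partial>lborel)"
      by (intro nn_integral_cong) (auto simp: indicator_def)
    also have "(\<integral>\<^sup>+x. (?A x * ennreal (norm (V x)))\<^sup>2 \<partial>lborel) = (\<integral>\<^sup>+x. ?A x * ennreal ((norm (V x))\<^sup>2) \<partial>lborel)"
      by (intro nn_integral_cong) (auto simp: indicator_def ennreal_power)
    finally have CS: "(\<integral>\<^sup>+x. ?A x * ennreal (norm (V x)) \<partial>lborel)\<^sup>2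
        \<le> (\<integral>\<^sup>+x. (?A x)\<^sup>2 \<partial>lborel) * (\<integral>\<^sup>+x. ?A x * ennreal ((norm (V x))\<^sup>2) \<partial>lborel)" .
    have "(\<integral>\<^sup>+x. (?A x)\<^sup>2 \<partial>lborel) \<le> (\<integral>\<^sup>+x. indicator {x. \<tau> < \<bar>v x\<bar>} x \<partial>lborel)"
      by (intro nn_integral_mono) (auto simp: indicator_def)
    also have "\<dots> = ennreal (m \<tau>)"
      using superlevel_finite[OF v, of \<tau>] \<tau> by (simp add: m_def)
    finally have "(\<integral>\<^sup>+x. ?A x * ennreal (norm (V x)) \<partial>lborel)\<^sup>2 \<le> ennreal (m \<tau>) * ennreal g"
      by (intro order_trans[OF CS] mult_mono g) auto
    also have "\<dots> = (ennreal (sqrt (m \<tau> * g)))\<^sup>2"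
      using m0 g(2) by (simp add: ennreal_power ennreal_mult')
    finally show ?thesis by (rule ennreal_le_of_square_le) (use m0 g(2) in simp)
  qed
  have "(\<integral>\<^sup>+x. ennreal (norm (?G x)) \<partial>lborel) \<le> ennreal (4 / \<tau>) * ennreal (sqrt (m \<tau> * g))"
    by (intro order_trans[OF G] mult_left_mono sq) simp
  also have "\<dots> = ennreal (4 / \<tau> * sqrt (m \<tau> * g))"
    using m0 g(2) by (subst ennreal_mult'') auto
  finally have I: "(\<integral>\<^sup>+x. ennreal (norm (?G x)) \<partial>lborel) \<le> ennreal (4 / \<tau> * sqrt (m \<tau> * g))" .
  have "m (\<tau> * 2) powr (1 - 1 / N) \<le> 2 * b powr (- 1 / N) * (4 / \<tau> * sqrt (m \<tau> * g))"
    unfolding N_def b_def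
  proof (rule weak_isoperimetric[OF F n])
    show "{x. \<tau> * 2 < \<bar>v x\<bar>} \<in> sets borel" "emeasure lborel {x. \<tau> * 2 < \<bar>v x\<bar>} = ennreal (m (\<tau> * 2))"
      using superlevel_finite[OF v, of "\<tau> * 2"] \<tau> by (auto simp: m_def)
    fix x assume "x \<in> {x. \<tau> * 2 < \<bar>v x\<bar>}"
    then have "2 \<le> \<bar>v x / \<tau>\<bar>" using \<tau> by (simp add: field_simps)
    then have "2\<^sup>2 \<le> \<bar>v x / \<tau>\<bar>\<^sup>2" by (intro power_mono) auto
    then have "4 \<le> (v x / \<tau>)\<^sup>2" by (simp only: power2_abs) simp
    then have "2 \<le> (v x / \<tau>)\<^sup>2 - 1" by linarith
    then show "1 \<le> \<bar>?F x\<bar>" by (simp add: ramp_eq_1)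
  qed (use I m0 \<tau> g in auto)
  then show ?thesis by (simp add: field_simps)
qed

text \<open>
  A substitute for Hoelder's inequality at exponents that sum to \<open>2\<theta> \<ge> 1\<close>: after normalising
  both sums to \<open>1\<close>, each product is at most \<open>1\<close>, so its power \<open>\<theta>\<close> is at most its square root
  and the arithmetic-geometric mean inequality applies.
\<close>

lemma sum_powr_product_le:
  fixes x y :: "'i \<Rightarrow> real"
  assumes "finite J" and x: "\<And>j. j \<in> J \<Longrightarrow> x j \<ge> 0" and y: "\<And>j. j \<in> J \<Longrightarrow> y j \<ge> 0" and \<theta>: "\<theta> \<ge> 1 / 2"
  shows "(\<Sum>j\<in>J. (x j * y j) powr \<theta>) \<le> sum x J powr \<theta> * sum y J powr \<theta>"
proof -
  define X Y where "X = sum x J" and "Y = sum y J"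
  have XY: "X \<ge> 0" "Y \<ge> 0" by (auto simp: X_def Y_def intro!: sum_nonneg x y)
  show ?thesis
  proof (cases "X = 0 \<or> Y = 0")
    case True
    then have "x j * y j = 0" if "j \<in> J" for j
      using that \<open>finite J\<close> x y by (auto simp: X_def Y_def sum_nonneg_eq_0_iff)
    then have "(\<Sum>j\<in>J. (x j * y j) powr \<theta>) = 0" by (intro sum.neutral) auto
    then show ?thesis by simp
  next
    case False
    then have pos: "X > 0" "Y > 0" using XY by auto
    have summand: "(x j * y j) powr \<theta> \<le> X powr \<theta> * Y powr \<theta> * ((x j / X + y j / Y) / 2)" if j: "j \<in> J" for j
    proof -
      define u w where "u = x j / X" and "w = y j / Y"
      have u: "0 \<le> u" "u \<le> 1" and w: "0 \<le> w" "w \<le> 1"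
        using pos x[OF j] y[OF j] member_le_sum[OF j, of x] member_le_sum[OF j, of y] x y \<open>finite J\<close>
        by (auto simp: u_def w_def X_def Y_def)
      have "(u * w) powr \<theta> \<le> (u * w) powr (1 / 2)"
        using u w \<theta> by (intro powr_mono') (auto intro: mult_le_one)
      also have "\<dots> = sqrt (u * w)" using u w by (simp add: powr_half_sqrt)
      also have "\<dots> \<le> (u + w) / 2" using u w by (intro arith_geo_mean_sqrt)
      finally have "X powr \<theta> * Y powr \<theta> * (u * w) powr \<theta> \<le> X powr \<theta> * Y powr \<theta> * ((u + w) / 2)"
        by (intro mult_left_mono) auto
      moreover have "X powr \<theta> * Y powr \<theta> * (u * w) powr \<theta> = (x j * y j) powr \<theta>"
        using pos x[OF j] y[OF j] by (simp add: u_def w_def powr_mult powr_divide)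
      ultimately show ?thesis by (simp add: u_def w_def)
    qed
    have "(\<Sum>j\<in>J. (x j * y j) powr \<theta>) \<le> (\<Sum>j\<in>J. X powr \<theta> * Y powr \<theta> * ((x j / X + y j / Y) / 2))"
      by (intro sum_mono summand)
    also have "\<dots> = X powr \<theta> * Y powr \<theta> * ((sum x J / X + sum y J / Y) / 2)"
      by (simp only: sum_distrib_left[symmetric] sum_divide_distrib[symmetric] sum.distrib)
    also have "\<dots> = X powr \<theta> * Y powr \<theta>"
      using pos by (simp add: X_def[symmetric] Y_def[symmetric])
    finally show ?thesis by (simp add: X_def Y_def)
  qed
qed

lemma sum_dyadic_indicator:
  fixes t y :: real
  assumes "t > 0"
  shows "(\<Sum>j<n. indicator {t * 2 ^ j<..t * 2 ^ Suc j} y) = (indicator {t<..t * 2 ^ n} y :: 'a::{comm_monoid_add,zero_neq_one})"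
proof (induction n)
  case (Suc n)
  have "t \<le> t * 2 ^ n" "t * 2 ^ n \<le> t * 2 ^ Suc n" using assms by simp_all
  then show ?case unfolding sum.lessThan_Suc Suc.IH by (auto simp: indicator_def)
qed (auto simp: indicator_def)

lemma sublinear_bound:
  fixes S a H \<theta> :: real
  assumes S: "S \<le> a + H * S powr \<theta>" and "a \<ge> 0" "H \<ge> 0" and \<theta>: "0 < \<theta>" "\<theta> < 1" and "S \<ge> 0"
  shows "S \<le> 2 * a + (2 * H) powr (1 / (1 - \<theta>))"
proof (cases "S \<le> 2 * a")
  case True
  then show ?thesis by (rule order_trans) simp
next
  case False
  then have "S > 0" using \<open>a \<ge> 0\<close> by linarith
  have "S \<le> 2 * H * S powr \<theta>" using S False by linarith
  then have "S * S powr (- \<theta>) \<le> 2 * H * S powr \<theta> * S powr (- \<theta>)"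
    by (rule mult_right_mono) simp
  then have "S powr (1 - \<theta>) \<le> 2 * H"
    using \<open>S > 0\<close> by (simp add: powr_minus powr_diff field_simps)
  then have "(S powr (1 - \<theta>)) powr (1 / (1 - \<theta>)) \<le> (2 * H) powr (1 / (1 - \<theta>))"
    using \<theta> by (intro powr_mono2) auto
  then have "S \<le> (2 * H) powr (1 / (1 - \<theta>))" using \<open>S > 0\<close> \<theta> by (simp add: powr_powr)
  then show ?thesis using \<open>a \<ge> 0\<close> by linarith
qed

text \<open>
  Put \<open>t\<^sub>j = t 2\<^sup>j\<close>, let \<open>m(t)\<close> be the measure of \<open>{|v| > t}\<close> and let \<open>g(t)\<close> be the part of
  the Dirichlet integral on \<open>{t < |v| \<le> 2t}\<close>. For \<open>a\<^sub>j = t\<^sub>j\<^bsup>q\<^esup> m(t\<^sub>j)\<close> the decay of the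
  superlevel sets reads \<open>a\<^bsub>j+1\<^esub> \<le> H (g(t\<^sub>j) a\<^sub>j)\<^bsup>\<theta>\<^esup>\<close>: the exponent \<open>q\<close> is the one for which
  all powers of \<open>t\<^sub>j\<close> cancel. Summation bounds \<open>S = \<Sum> a\<^sub>j\<close> by \<open>a\<^sub>0 + H e\<^bsup>\<theta>\<^esup> S\<^bsup>\<theta>\<^esup>\<close>, hence by
  a multiple of \<open>a\<^sub>0\<close> plus a multiple of \<open>e\<^bsup>\<theta>/(1-\<theta>)\<^esup> = e\<^bsup>q/2\<^esup>\<close>. The first term
  \<open>a\<^sub>0 \<le> t\<^bsup>q\<^esup> B\<close> disappears as \<open>t \<rightarrow> 0\<close>, since \<open>v\<close> has bounded support.
\<close>

lemma Sobolev_inequality: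
  fixes N q :: real
  defines "N \<equiv> real CARD('n)"
  assumes N: "N \<ge> 3" and q: "q = 2 * N / (N - 2)"
  shows "\<exists>C\<ge>0. \<forall>(v::real^'n \<Rightarrow> real) V e. punctured_C1 v V \<longrightarrow> e \<ge> 0 \<longrightarrow>
    (\<integral>\<^sup>+x. ennreal ((norm (V x))\<^sup>2) \<partial>lborel) \<le> ennreal e \<longrightarrow>
    (\<integral>\<^sup>+x. ennreal (\<bar>v x\<bar> powr q) \<partial>lborel) \<le> ennreal (C * e powr (q / 2))"
proof -
  define b where "b = measure lborel (ball (0::real^'n) 1)"
  define D where "D = 8 * b powr (- 1 / N)"
  define \<theta> where "\<theta> = N / (2 * N - 2)"
  define H where "H = 2 powr q * D powr (2 * \<theta>)"
  define C where "C = 2 powr q * (2 * H) powr (1 / (1 - \<theta>))"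
  have \<theta>: "\<theta> \<ge> 1 / 2" "\<theta> < 1" using N by (auto simp: \<theta>_def field_simps)
  have q\<theta>: "q - 2 * \<theta> = q * \<theta>" using N by (simp add: q \<theta>_def divide_simps) (simp add: algebra_simps)
  have e\<theta>: "\<theta> * (1 / (1 - \<theta>)) = q / 2" using N by (simp add: q \<theta>_def divide_simps)
  have t2: "2 * \<theta> = 1 / (1 - 1 / N)" using N by (simp add: \<theta>_def divide_simps)
  have q0: "q > 0" using N by (simp add: q)
  have D0: "D \<ge> 0" by (simp add: D_def)
  have H0: "H \<ge> 0" by (simp add: H_def)
  have "(\<integral>\<^sup>+x. ennreal (\<bar>v x\<bar> powr q) \<partial>lborel) \<le> ennreal (C * e powr (q / 2))"
    if v: "punctured_C1 v V" and e: "e \<ge> 0" "(\<integral>\<^sup>+x. ennreal ((norm (V x))\<^sup>2) \<partial>lborel) \<le> ennreal e"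
    for v :: "real^'n \<Rightarrow> real" and V e
  proof -
    note [measurable] = punctured_C1_measurable[OF v]
    define m where "m t = measure lborel {x. t < \<bar>v x\<bar>}" for t
    have m0: "m t \<ge> 0" for t by (simp add: m_def)
    obtain B where B: "\<And>t. t \<ge> 0 \<Longrightarrow> m t \<le> B"
      using superlevel_finite(3)[OF v order_refl] by (auto simp: m_def)
    define ann where "ann t x = (indicator {t<..t * 2} \<bar>v x\<bar> :: ennreal)" for t x
    have [measurable]: "ann t \<in> borel_measurable borel" for t unfolding ann_def by measurable
    define g where "g t = enn2real (\<integral>\<^sup>+x. ann t x * ennreal ((norm (V x))\<^sup>2) \<partial>lborel)" for t
    have g: "(\<integral>\<^sup>+x. ann t x * ennreal ((norm (V x))\<^sup>2) \<partial>lborel) = ennreal (g t)" for t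
    proof -
      have "(\<integral>\<^sup>+x. ann t x * ennreal ((norm (V x))\<^sup>2) \<partial>lborel) \<le> (\<integral>\<^sup>+x. ennreal ((norm (V x))\<^sup>2) \<partial>lborel)"
        by (intro nn_integral_mono) (auto simp: ann_def indicator_def)
      then have "(\<integral>\<^sup>+x. ann t x * ennreal ((norm (V x))\<^sup>2) \<partial>lborel) < top"
        using e(2) by (meson ennreal_less_top le_less_trans)
      then show ?thesis by (simp add: g_def)
    qed
    have g0: "g t \<ge> 0" for t by (simp add: g_def)
    have step: "(t * 2) powr q * m (t * 2) \<le> H * (g t * (t powr q * m t)) powr \<theta>" if t: "t > 0" for t
    proof -
      have "m (t * 2) powr (1 - 1 / N) \<le> D / t * sqrt (m t * g t)"
        unfolding m_def D_def b_def N_def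
        by (rule superlevel_decay[OF v _ t]) (use N g g0 in \<open>auto simp: N_def ann_def m_def\<close>)
      then have "(m (t * 2) powr (1 - 1 / N)) powr (1 / (1 - 1 / N)) \<le> (D / t * sqrt (m t * g t)) powr (1 / (1 - 1 / N))"
        using N by (intro powr_mono2) auto
      then have "m (t * 2) \<le> (D / t * sqrt (m t * g t)) powr (2 * \<theta>)"
        using N m0[of "t * 2"] unfolding t2 by (simp add: powr_powr)
      also have "\<dots> = D powr (2 * \<theta>) * t powr (- 2 * \<theta>) * (sqrt (m t * g t)) powr (2 * \<theta>)"
        using t m0[of t] g0[of t] D0 by (simp add: powr_mult powr_divide powr_minus_divide)
      also have "(sqrt (m t * g t)) powr (2 * \<theta>) = (m t * g t) powr \<theta>"
        using m0[of t] g0[of t] by (simp add: powr_half_sqrt[symmetric] powr_powr)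
      finally have "(t * 2) powr q * m (t * 2) \<le> (t * 2) powr q * (D powr (2 * \<theta>) * t powr (- 2 * \<theta>) * (m t * g t) powr \<theta>)"
        by (rule mult_left_mono) simp
      also have "\<dots> = H * ((t powr q * t powr (- 2 * \<theta>)) * (m t * g t) powr \<theta>)"
        using t by (simp add: H_def powr_mult)
      also have "t powr q * t powr (- 2 * \<theta>) = (t powr q) powr \<theta>"
        using q\<theta> by (simp add: powr_add[symmetric] powr_powr)
      also have "(t powr q) powr \<theta> * (m t * g t) powr \<theta> = (g t * (t powr q * m t)) powr \<theta>"
        using m0[of t] g0[of t] by (simp add: powr_mult)
      finally show ?thesis .
    qed
    have block: "(\<integral>\<^sup>+x. ennreal (indicator {t<..t * 2 ^ Suc n} \<bar>v x\<bar> * \<bar>v x\<bar> powr q) \<partial>lborel)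
        \<le> ennreal (2 powr q * (2 * (t powr q * B)) + C * e powr (q / 2))" if t: "t > 0" for t n
    proof -
      let ?t = "\<lambda>j. t * 2 ^ j"
      have tp: "?t j > 0" for j using t by simp
      define a where "a j = ?t j powr q * m (?t j)" for j :: nat
      have a0: "a j \<ge> 0" for j by (simp add: a_def m0)
      have "ennreal (\<Sum>j<n. g (?t j)) = (\<Sum>j<n. (\<integral>\<^sup>+x. ann (?t j) x * ennreal ((norm (V x))\<^sup>2) \<partial>lborel))"
        by (simp add: g g0 sum_ennreal)
      also have "\<dots> = (\<integral>\<^sup>+x. (\<Sum>j<n. ann (?t j) x * ennreal ((norm (V x))\<^sup>2)) \<partial>lborel)"
        by (subst nn_integral_sum) auto
      also have "\<dots> \<le> (\<integral>\<^sup>+x. ennreal ((norm (V x))\<^sup>2) \<partial>lborel)"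
      proof (rule nn_integral_mono)
        fix x
        have "(\<Sum>j<n. ann (?t j) x) = indicator {t<..t * 2 ^ n} \<bar>v x\<bar>"
          using sum_dyadic_indicator[OF t, where n=n and y="\<bar>v x\<bar>"] by (simp add: ann_def mult_ac)
        then have "(\<Sum>j<n. ann (?t j) x) \<le> 1" by (simp add: indicator_def)
        then show "(\<Sum>j<n. ann (?t j) x * ennreal ((norm (V x))\<^sup>2)) \<le> ennreal ((norm (V x))\<^sup>2)"
          using mult_right_mono[of "\<Sum>j<n. ann (?t j) x" 1 "ennreal ((norm (V x))\<^sup>2)"]
          by (simp add: sum_distrib_right)
      qed
      also note e(2)
      finally have sg: "(\<Sum>j<n. g (?t j)) \<le> e" using e(1) by simp
      define S where "S = (\<Sum>j<Suc n. a j)"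
      have S0: "S \<ge> 0" unfolding S_def by (intro sum_nonneg a0)
      have "S = a 0 + (\<Sum>j<n. a (Suc j))" unfolding S_def by (rule sum.lessThan_Suc_shift)
      also have "(\<Sum>j<n. a (Suc j)) \<le> (\<Sum>j<n. H * (g (?t j) * a j) powr \<theta>)"
        using step[OF tp] by (intro sum_mono) (simp add: a_def mult_ac)
      also have "\<dots> = H * (\<Sum>j<n. (g (?t j) * a j) powr \<theta>)" by (simp add: sum_distrib_left)
      also have "(\<Sum>j<n. (g (?t j) * a j) powr \<theta>) \<le> (\<Sum>j<n. g (?t j)) powr \<theta> * (\<Sum>j<n. a j) powr \<theta>"
        by (rule sum_powr_product_le) (use g0 a0 \<theta> in auto)
      also have "\<dots> \<le> e powr \<theta> * S powr \<theta>"
        using sg \<theta> a0 by (intro mult_mono powr_mono2) (auto simp: S_def intro!: sum_nonneg g0)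
      finally have "S \<le> a 0 + (H * e powr \<theta>) * S powr \<theta>"
        using H0 by (simp add: mult_left_mono mult.assoc)
      then have "S \<le> 2 * a 0 + (2 * (H * e powr \<theta>)) powr (1 / (1 - \<theta>))"
        by (rule sublinear_bound) (use a0 H0 \<theta> S0 in auto)
      also have "(2 * (H * e powr \<theta>)) powr (1 / (1 - \<theta>)) = (2 * H) powr (1 / (1 - \<theta>)) * e powr (q / 2)"
        using H0 e(1) by (simp add: mult.assoc[symmetric] powr_mult powr_powr e\<theta>[symmetric])
      also have "a 0 \<le> t powr q * B" using B[of t] t by (simp add: a_def mult_left_mono)
      finally have S: "S \<le> 2 * (t powr q * B) + (2 * H) powr (1 / (1 - \<theta>)) * e powr (q / 2)" by simp
      have "(\<integral>\<^sup>+x. ennreal (indicator {t<..t * 2 ^ Suc n} \<bar>v x\<bar> * \<bar>v x\<bar> powr q) \<partial>lborel)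
          \<le> (\<integral>\<^sup>+x. (\<Sum>j<Suc n. ennreal (2 powr q * ?t j powr q) * indicator {x. ?t j < \<bar>v x\<bar>} x) \<partial>lborel)"
      proof (rule nn_integral_mono)
        fix x
        have "ennreal (indicator {t<..t * 2 ^ Suc n} \<bar>v x\<bar> * \<bar>v x\<bar> powr q)
            = (\<Sum>j<Suc n. ennreal (indicator {?t j<..t * 2 ^ Suc j} \<bar>v x\<bar> * \<bar>v x\<bar> powr q))"
          using sum_dyadic_indicator[OF t, where n="Suc n" and y="\<bar>v x\<bar>" and ?'a = real]
          by (subst sum_ennreal) (auto simp: sum_distrib_right[symmetric] simp del: sum.lessThan_Suc)
        also have "\<dots> \<le> (\<Sum>j<Suc n. ennreal (2 powr q * ?t j powr q) * indicator {x. ?t j < \<bar>v x\<bar>} x)"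
        proof (rule sum_mono)
          fix j
          show "ennreal (indicator {?t j<..t * 2 ^ Suc j} \<bar>v x\<bar> * \<bar>v x\<bar> powr q)
              \<le> ennreal (2 powr q * ?t j powr q) * indicator {x. ?t j < \<bar>v x\<bar>} x"
          proof (cases "\<bar>v x\<bar> \<in> {?t j<..t * 2 ^ Suc j}")
            case True
            then have "\<bar>v x\<bar> powr q \<le> (2 * ?t j) powr q"
              using q0 by (intro powr_mono2) (auto simp: mult_ac)
            also have "\<dots> = 2 powr q * ?t j powr q" using tp[of j] by (subst powr_mult) auto
            finally show ?thesis using True by (auto simp: indicator_def intro: ennreal_leI)
          qed (auto simp: indicator_def)
        qed
        finally show "ennreal (indicator {t<..t * 2 ^ Suc n} \<bar>v x\<bar> * \<bar>v x\<bar> powr q)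
            \<le> (\<Sum>j<Suc n. ennreal (2 powr q * ?t j powr q) * indicator {x. ?t j < \<bar>v x\<bar>} x)" .
      qed
      also have "\<dots> = (\<Sum>j<Suc n. ennreal (2 powr q * ?t j powr q) * ennreal (m (?t j)))"
        using superlevel_finite[OF v, of "?t _"] tp
        by (subst nn_integral_sum) (auto simp: nn_integral_cmult m_def less_imp_le intro!: sum.cong)
      also have "\<dots> = ennreal (2 powr q * S)"
        unfolding S_def sum_distrib_left
        by (subst sum_ennreal[symmetric]) (auto simp: a_def m0 ennreal_mult''[symmetric] mult_ac)
      also have "\<dots> \<le> ennreal (2 powr q * (2 * (t powr q * B) + (2 * H) powr (1 / (1 - \<theta>)) * e powr (q / 2)))"
        by (intro ennreal_leI mult_left_mono S) simp
      finally show ?thesis by (simp add: C_def distrib_left mult.assoc)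
    qed
    have "(\<integral>\<^sup>+x. ennreal (\<bar>v x\<bar> powr q) \<partial>lborel) \<le> ennreal (2 powr q * (2 * (0 * B)) + C * e powr (q / 2))"
    proof (rule nn_integral_Fatou_bound)
      \<comment> \<open>the levels from \<open>2\<^bsup>-k\<^esup>\<close> to \<open>2\<^bsup>k+1\<^esup>\<close> exhaust the positive numbers\<close>
      let ?s = "\<lambda>k::nat. (1 / 2) ^ k :: real"
      show "\<forall>\<^sub>F k in sequentially. (\<integral>\<^sup>+x. ennreal (indicator {?s k<..?s k * 2 ^ Suc (2 * k)} \<bar>v x\<bar> * \<bar>v x\<bar> powr q) \<partial>lborel)
          \<le> ennreal (2 powr q * (2 * (?s k powr q * B)) + C * e powr (q / 2))"
        using block by (intro always_eventually allI) simp
      have s0: "?s \<longlonglongrightarrow> 0" by (intro LIMSEQ_power_zero) simp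
      have "(\<lambda>k. ?s k powr q) \<longlonglongrightarrow> 0 powr q"
        by (intro tendsto_powr' s0 tendsto_const) (use q0 in auto)
      then have "(\<lambda>k. ?s k powr q) \<longlonglongrightarrow> 0" by simp
      then show "(\<lambda>k. 2 powr q * (2 * (?s k powr q * B)) + C * e powr (q / 2)) \<longlonglongrightarrow> 2 powr q * (2 * (0 * B)) + C * e powr (q / 2)"
        by (intro tendsto_intros)
      show "AE x in lborel. (\<lambda>k. indicator {?s k<..?s k * 2 ^ Suc (2 * k)} \<bar>v x\<bar> * \<bar>v x\<bar> powr q) \<longlonglongrightarrow> \<bar>v x\<bar> powr q"
      proof (rule AE_I2)
        fix x
        show "(\<lambda>k. indicator {?s k<..?s k * 2 ^ Suc (2 * k)} \<bar>v x\<bar> * \<bar>v x\<bar> powr q) \<longlonglongrightarrow> \<bar>v x\<bar> powr q"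
        proof (cases "v x = 0")
          case False
          have "\<forall>\<^sub>F k in sequentially. ?s k < \<bar>v x\<bar>"
            using order_tendstoD(2)[OF s0, of "\<bar>v x\<bar>"] False by simp
          moreover have "\<forall>\<^sub>F k in sequentially. \<bar>v x\<bar> \<le> ?s k * 2 ^ Suc (2 * k)"
          proof -
            obtain k\<^sub>0 where "\<bar>v x\<bar> < 2 ^ k\<^sub>0" using real_arch_pow[of 2 "\<bar>v x\<bar>"] by auto
            then have "\<forall>\<^sub>F k in sequentially. \<bar>v x\<bar> \<le> 2 ^ k"
              by (intro eventually_sequentiallyI[of k\<^sub>0]) (meson less_imp_le order_trans power_increasing one_le_numeral)
            then show ?thesis
            proof eventually_elim
              case (elim k)
              have "?s k * 2 ^ Suc (2 * k) = 2 * 2 ^ k"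
              proof -
                have "(1 / 2) ^ k * (2::real) ^ k = 1" by (simp add: power_one_over)
                moreover have "(2::real) ^ Suc (2 * k) = 2 ^ k * 2 ^ Suc k"
                proof -
                  have "Suc (2 * k) = k + Suc k" by simp
                  then show ?thesis by (simp only: power_add)
                qed
                ultimately have "(1 / 2) ^ k * (2::real) ^ Suc (2 * k) = 1 * 2 ^ Suc k"
                  by (simp only: mult.assoc[symmetric])
                then show ?thesis by simp
              qed
              then show ?case using elim by simp
            qed
          qed
          ultimately have "\<forall>\<^sub>F k in sequentially. indicator {?s k<..?s k * 2 ^ Suc (2 * k)} \<bar>v x\<bar> * \<bar>v x\<bar> powr q = \<bar>v x\<bar> powr q"
            by eventually_elim simp
          then show ?thesis by (rule tendsto_eventually)
        qed simp
      qed
    qed measurable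
    then show ?thesis by simp
  qed
  moreover have "C \<ge> 0" by (simp add: C_def)
  ultimately show ?thesis by blast
qed

section \<open>The Caffarelli--Kohn--Nirenberg inequality\<close>

text \<open>
  The case \<open>b = a\<close>. The gradient of \<open>v = |x|\<^bsup>-a\<^esup> \<phi>\<close> consists of \<open>|x|\<^bsup>-a\<^esup> \<nabla>\<phi>\<close> and a term of
  size \<open>|a| |x|\<^bsup>-a-1\<^esup> |\<phi>|\<close>, which Hardy's inequality controls; so the Sobolev inequality for
  \<open>v\<close> is the claim.
\<close>

lemma CKN_endpoint:
  fixes N q a :: real
  defines "N \<equiv> real CARD('n)"
  assumes N: "N \<ge> 3" and q: "q = 2 * N / (N - 2)" and a: "a < (N - 2) / 2"
  shows "\<exists>C\<ge>0. \<forall>(\<phi>::real^'n \<Rightarrow> real) G e. punctured_C1 \<phi> G \<longrightarrow> e \<ge> 0 \<longrightarrow>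
    energy a G \<le> ennreal e \<longrightarrow>
    wint (- a * q) (\<lambda>x. \<bar>\<phi> x\<bar> powr q) \<le> ennreal (C * e powr (q / 2))"
proof -
  define s where "s = (N - 2 - 2 * a) / 2"
  have s: "s = (real CARD('n) - 2 - 2 * a) / 2" "s > 0" using a by (auto simp: s_def N_def)
  define k where "k = 2 + 2 * a\<^sup>2 / s\<^sup>2"
  have k0: "k \<ge> 0" by (simp add: k_def)
  obtain C where C: "C \<ge> 0" "\<And>(v::real^'n \<Rightarrow> real) V e. punctured_C1 v V \<Longrightarrow> e \<ge> 0 \<Longrightarrow>
    (\<integral>\<^sup>+x. ennreal ((norm (V x))\<^sup>2) \<partial>lborel) \<le> ennreal e \<Longrightarrow>
    (\<integral>\<^sup>+x. ennreal (\<bar>v x\<bar> powr q) \<partial>lborel) \<le> ennreal (C * e powr (q / 2))"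
    using Sobolev_inequality[where 'n='n, OF _ q[unfolded N_def]] N unfolding N_def by blast
  have "wint (- a * q) (\<lambda>x. \<bar>\<phi> x\<bar> powr q) \<le> ennreal ((C * k powr (q / 2)) * e powr (q / 2))"
    if \<phi>: "punctured_C1 \<phi> G" and e: "e \<ge> 0" "energy a G \<le> ennreal e"
    for \<phi> :: "real^'n \<Rightarrow> real" and G e
  proof -
    note [measurable] = punctured_C1_measurable[OF \<phi>]
    define v where "v x = norm x powr - a * \<phi> x" for x
    define V where "V x = norm x powr - a *\<^sub>R G x - (a * norm x powr (- a - 1) * \<phi> x) *\<^sub>R sgn x" for x
    have c\<phi>: "continuous_on (- {0}) \<phi>"
      using \<phi> unfolding punctured_C1_def
      by (intro continuous_at_imp_continuous_on ballI has_derivative_continuous) auto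
    have v: "punctured_C1 v V"
      unfolding punctured_C1_def
    proof (intro conjI allI impI)
      fix x :: "real^'n" assume x: "x \<noteq> 0"
      have d1: "((\<lambda>x. norm x powr - a) has_derivative (\<lambda>h. (- a * norm x powr (- a - 1)) * inner (sgn x) h)) (at x)"
      proof -
        have "((\<lambda>y. y powr - a) has_real_derivative - a * norm x powr (- a - 1)) (at (norm x))"
          using x by (intro has_real_derivative_powr) auto
        then have "((\<lambda>y. y powr - a) has_derivative (\<lambda>h. - a * norm x powr (- a - 1) * h)) (at (norm x))"
          unfolding has_field_derivative_def .
        from has_derivative_compose[OF has_derivative_norm[OF x] this]
        show ?thesis by (simp add: inner_commute)
      qed
      have d2: "(\<phi> has_derivative (\<lambda>h. inner (G x) h)) (at x)" using \<phi> x by (simp add: punctured_C1_def)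
      show "(v has_derivative inner (V x)) (at x)"
        unfolding v_def[abs_def]
        by (rule has_derivative_eq_rhs[OF has_derivative_mult[OF d1 d2]])
           (simp add: fun_eq_iff V_def inner_diff_left)
    next
      show "continuous_on (- {0}) V" unfolding V_def[abs_def]
        using \<phi> unfolding punctured_C1_def sgn_div_norm
        by (intro continuous_intros c\<phi>) auto
      obtain R where "\<And>x. norm x > R \<Longrightarrow> \<phi> x = 0" using \<phi> unfolding punctured_C1_def by auto
      then show "\<exists>R. \<forall>x. R < norm x \<longrightarrow> v x = 0" by (auto simp: v_def)
    qed
    have "(\<integral>\<^sup>+x. ennreal ((norm (V x))\<^sup>2) \<partial>lborel)
        \<le> (\<integral>\<^sup>+x. ennreal 2 * ennreal (norm x powr (- 2 * a) * (norm (G x))\<^sup>2) + ennreal (2 * a\<^sup>2) * ennreal (norm x powr (- 2 * a - 2) * (\<phi> x)\<^sup>2) \<partial>lborel)"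
    proof (rule nn_integral_mono_AE, rule eventually_mono[OF AE_lborel_singleton[of 0]])
      fix x :: "real^'n" assume x: "x \<noteq> 0"
      define A where "A = norm x powr - a *\<^sub>R G x"
      define B where "B = (a * norm x powr (- a - 1) * \<phi> x) *\<^sub>R sgn x"
      have "(norm (V x))\<^sup>2 \<le> (norm A + norm B)\<^sup>2"
        unfolding V_def A_def[symmetric] B_def[symmetric] by (intro power_mono norm_triangle_ineq4) simp
      also have "\<dots> \<le> 2 * (norm A)\<^sup>2 + 2 * (norm B)\<^sup>2"
        using sum_squares_bound[of "norm A" "norm B"] by (simp add: power2_sum)
      also have "(norm A)\<^sup>2 = norm x powr (- 2 * a) * (norm (G x))\<^sup>2"
        by (simp add: A_def power_mult_distrib) (simp add: power2_eq_square powr_add[symmetric])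
      also have "(norm B)\<^sup>2 = a\<^sup>2 * (norm x powr (- 2 * a - 2) * (\<phi> x)\<^sup>2)"
      proof -
        have "(norm x powr (- a - 1))\<^sup>2 = norm x powr (- 2 * a - 2)"
          by (simp add: power2_eq_square powr_add[symmetric])
        then show ?thesis using x by (simp add: B_def norm_sgn power_mult_distrib abs_mult)
      qed
      finally have "ennreal ((norm (V x))\<^sup>2) \<le> ennreal (2 * (norm x powr (- 2 * a) * (norm (G x))\<^sup>2) + 2 * (a\<^sup>2 * (norm x powr (- 2 * a - 2) * (\<phi> x)\<^sup>2)))"
        by (rule ennreal_leI)
      also have "\<dots> = ennreal 2 * ennreal (norm x powr (- 2 * a) * (norm (G x))\<^sup>2) + ennreal (2 * a\<^sup>2) * ennreal (norm x powr (- 2 * a - 2) * (\<phi> x)\<^sup>2)"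
        by (subst ennreal_plus) (auto simp: ennreal_mult'[symmetric] mult.assoc simp del: ennreal_numeral)
      finally show "ennreal ((norm (V x))\<^sup>2) \<le> ennreal 2 * ennreal (norm x powr (- 2 * a) * (norm (G x))\<^sup>2) + ennreal (2 * a\<^sup>2) * ennreal (norm x powr (- 2 * a - 2) * (\<phi> x)\<^sup>2)" .
    qed
    also have "\<dots> = ennreal 2 * energy a G + ennreal (2 * a\<^sup>2) * wint (- 2 * a - 2) (\<lambda>x. (\<phi> x)\<^sup>2)"
      unfolding wint_def by (subst nn_integral_add) (auto simp: nn_integral_cmult simp del: ennreal_numeral)
    also have "\<dots> \<le> ennreal 2 * ennreal e + ennreal (2 * a\<^sup>2) * (ennreal (1 / s\<^sup>2) * ennreal e)"
      by (intro add_mono mult_left_mono e order_trans[OF Hardy_inequality[OF \<phi> s]]) auto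
    also have "\<dots> = ennreal (k * e)"
      using e by (simp add: k_def ennreal_mult'[symmetric] ennreal_plus[symmetric] distrib_right del: ennreal_plus ennreal_numeral)
    finally have "(\<integral>\<^sup>+x. ennreal (\<bar>v x\<bar> powr q) \<partial>lborel) \<le> ennreal (C * (k * e) powr (q / 2))"
      using k0 e by (intro C(2)[OF v]) auto
    moreover have "wint (- a * q) (\<lambda>x. \<bar>\<phi> x\<bar> powr q) = (\<integral>\<^sup>+x. ennreal (\<bar>v x\<bar> powr q) \<partial>lborel)"
      unfolding wint_def v_def by (intro nn_integral_cong) (simp add: abs_mult powr_mult powr_powr)
    ultimately show ?thesis using k0 e by (simp add: powr_mult mult.assoc)
  qed
  then show ?thesis using C(1) by (intro exI[of _ "C * k powr (q / 2)"]) auto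
qed

text \<open>
  Hoelder interpolation between \<open>|x|\<^bsup>-2a-2\<^esup> \<phi>\<^sup>2\<close> (Hardy's inequality) and \<open>|x|\<^bsup>-aq\<^esup> |\<phi>|\<^bsup>q\<^esup>\<close>
  (the endpoint), with weight \<open>\<alpha> = (b - a) p / 2\<close> on the former.
\<close>

lemma CKN_inequality:
  fixes N p a b :: real
  defines "N \<equiv> real CARD('n)"
  assumes N: "N \<ge> 3" and a: "a < (N - 2) / 2" and b: "a \<le> b" "b < a + 1"
    and p: "p = 2 * N / (N - 2 * (1 + a - b))"
  shows "\<exists>C\<ge>0. \<forall>(\<phi>::real^'n \<Rightarrow> real) G e. punctured_C1 \<phi> G \<longrightarrow> e \<ge> 0 \<longrightarrow>
    energy a G \<le> ennreal e \<longrightarrow>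
    wint (- b * p) (\<lambda>x. \<bar>\<phi> x\<bar> powr p) \<le> ennreal (C * e powr (p / 2))"
proof -
  define q where "q = 2 * N / (N - 2)"
  obtain C where C: "C \<ge> 0" "\<And>(\<phi>::real^'n \<Rightarrow> real) G e. punctured_C1 \<phi> G \<Longrightarrow> e \<ge> 0 \<Longrightarrow>
    energy a G \<le> ennreal e \<Longrightarrow>
    wint (- a * q) (\<lambda>x. \<bar>\<phi> x\<bar> powr q) \<le> ennreal (C * e powr (q / 2))"
    using CKN_endpoint[where 'n='n, of q a] q_def N a unfolding N_def by blast
  show ?thesis
  proof (cases "a = b")
    case True
    then have "p = q" using p by (simp add: q_def)
    then show ?thesis using C True by auto
  next
    case False
    define s where "s = (N - 2 - 2 * a) / 2"
    have s: "s = (real CARD('n) - 2 - 2 * a) / 2" "s > 0" using a by (auto simp: s_def N_def)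
    define \<alpha> where "\<alpha> = (b - a) * p / 2"
    have den: "N - 2 * (1 + a - b) > 0" using N b by simp
    have p0: "p > 0" using N den by (simp add: p)
    have \<alpha>: "0 < \<alpha>" "\<alpha> < 1"
    proof -
      show "0 < \<alpha>" using False b p0 by (simp add: \<alpha>_def)
      have "N * (b - a) < N - 2 + 2 * (b - a)"
      proof -
        have "(N - 2) * (b - a) < (N - 2) * 1" using N b by (intro mult_strict_left_mono) auto
        then show ?thesis by (simp add: algebra_simps)
      qed
      then show "\<alpha> < 1" using den by (simp add: \<alpha>_def p field_simps)
    qed
    have \<alpha>2: "2 * \<alpha> = (b - a) * p" by (simp add: \<alpha>_def)
    have q2: "2 * \<alpha> + q * (1 - \<alpha>) = p"
    proof -
      have "p * (N - 2 * (1 + a - b)) = 2 * N" using den by (simp add: p)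
      then have "p * (N - 2) = 2 * N - 2 * (2 * \<alpha>)" unfolding \<alpha>2 by (simp add: algebra_simps)
      then have "p * (N - 2) = 2 * N - 4 * \<alpha>" by simp
      then have "p = (2 * N - 4 * \<alpha>) / (N - 2)" using N by (simp add: field_simps)
      then show ?thesis using N by (simp add: q_def field_simps)
    qed
    have w: "(2 * a + 2) * \<alpha> + a * q * (1 - \<alpha>) = b * p"
    proof -
      have "(2 * a + 2) * \<alpha> + a * q * (1 - \<alpha>) = 2 * \<alpha> + a * (2 * \<alpha> + q * (1 - \<alpha>))" by (simp add: algebra_simps)
      also have "\<dots> = 2 * \<alpha> + a * p" by (simp only: q2)
      also have "\<dots> = b * p" unfolding \<alpha>2 by (simp add: algebra_simps)
      finally show ?thesis .
    qed
    define K where "K = (1 / s\<^sup>2) powr \<alpha> * C powr (1 - \<alpha>)"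
    have "wint (- b * p) (\<lambda>x. \<bar>\<phi> x\<bar> powr p) \<le> ennreal (K * e powr (p / 2))"
      if \<phi>: "punctured_C1 \<phi> G" and e: "e \<ge> 0" "energy a G \<le> ennreal e"
      for \<phi> :: "real^'n \<Rightarrow> real" and G e
    proof -
      note [measurable] = punctured_C1_measurable[OF \<phi>]
      have "wint (- b * p) (\<lambda>x. \<bar>\<phi> x\<bar> powr p)
          = (\<integral>\<^sup>+x. ennreal ((norm x powr (- 2 * a - 2) * (\<phi> x)\<^sup>2) powr \<alpha> * (norm x powr (- a * q) * \<bar>\<phi> x\<bar> powr q) powr (1 - \<alpha>)) \<partial>lborel)"
        unfolding wint_def
      proof (intro nn_integral_cong arg_cong[where f=ennreal])
        fix x :: "real^'n"
        have "(\<phi> x)\<^sup>2 = \<bar>\<phi> x\<bar> powr 2" by (cases "\<phi> x = 0") (auto simp: powr_numeral)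
        then have "((\<phi> x)\<^sup>2) powr \<alpha> = \<bar>\<phi> x\<bar> powr (2 * \<alpha>)" by (simp only: powr_powr)
        then have "(norm x powr (- 2 * a - 2) * (\<phi> x)\<^sup>2) powr \<alpha> * (norm x powr (- a * q) * \<bar>\<phi> x\<bar> powr q) powr (1 - \<alpha>)
          = (norm x powr ((- 2 * a - 2) * \<alpha>) * norm x powr ((- a * q) * (1 - \<alpha>))) * (\<bar>\<phi> x\<bar> powr (2 * \<alpha>) * \<bar>\<phi> x\<bar> powr (q * (1 - \<alpha>)))"
          by (simp add: powr_mult powr_powr)
        also have "\<bar>\<phi> x\<bar> powr (2 * \<alpha>) * \<bar>\<phi> x\<bar> powr (q * (1 - \<alpha>)) = \<bar>\<phi> x\<bar> powr p"
          by (simp only: powr_add[symmetric] q2)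
        also have "norm x powr ((- 2 * a - 2) * \<alpha>) * norm x powr ((- a * q) * (1 - \<alpha>)) = norm x powr (- b * p)"
        proof -
          have "(- 2 * a - 2) * \<alpha> + (- a * q) * (1 - \<alpha>) = - b * p" using w by (simp add: algebra_simps)
          then show ?thesis by (simp only: powr_add[symmetric])
        qed
        finally show "norm x powr (- b * p) * \<bar>\<phi> x\<bar> powr p
          = (norm x powr (- 2 * a - 2) * (\<phi> x)\<^sup>2) powr \<alpha> * (norm x powr (- a * q) * \<bar>\<phi> x\<bar> powr q) powr (1 - \<alpha>)" by simp
      qed
      also have "\<dots> \<le> ennreal ((1 / s\<^sup>2 * e) powr \<alpha> * (C * e powr (q / 2)) powr (1 - \<alpha>))"
      proof (rule Hoelder_nn_integral)
        have "wint (- 2 * a - 2) (\<lambda>x. (\<phi> x)\<^sup>2) \<le> ennreal (1 / s\<^sup>2) * ennreal e"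
          by (rule order_trans[OF Hardy_inequality[OF \<phi> s]]) (intro mult_left_mono e, simp)
        then show "(\<integral>\<^sup>+x. ennreal (norm x powr (- 2 * a - 2) * (\<phi> x)\<^sup>2) \<partial>lborel) \<le> ennreal (1 / s\<^sup>2 * e)"
          using e by (simp add: wint_def ennreal_mult'[symmetric])
        show "(\<integral>\<^sup>+x. ennreal (norm x powr (- a * q) * \<bar>\<phi> x\<bar> powr q) \<partial>lborel) \<le> ennreal (C * e powr (q / 2))"
          using C(2)[OF \<phi> e] by (simp add: wint_def)
      qed (use \<alpha> e C in auto)
      also have "(1 / s\<^sup>2 * e) powr \<alpha> * (C * e powr (q / 2)) powr (1 - \<alpha>) = K * (e powr \<alpha> * e powr (q / 2 * (1 - \<alpha>)))"
        using e C s by (simp add: K_def powr_mult powr_divide powr_powr)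
      also have "e powr \<alpha> * e powr (q / 2 * (1 - \<alpha>)) = e powr (p / 2)"
      proof -
        have "\<alpha> + q / 2 * (1 - \<alpha>) = p / 2" using q2 by (simp add: field_simps)
        then show ?thesis by (simp only: powr_add[symmetric])
      qed
      finally show ?thesis .
    qed
    moreover have "K \<ge> 0" by (simp add: K_def)
    ultimately show ?thesis by blast
  qed
qed

text \<open>
  Hardy's inequality for a cut-off function that equals \<open>1\<close> on the ball: the weight on the
  left is the one in question, and the gradient on the right lives on an annulus, where the
  weight is bounded.
\<close>

lemma wint_cball_finite:
  fixes c :: real
  assumes c: "c > - real CARD('n)" and R: "R > 0"
  shows "wint c (indicator (cball (0::real^'n) R)) < \<infinity>"
proof -
  \<comment> \<open>the parameter for which the left side of Hardy's inequality has weight \<open>|x|\<^bsup>c\<^esup>\<close>\<close>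
  define a where "a = (- c - 2) / 2"
  define s where "s = (real CARD('n) - 2 - 2 * a) / 2"
  have ca: "c = - 2 * a - 2" by (simp add: a_def field_simps)
  have s: "s > 0" using c by (simp add: s_def a_def)
  define \<phi> where "\<phi> x = 1 - ramp (inner x x / R\<^sup>2 - 1)" for x :: "real^'n"
  define G where "G x = (- tent (inner x x / R\<^sup>2 - 1) * 2 / R\<^sup>2) *\<^sub>R x" for x :: "real^'n"
  have "punctured_C1 \<phi> G" unfolding punctured_C1_def
  proof (intro conjI allI impI)
    fix x :: "real^'n"
    have d1: "((\<lambda>x. inner x x / R\<^sup>2 - 1) has_derivative (\<lambda>h. 2 * inner x h / R\<^sup>2)) (at x)"
      unfolding divide_inverse by (auto intro!: derivative_eq_intros simp: inner_commute fun_eq_iff algebra_simps)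
    have d2: "(ramp has_derivative (\<lambda>h. tent (inner x x / R\<^sup>2 - 1) * h)) (at (inner x x / R\<^sup>2 - 1))"
      using DERIV_ramp unfolding has_field_derivative_def .
    show "(\<phi> has_derivative inner (G x)) (at x)" unfolding \<phi>_def[abs_def]
      by (rule has_derivative_eq_rhs[OF has_derivative_diff[OF has_derivative_const has_derivative_compose[OF d1 d2]]])
         (simp add: G_def fun_eq_iff)
  next
    show "continuous_on (- {0}) G" unfolding G_def[abs_def] divide_inverse
      by (intro continuous_intros continuous_on_compose2[OF continuous_on_tent[of UNIV]]) auto
    show "\<exists>R. \<forall>x. R < norm x \<longrightarrow> \<phi> x = 0"
    proof (intro exI[of _ "2 * R"] allI impI)
      fix x :: "real^'n" assume "2 * R < norm x"
      then have "(2 * R)\<^sup>2 \<le> (norm x)\<^sup>2" using R by (intro power_mono) auto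
      then have "3 * R\<^sup>2 \<le> (norm x)\<^sup>2" by (rule order_trans[rotated]) (simp add: power_mult_distrib)
      then have "3 \<le> inner x x / R\<^sup>2" using R by (simp add: power2_norm_eq_inner[symmetric] field_simps)
      then show "\<phi> x = 0" by (simp add: \<phi>_def ramp_eq_1)
    qed
  qed
  note H = Hardy_inequality[OF this s_def s]
  have "wint c (indicator (cball (0::real^'n) R)) \<le> wint c (\<lambda>x. (\<phi> x)\<^sup>2)"
  proof (rule wint_mono)
    fix x :: "real^'n"
    show "indicator (cball 0 R) x \<le> (\<phi> x)\<^sup>2"
    proof (cases "norm x \<le> R")
      case True
      then have "(norm x)\<^sup>2 \<le> R\<^sup>2" by (intro power_mono) auto
      then have "inner x x / R\<^sup>2 - 1 \<le> 0" using R by (simp add: power2_norm_eq_inner[symmetric])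
      then show ?thesis by (simp add: \<phi>_def ramp_eq_0 indicator_def)
    qed (simp add: indicator_def)
  qed
  also note H[folded ca]
  finally have H': "wint c (indicator (cball (0::real^'n) R)) \<le> ennreal (1 / s\<^sup>2) * energy a G" .
  have "energy a G
      \<le> (\<integral>\<^sup>+x. ennreal ((R powr (- 2 * a) + (2 * R) powr (- 2 * a)) * (16 / R\<^sup>2)) * indicator (cball (0::real^'n) (2 * R)) x \<partial>lborel)"
    unfolding wint_def
  proof (rule nn_integral_mono)
    fix x :: "real^'n"
    consider "norm x < R" | "R \<le> norm x" "norm x \<le> 2 * R" | "norm x > 2 * R" by linarith
    then show "ennreal (norm x powr (- 2 * a) * (norm (G x))\<^sup>2)
      \<le> ennreal ((R powr (- 2 * a) + (2 * R) powr (- 2 * a)) * (16 / R\<^sup>2)) * indicator (cball (0::real^'n) (2 * R)) x"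
    proof cases
      case 1
      then have "(norm x)\<^sup>2 \<le> R\<^sup>2" by (intro power_mono) auto
      then have "inner x x / R\<^sup>2 - 1 \<le> 0" using R by (simp add: power2_norm_eq_inner[symmetric])
      then show ?thesis by (simp add: G_def tent_eq_0)
    next
      case 3
      then have "(2 * R)\<^sup>2 \<le> (norm x)\<^sup>2" using R by (intro power_mono) auto
      then have "3 * R\<^sup>2 \<le> (norm x)\<^sup>2" by (rule order_trans[rotated]) (simp add: power_mult_distrib)
      then have "3 \<le> inner x x / R\<^sup>2" using R by (simp add: power2_norm_eq_inner[symmetric] field_simps)
      then show ?thesis by (simp add: G_def tent_eq_0)
    next
      case 2
      have "norm x powr (- 2 * a) \<le> R powr (- 2 * a) + (2 * R) powr (- 2 * a)"
      proof (cases "- 2 * a \<ge> 0")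
        case True
        then have "norm x powr (- 2 * a) \<le> (2 * R) powr (- 2 * a)" using 2 by (intro powr_mono2) auto
        then show ?thesis by (rule order_trans) simp
      next
        case False
        then have "norm x powr (- 2 * a) \<le> R powr (- 2 * a)" using 2 R by (intro powr_mono2') auto
        then show ?thesis by (rule order_trans) simp
      qed
      moreover have "(norm (G x))\<^sup>2 \<le> 16 / R\<^sup>2"
      proof -
        let ?t = "tent (inner x x / R\<^sup>2 - 1)"
        have "norm (G x) = ?t * (2 / R\<^sup>2 * norm x)" using tent_bounds(1) by (simp add: G_def)
        also have "\<dots> \<le> 1 * (2 / R\<^sup>2 * (2 * R))"
          using 2 R tent_bounds by (intro mult_mono) (auto intro!: divide_right_mono)
        also have "\<dots> = 4 / R" using R by (simp add: power2_eq_square)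
        finally have "(norm (G x))\<^sup>2 \<le> (4 / R)\<^sup>2" by (intro power_mono) auto
        then show ?thesis by (simp add: power_divide)
      qed
      ultimately have "norm x powr (- 2 * a) * (norm (G x))\<^sup>2 \<le> (R powr (- 2 * a) + (2 * R) powr (- 2 * a)) * (16 / R\<^sup>2)"
        by (intro mult_mono) auto
      then show ?thesis using 2 by (auto intro: ennreal_leI)
    qed
  qed
  also have "\<dots> = ennreal ((R powr (- 2 * a) + (2 * R) powr (- 2 * a)) * (16 / R\<^sup>2)) * emeasure lborel (cball (0::real^'n) (2 * R))"
    by (rule nn_integral_cmult_indicator) simp
  also have "\<dots> < \<infinity>"
    using emeasure_bounded_finite[of "cball (0::real^'n) (2 * R)"] by (simp add: ennreal_mult_less_top)
  finally have "ennreal (1 / s\<^sup>2) * energy a G < \<infinity>"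
    by (simp add: ennreal_mult_less_top)
  with H' show ?thesis by (rule le_less_trans)
qed

section \<open>Test functions\<close>

lemma pderivative_eqI:
  assumes "(f has_derivative f') (at x)"
  shows "pderivative i f x = f' (axis i 1)"
  unfolding pderivative_def using frechet_derivative_at[OF assms] by simp

lemma Ck_diff: "Ck k f \<Longrightarrow> Ck k g \<Longrightarrow> Ck k (\<lambda>x. f x - g x)"
proof (induction k arbitrary: f g)
  case (Suc k)
  have "pderivative i (\<lambda>x. f x - g x) = (\<lambda>x. pderivative i f x - pderivative i g x)" for i
  proof
    fix x
    have "(f has_derivative frechet_derivative f (at x)) (at x)" "(g has_derivative frechet_derivative g (at x)) (at x)"
      using Suc.prems by (simp_all add: frechet_derivative_works[symmetric])
    then have "((\<lambda>x. f x - g x) has_derivative (\<lambda>h. frechet_derivative f (at x) h - frechet_derivative g (at x) h)) (at x)"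
      by (rule has_derivative_diff)
    from pderivative_eqI[OF this] show "pderivative i (\<lambda>x. f x - g x) x = pderivative i f x - pderivative i g x"
      by (simp add: pderivative_def)
  qed
  then show ?case using Suc by (auto intro: differentiable_diff)
qed (auto intro: continuous_on_diff)

lemma Ck_dilation: "Ck k f \<Longrightarrow> Ck k (\<lambda>x. c * f (l *\<^sub>R x))"
proof (induction k arbitrary: f c)
  case 0
  then show ?case by (auto intro!: continuous_intros continuous_on_compose2[of UNIV f])
next
  case (Suc k)
  have D: "((\<lambda>x. c * f (l *\<^sub>R x)) has_derivative (\<lambda>h. c * frechet_derivative f (at (l *\<^sub>R x)) (l *\<^sub>R h))) (at x)" for x
  proof -
    have "(f has_derivative frechet_derivative f (at (l *\<^sub>R x))) (at (l *\<^sub>R x))"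
      using Suc.prems by (simp add: frechet_derivative_works[symmetric])
    moreover have "((\<lambda>x. l *\<^sub>R x) has_derivative (\<lambda>h. l *\<^sub>R h)) (at x)"
      by (auto intro!: derivative_eq_intros)
    ultimately show ?thesis by (intro has_derivative_mult_right) (rule has_derivative_compose)
  qed
  have "pderivative i (\<lambda>x. c * f (l *\<^sub>R x)) = (\<lambda>x. (c * l) * pderivative i f (l *\<^sub>R x))" for i
  proof
    fix x
    have "linear (frechet_derivative f (at (l *\<^sub>R x)))"
      using Suc.prems by (intro linear_frechet_derivative) simp
    then show "pderivative i (\<lambda>x. c * f (l *\<^sub>R x)) x = (c * l) * pderivative i f (l *\<^sub>R x)"
      using pderivative_eqI[OF D] by (simp add: pderivative_def linear_cmul)
  qed
  moreover have "(\<lambda>x. c * f (l *\<^sub>R x)) differentiable (at x)" for x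
    using D by (auto simp: differentiable_def)
  ultimately show ?case using Suc by simp
qed

lemma grad_has_derivative:
  assumes "f differentiable (at x)"
  shows "(f has_derivative (\<lambda>h. inner (grad f x) h)) (at x)"
  using GDERIV_grad[OF assms] by (simp add: gderiv_def inner_commute)

lemma grad_eqI:
  fixes f :: "real ^ 'n \<Rightarrow> real"
  assumes "(f has_derivative (\<lambda>h. inner w h)) (at x)"
  shows "grad f x = w"
  unfolding grad_def using pderivative_eqI[OF assms] by (simp add: vec_eq_iff inner_axis)

lemma continuous_on_grad:
  fixes f :: "real ^ 'n \<Rightarrow> real"
  assumes "Ck 1 f"
  shows "continuous_on UNIV (grad f)"
  using assms unfolding grad_def by (simp add: continuous_on_vec_lambda)

lemma grad_diff:
  assumes "f differentiable (at x)" "g differentiable (at x)"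
  shows "grad (\<lambda>x. f x - g x) x = grad f x - grad g x"
  by (rule grad_eqI) (auto intro!: derivative_eq_intros grad_has_derivative assms simp: inner_diff_left)

lemma grad_dilation:
  assumes "f differentiable (at (l *\<^sub>R x))"
  shows "grad (\<lambda>x. c * f (l *\<^sub>R x)) x = (c * l) *\<^sub>R grad f (l *\<^sub>R x)"
proof (rule grad_eqI)
  have "((\<lambda>x. l *\<^sub>R x) has_derivative (\<lambda>h. l *\<^sub>R h)) (at x)"
    by (auto intro!: derivative_eq_intros)
  from has_derivative_mult_right[OF has_derivative_compose[OF this grad_has_derivative[OF assms]], of c]
  show "((\<lambda>x. c * f (l *\<^sub>R x)) has_derivative inner ((c * l) *\<^sub>R grad f (l *\<^sub>R x))) (at x)"
    by (rule has_derivative_eq_rhs) (simp add: fun_eq_iff)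
qed

lemma Cc_infinityD:
  assumes "\<phi> \<in> Cc_infinity"
  shows "Ck 1 \<phi>" "\<phi> differentiable (at x)" "\<exists>R>0. \<forall>x. norm x > R \<longrightarrow> \<phi> x = 0"
proof -
  have k: "Ck k \<phi>" for k using assms by (simp add: Cc_infinity_def)
  show "Ck 1 \<phi>" by (rule k)
  show "\<phi> differentiable (at x)" using k[of "Suc 0"] by simp
  have "bounded (closure {x. \<phi> x \<noteq> 0})" using assms by (simp add: Cc_infinity_def compact_imp_bounded)
  then have "bounded {x. \<phi> x \<noteq> 0}" using bounded_subset closure_subset by blast
  then obtain R where "R > 0" "\<forall>x\<in>{x. \<phi> x \<noteq> 0}. norm x \<le> R" by (meson bounded_pos)
  then show "\<exists>R>0. \<forall>x. norm x > R \<longrightarrow> \<phi> x = 0" by (intro exI[of _ R]) force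
qed

lemma Cc_infinityI:
  fixes \<phi> :: "real ^ 'n \<Rightarrow> real"
  assumes "\<And>k. Ck k \<phi>" and "\<And>x. norm x > R \<Longrightarrow> \<phi> x = 0"
  shows "\<phi> \<in> Cc_infinity"
proof -
  have "{x. \<phi> x \<noteq> 0} \<subseteq> cball 0 R" using assms(2) by (force simp: not_less)
  then have "bounded {x. \<phi> x \<noteq> 0}" by (rule bounded_subset[OF bounded_cball])
  then show ?thesis using assms(1) by (simp add: Cc_infinity_def compact_closure)
qed

lemma Cc_infinity_punctured_C1:
  assumes "\<phi> \<in> Cc_infinity"
  shows "punctured_C1 \<phi> (grad \<phi>)"
  unfolding punctured_C1_def
  using Cc_infinityD[OF assms] continuous_on_grad[of \<phi>]
  by (auto intro: grad_has_derivative continuous_on_subset)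

lemma Cc_infinity_measurable:
  assumes "\<phi> \<in> Cc_infinity"
  shows "\<phi> \<in> borel_measurable borel" "grad \<phi> \<in> borel_measurable borel"
  using punctured_C1_measurable[OF Cc_infinity_punctured_C1[OF assms]] .

lemma Cc_infinity_diff:
  fixes \<phi> \<psi> :: "real ^ 'n \<Rightarrow> real"
  assumes "\<phi> \<in> Cc_infinity" "\<psi> \<in> Cc_infinity"
  shows "(\<lambda>x. \<phi> x - \<psi> x) \<in> Cc_infinity"
proof -
  obtain R S where "\<And>x. norm x > R \<Longrightarrow> \<phi> x = 0" "\<And>x. norm x > S \<Longrightarrow> \<psi> x = 0"
    using Cc_infinityD(3)[OF assms(1)] Cc_infinityD(3)[OF assms(2)] by auto
  then show ?thesis using assms
    by (intro Cc_infinityI[of _ "max R S"] Ck_diff) (auto simp: Cc_infinity_def)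
qed

lemma Cc_infinity_dilation:
  fixes \<phi> :: "real ^ 'n \<Rightarrow> real"
  assumes \<phi>: "\<phi> \<in> Cc_infinity" and l: "l > 0"
  shows "(\<lambda>x. c * \<phi> (l *\<^sub>R x)) \<in> Cc_infinity"
proof -
  obtain R where R: "\<And>x. norm x > R \<Longrightarrow> \<phi> x = 0" using Cc_infinityD(3)[OF \<phi>] by auto
  show ?thesis
  proof (rule Cc_infinityI[where R = "R / l"])
    show "Ck k (\<lambda>x. c * \<phi> (l *\<^sub>R x))" for k
      using \<phi> by (intro Ck_dilation) (simp add: Cc_infinity_def)
    fix x :: "real^'n" assume "norm x > R / l"
    then have "norm (l *\<^sub>R x) > R" using l by (simp add: field_simps)
    then show "c * \<phi> (l *\<^sub>R x) = 0" using R by simp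
  qed
qed

text \<open>
  The gradient is bounded and vanishes outside a ball, and the weight is integrable on
  balls.
\<close>

lemma Cc_infinity_energy_finite:
  fixes \<phi> :: "real ^ 'n \<Rightarrow> real"
  assumes \<phi>: "\<phi> \<in> Cc_infinity" and c: "c > - real CARD('n)"
  shows "wint c (\<lambda>x. (norm (grad \<phi> x))\<^sup>2) < \<infinity>"
proof -
  obtain R where R: "R > 0" "\<And>x. norm x > R \<Longrightarrow> \<phi> x = 0" using Cc_infinityD(3)[OF \<phi>] by auto
  have cg: "continuous_on UNIV (grad \<phi>)" by (rule continuous_on_grad[OF Cc_infinityD(1)[OF \<phi>]])
  have z: "grad \<phi> x = 0" if "norm x > R" for x
  proof (rule grad_eqI)
    have "((\<lambda>x. 0) has_derivative inner 0) (at x)" by (simp add: inner_zero_left[abs_def])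
    then show "(\<phi> has_derivative inner 0) (at x)"
    proof (rule has_derivative_transform_within_open)
      show "open (- cball 0 R :: (real^'n) set)" by auto
    qed (use that R in auto)
  qed
  have "compact (grad \<phi> ` cball 0 R)"
    by (intro compact_continuous_image continuous_on_subset[OF cg]) auto
  then have "bounded (grad \<phi> ` cball 0 R)" by (rule compact_imp_bounded)
  then obtain M where M: "\<And>x. x \<in> cball 0 R \<Longrightarrow> norm (grad \<phi> x) \<le> M"
    unfolding bounded_iff by blast
  have "wint c (\<lambda>x. (norm (grad \<phi> x))\<^sup>2) \<le> wint c (\<lambda>x. M\<^sup>2 * indicator (cball (0::real^'n) R) x)"
  proof (rule wint_mono)
    fix x :: "real^'n"
    show "(norm (grad \<phi> x))\<^sup>2 \<le> M\<^sup>2 * indicator (cball 0 R) x"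
      using z[of x] M[of x] by (cases "norm x \<le> R") (auto intro: power_mono)
  qed
  also have "\<dots> = ennreal (M\<^sup>2) * wint c (indicator (cball (0::real^'n) R))"
    by (rule wint_cmult) (auto intro!: borel_measurable_indicator)
  also have "\<dots> < \<infinity>"
    using wint_cball_finite[OF c R(1)] by (simp add: ennreal_mult_less_top)
  finally show ?thesis .
qed

section \<open>Functions with a gradient in the completion\<close>

text \<open>
  An element \<open>u\<close> of the completion together with its gradient \<open>g\<close>, in terms of Borel
  functions, for which Tonelli's theorem and dilations of the variable are available.
\<close>

definition D_pair :: "real \<Rightarrow> (real ^ 'n \<Rightarrow> real) \<Rightarrow> (real ^ 'n \<Rightarrow> real ^ 'n) \<Rightarrow> bool"
  where "D_pair a u g \<longleftrightarrow> u \<in> borel_measurable borel \<and> g \<in> borel_measurable borel \<and>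
    (\<exists>\<phi>. (\<forall>n. \<phi> n \<in> Cc_infinity) \<and> (AE x in lborel. (\<lambda>n. \<phi> n x) \<longlonglongrightarrow> u x) \<and>
      (\<lambda>n. energy a (\<lambda>x. grad (\<phi> n) x - g x)) \<longlonglongrightarrow> 0)"

lemma D_pair_measurable:
  assumes "D_pair a u g"
  shows "u \<in> borel_measurable borel" "g \<in> borel_measurable borel"
  using assms by (auto simp: D_pair_def)

lemma D_pair_test_function:
  assumes "\<phi> \<in> Cc_infinity"
  shows "D_pair a \<phi> (grad \<phi>)"
  unfolding D_pair_def using Cc_infinity_measurable[OF assms] assms
  by (auto intro!: exI[of _ "\<lambda>_. \<phi>"] simp: wint_def)

lemma wint_norm_square_triangle:
  fixes G H :: "real ^ 'n \<Rightarrow> real ^ 'n"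
  assumes [measurable]: "G \<in> borel_measurable borel" "H \<in> borel_measurable borel"
  shows "wint c (\<lambda>x. (norm (G x + H x))\<^sup>2) \<le> 2 * wint c (\<lambda>x. (norm (G x))\<^sup>2) + 2 * wint c (\<lambda>x. (norm (H x))\<^sup>2)"
proof -
  have "wint c (\<lambda>x. (norm (G x + H x))\<^sup>2) \<le> wint c (\<lambda>x. 2 * (norm (G x))\<^sup>2 + 2 * (norm (H x))\<^sup>2)"
  proof (rule wint_mono)
    fix x
    have "(norm (G x + H x))\<^sup>2 \<le> (norm (G x) + norm (H x))\<^sup>2" by (intro power_mono norm_triangle_ineq) simp
    also have "\<dots> \<le> 2 * (norm (G x))\<^sup>2 + 2 * (norm (H x))\<^sup>2"
      using sum_squares_bound[of "norm (G x)" "norm (H x)"] by (simp add: power2_sum)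
    finally show "(norm (G x + H x))\<^sup>2 \<le> 2 * (norm (G x))\<^sup>2 + 2 * (norm (H x))\<^sup>2" .
  qed
  also have "\<dots> = 2 * wint c (\<lambda>x. (norm (G x))\<^sup>2) + 2 * wint c (\<lambda>x. (norm (H x))\<^sup>2)"
    by (subst wint_add) (auto simp: wint_cmult)
  finally show ?thesis .
qed

lemma D_pair_diff:
  assumes u: "D_pair a u g" and v: "D_pair a v h"
  shows "D_pair a (\<lambda>x. u x - v x) (\<lambda>x. g x - h x)"
proof -
  note [measurable] = D_pair_measurable[OF u] D_pair_measurable[OF v]
  from u v obtain \<phi> \<psi> where \<phi>: "\<And>n. \<phi> n \<in> Cc_infinity" "AE x in lborel. (\<lambda>n. \<phi> n x) \<longlonglongrightarrow> u x"
      "(\<lambda>n. energy a (\<lambda>x. grad (\<phi> n) x - g x)) \<longlonglongrightarrow> 0"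
    and \<psi>: "\<And>n. \<psi> n \<in> Cc_infinity" "AE x in lborel. (\<lambda>n. \<psi> n x) \<longlonglongrightarrow> v x"
      "(\<lambda>n. energy a (\<lambda>x. grad (\<psi> n) x - h x)) \<longlonglongrightarrow> 0"
    unfolding D_pair_def by blast
  note [measurable] = Cc_infinity_measurable[OF \<phi>(1)] Cc_infinity_measurable[OF \<psi>(1)]
  show ?thesis unfolding D_pair_def
  proof (intro conjI exI[of _ "\<lambda>n x. \<phi> n x - \<psi> n x"] allI)
    show "(\<lambda>x. \<phi> n x - \<psi> n x) \<in> Cc_infinity" for n
      by (rule Cc_infinity_diff[OF \<phi>(1) \<psi>(1)])
    show "AE x in lborel. (\<lambda>n. \<phi> n x - \<psi> n x) \<longlonglongrightarrow> u x - v x"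
      using \<phi>(2) \<psi>(2) by eventually_elim (rule tendsto_diff)
    show "(\<lambda>n. energy a (\<lambda>x. grad (\<lambda>x. \<phi> n x - \<psi> n x) x - (g x - h x))) \<longlonglongrightarrow> 0"
    proof (rule tendsto_sandwich[OF _ _ tendsto_const])
      show "\<forall>\<^sub>F n in sequentially. energy a (\<lambda>x. grad (\<lambda>x. \<phi> n x - \<psi> n x) x - (g x - h x))
        \<le> 2 * energy a (\<lambda>x. grad (\<phi> n) x - g x) + 2 * energy a (\<lambda>x. grad (\<psi> n) x - h x)"
      proof (intro always_eventually allI)
        fix n
        have "grad (\<lambda>x. \<phi> n x - \<psi> n x) x - (g x - h x) = (grad (\<phi> n) x - g x) + - (grad (\<psi> n) x - h x)" for x
          using grad_diff[OF Cc_infinityD(2)[OF \<phi>(1)] Cc_infinityD(2)[OF \<psi>(1)]] by simp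
        then show "energy a (\<lambda>x. grad (\<lambda>x. \<phi> n x - \<psi> n x) x - (g x - h x))
          \<le> 2 * energy a (\<lambda>x. grad (\<phi> n) x - g x) + 2 * energy a (\<lambda>x. grad (\<psi> n) x - h x)"
          using wint_norm_square_triangle[of "\<lambda>x. grad (\<phi> n) x - g x" "\<lambda>x. - (grad (\<psi> n) x - h x)" "- 2 * a"]
          by (simp only: norm_minus_cancel) measurable
      qed
      have "(\<lambda>n. 2 * energy a (\<lambda>x. grad (\<phi> n) x - g x) + 2 * energy a (\<lambda>x. grad (\<psi> n) x - h x)) \<longlonglongrightarrow> 2 * 0 + 2 * 0"
        by (intro tendsto_add ennreal_tendsto_cmult \<phi>(3) \<psi>(3)) simp_all
      then show "(\<lambda>n. 2 * energy a (\<lambda>x. grad (\<phi> n) x - g x) + 2 * energy a (\<lambda>x. grad (\<psi> n) x - h x)) \<longlonglongrightarrow> 0" by simp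
    qed simp
  qed measurable
qed

text \<open>
  The exponent \<open>s\<close> of the dilations is chosen so that they preserve the energy.
\<close>

lemma wint_energy_dilation:
  fixes g :: "real ^ 'n \<Rightarrow> real ^ 'n"
  assumes [measurable]: "g \<in> borel_measurable borel" and s: "s = (real CARD('n) - 2 - 2 * a) / 2" and l: "l > 0"
  shows "energy a (\<lambda>x. l powr (s + 1) *\<^sub>R g (l *\<^sub>R x)) = energy a g"
proof -
  have "(l powr (s + 1))\<^sup>2 = l powr (real CARD('n) - 2 * a)"
  proof -
    have "(s + 1) + (s + 1) = real CARD('n) - 2 * a" using s by (simp add: field_simps)
    then show ?thesis by (simp only: power2_eq_square powr_add[symmetric])
  qed
  then have "energy a (\<lambda>x. l powr (s + 1) *\<^sub>R g (l *\<^sub>R x))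
      = wint (- 2 * a) (\<lambda>x. l powr (real CARD('n) - 2 * a) * (norm (g (l *\<^sub>R x)))\<^sup>2)"
    by (simp add: power_mult_distrib)
  also have "\<dots> = ennreal (l powr (real CARD('n) - 2 * a)) * energy a (\<lambda>x. g (l *\<^sub>R x))"
    by (rule wint_cmult) auto
  also have "energy a (\<lambda>x. g (l *\<^sub>R x)) = ennreal (l powr (- real CARD('n) - - 2 * a)) * energy a g"
    by (rule wint_dilation[OF _ l, of "\<lambda>x. (norm (g x))\<^sup>2"]) simp
  also have "ennreal (l powr (real CARD('n) - 2 * a)) * (ennreal (l powr (- real CARD('n) - - 2 * a)) * energy a g)
      = ennreal (l powr (real CARD('n) - 2 * a) * l powr (- real CARD('n) - - 2 * a)) * energy a g"
    by (simp only: mult.assoc[symmetric] ennreal_mult'[OF powr_ge_zero])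
  also have "l powr (real CARD('n) - 2 * a) * l powr (- real CARD('n) - - 2 * a) = 1"
    using l by (simp add: powr_add[symmetric])
  finally show ?thesis by simp
qed

lemma D_pair_dilation:
  fixes u :: "real ^ 'n \<Rightarrow> real"
  assumes u: "D_pair a u g" and s: "s = (real CARD('n) - 2 - 2 * a) / 2" and l: "l > 0"
  shows "D_pair a (\<lambda>x. l powr s * u (l *\<^sub>R x)) (\<lambda>x. l powr (s + 1) *\<^sub>R g (l *\<^sub>R x))"
proof -
  note [measurable] = D_pair_measurable[OF u]
  from u obtain \<phi> where \<phi>: "\<And>n. \<phi> n \<in> Cc_infinity" "AE x in lborel. (\<lambda>n. \<phi> n x) \<longlonglongrightarrow> u x"
      "(\<lambda>n. energy a (\<lambda>x. grad (\<phi> n) x - g x)) \<longlonglongrightarrow> 0"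
    unfolding D_pair_def by blast
  note [measurable] = Cc_infinity_measurable[OF \<phi>(1)]
  show ?thesis unfolding D_pair_def
  proof (intro conjI exI[of _ "\<lambda>n x. l powr s * \<phi> n (l *\<^sub>R x)"] allI)
    show "(\<lambda>x. l powr s * \<phi> n (l *\<^sub>R x)) \<in> Cc_infinity" for n
      by (rule Cc_infinity_dilation[OF \<phi>(1) l])
    show "AE x in lborel. (\<lambda>n. l powr s * \<phi> n (l *\<^sub>R x)) \<longlonglongrightarrow> l powr s * u (l *\<^sub>R x)"
      using AE_dilation[OF \<phi>(2) l] by eventually_elim (intro tendsto_intros)
    have "energy a (\<lambda>x. grad (\<lambda>x. l powr s * \<phi> n (l *\<^sub>R x)) x - l powr (s + 1) *\<^sub>R g (l *\<^sub>R x))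
        = energy a (\<lambda>x. grad (\<phi> n) x - g x)" for n
    proof -
      have "grad (\<lambda>x. l powr s * \<phi> n (l *\<^sub>R x)) x - l powr (s + 1) *\<^sub>R g (l *\<^sub>R x)
          = l powr (s + 1) *\<^sub>R (grad (\<phi> n) (l *\<^sub>R x) - g (l *\<^sub>R x))" for x
        using grad_dilation[OF Cc_infinityD(2)[OF \<phi>(1)]] l by (simp add: powr_add scaleR_diff_right)
      then show ?thesis
        using wint_energy_dilation[OF _ s l, of "\<lambda>x. grad (\<phi> n) x - g x"] by simp
    qed
    then show "(\<lambda>n. energy a (\<lambda>x. grad (\<lambda>x. l powr s * \<phi> n (l *\<^sub>R x)) x - l powr (s + 1) *\<^sub>R g (l *\<^sub>R x))) \<longlonglongrightarrow> 0"
      using \<phi>(3) by simp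
  qed measurable
qed

text \<open>
  Energies of approximating test functions are eventually below twice the energy of the
  limit, up to an error that tends to \<open>0\<close>; this suffices to carry homogeneous inequalities
  over to the completion.
\<close>

lemma D_pair_approximation:
  fixes u :: "real ^ 'n \<Rightarrow> real"
  assumes u: "D_pair a u g" and e: "e \<ge> 0" "energy a g \<le> ennreal e"
  obtains \<phi> \<epsilon> where "\<And>n. \<phi> n \<in> Cc_infinity" "AE x in lborel. (\<lambda>n. \<phi> n x) \<longlonglongrightarrow> u x"
    "\<forall>\<^sub>F n in sequentially. energy a (\<lambda>x. grad (\<phi> n) x - g x) \<le> ennreal (\<epsilon> n)"
    "\<forall>\<^sub>F n in sequentially. energy a (\<lambda>x. grad (\<phi> n) x) \<le> ennreal (2 * e + 2 * \<epsilon> n)"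
    "\<And>n. \<epsilon> n \<ge> 0" "\<epsilon> \<longlonglongrightarrow> (0::real)"
proof -
  note [measurable] = D_pair_measurable[OF u]
  from u obtain \<phi> where \<phi>: "\<And>n. \<phi> n \<in> Cc_infinity" "AE x in lborel. (\<lambda>n. \<phi> n x) \<longlonglongrightarrow> u x"
      "(\<lambda>n. energy a (\<lambda>x. grad (\<phi> n) x - g x)) \<longlonglongrightarrow> 0"
    unfolding D_pair_def by blast
  note [measurable] = Cc_infinity_measurable[OF \<phi>(1)]
  define E where "E n = energy a (\<lambda>x. grad (\<phi> n) x - g x)" for n
  define \<epsilon> where "\<epsilon> n = enn2real (E n)" for n
  have "\<forall>\<^sub>F n in sequentially. E n < 1"
    using order_tendstoD(2)[OF \<phi>(3), of 1] by (simp add: E_def)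
  then have E: "\<forall>\<^sub>F n in sequentially. E n = ennreal (\<epsilon> n)"
  proof eventually_elim
    case (elim n)
    then have "E n < top" by (rule less_trans) simp
    then show ?case by (simp add: \<epsilon>_def)
  qed
  show thesis
  proof (rule that[of \<phi> \<epsilon>])
    show "\<forall>\<^sub>F n in sequentially. energy a (\<lambda>x. grad (\<phi> n) x - g x) \<le> ennreal (\<epsilon> n)"
      using E by eventually_elim (simp add: E_def)
    show "\<forall>\<^sub>F n in sequentially. energy a (\<lambda>x. grad (\<phi> n) x) \<le> ennreal (2 * e + 2 * \<epsilon> n)"
      using E
    proof eventually_elim
      case (elim n)
      have "energy a (\<lambda>x. g x + (grad (\<phi> n) x - g x)) \<le> 2 * energy a g + 2 * E n"
        unfolding E_def by (rule wint_norm_square_triangle) measurable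
      also have "\<dots> \<le> ennreal 2 * ennreal e + ennreal 2 * ennreal (\<epsilon> n)"
        unfolding elim by (intro add_mono mult_mono e) auto
      also have "\<dots> = ennreal (2 * e + 2 * \<epsilon> n)"
        using e by (simp add: ennreal_mult'[symmetric] ennreal_plus[symmetric] \<epsilon>_def del: ennreal_plus ennreal_numeral)
      finally show ?case by simp
    qed
    show "\<epsilon> \<longlonglongrightarrow> 0"
    proof -
      have "E \<longlonglongrightarrow> ennreal 0" using \<phi>(3) by (simp add: E_def[abs_def])
      then show ?thesis unfolding \<epsilon>_def[abs_def] by (rule tendsto_enn2real) simp
    qed
  qed (use \<phi> in \<open>auto simp: \<epsilon>_def\<close>)
qed

lemma D_pair_energy_finite:
  fixes u :: "real ^ 'n \<Rightarrow> real"
  assumes u: "D_pair a u g" and a: "a < (real CARD('n) - 2) / 2"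
  shows "energy a g < \<infinity>"
proof -
  note [measurable] = D_pair_measurable[OF u]
  from u obtain \<phi> where \<phi>: "\<And>n. \<phi> n \<in> Cc_infinity"
      "(\<lambda>n. energy a (\<lambda>x. grad (\<phi> n) x - g x)) \<longlonglongrightarrow> 0"
    unfolding D_pair_def by blast
  note [measurable] = Cc_infinity_measurable[OF \<phi>(1)]
  have "\<forall>\<^sub>F n in sequentially. energy a (\<lambda>x. grad (\<phi> n) x - g x) < 1"
    using order_tendstoD(2)[OF \<phi>(2), of 1] by simp
  then obtain n where n: "energy a (\<lambda>x. grad (\<phi> n) x - g x) < 1"
    using eventually_happens'[OF sequentially_bot] by blast
  have "energy a (\<lambda>x. grad (\<phi> n) x + - (grad (\<phi> n) x - g x))
      \<le> 2 * energy a (\<lambda>x. grad (\<phi> n) x) + 2 * energy a (\<lambda>x. - (grad (\<phi> n) x - g x))"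
    by (rule wint_norm_square_triangle) measurable
  also have "\<dots> < \<infinity>"
  proof -
    have "energy a (\<lambda>x. grad (\<phi> n) x) < \<infinity>"
      by (rule Cc_infinity_energy_finite[OF \<phi>(1)]) (use a in simp)
    moreover have "energy a (\<lambda>x. - (grad (\<phi> n) x - g x)) < \<infinity>"
      using n unfolding norm_minus_cancel by (rule less_trans) simp
    ultimately show ?thesis by (simp add: ennreal_mult_less_top)
  qed
  finally show ?thesis by simp
qed

lemma D_pair_CKN:
  fixes N p a b :: real
  defines "N \<equiv> real CARD('n)"
  assumes N: "N \<ge> 3" and a: "a < (N - 2) / 2" and b: "a \<le> b" "b < a + 1"
    and p: "p = 2 * N / (N - 2 * (1 + a - b))"
  shows "\<exists>C\<ge>0. \<forall>(u::real^'n \<Rightarrow> real) g e. D_pair a u g \<longrightarrow> e \<ge> 0 \<longrightarrow>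
    energy a g \<le> ennreal e \<longrightarrow>
    wint (- b * p) (\<lambda>x. \<bar>u x\<bar> powr p) \<le> ennreal (C * e powr (p / 2))"
proof -
  obtain C where C: "C \<ge> 0" "\<And>(\<phi>::real^'n \<Rightarrow> real) G e. punctured_C1 \<phi> G \<Longrightarrow> e \<ge> 0 \<Longrightarrow>
    energy a G \<le> ennreal e \<Longrightarrow>
    wint (- b * p) (\<lambda>x. \<bar>\<phi> x\<bar> powr p) \<le> ennreal (C * e powr (p / 2))"
    using CKN_inequality[where 'n='n, of a b p] assms unfolding N_def by blast
  have p0: "p > 0" using N b by (simp add: p)
  have "wint (- b * p) (\<lambda>x. \<bar>u x\<bar> powr p) \<le> ennreal (C * 2 powr (p / 2) * e powr (p / 2))"
    if u: "D_pair a u g" and e: "e \<ge> 0" "energy a g \<le> ennreal e"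
    for u :: "real^'n \<Rightarrow> real" and g e
  proof -
    note [measurable] = D_pair_measurable[OF u]
    obtain \<phi> \<epsilon> where \<phi>: "\<And>n. \<phi> n \<in> Cc_infinity" "AE x in lborel. (\<lambda>n. \<phi> n x) \<longlonglongrightarrow> u x"
      and le: "\<forall>\<^sub>F n in sequentially. energy a (\<lambda>x. grad (\<phi> n) x) \<le> ennreal (2 * e + 2 * \<epsilon> n)"
      and \<epsilon>: "\<And>n. \<epsilon> n \<ge> 0" "\<epsilon> \<longlonglongrightarrow> (0::real)"
      by (rule D_pair_approximation[OF u e]) blast
    note [measurable] = Cc_infinity_measurable[OF \<phi>(1)]
    have "wint (- b * p) (\<lambda>x. \<bar>u x\<bar> powr p) \<le> ennreal (C * (2 * e + 2 * 0) powr (p / 2))"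
      unfolding wint_def
    proof (rule nn_integral_Fatou_bound)
      show "AE x in lborel. (\<lambda>n. norm x powr (- b * p) * \<bar>\<phi> n x\<bar> powr p) \<longlonglongrightarrow> norm x powr (- b * p) * \<bar>u x\<bar> powr p"
        using \<phi>(2) by eventually_elim (intro tendsto_mult tendsto_const tendsto_powr' tendsto_rabs, use p0 in auto)
      show "\<forall>\<^sub>F n in sequentially. (\<integral>\<^sup>+x. ennreal (norm x powr (- b * p) * \<bar>\<phi> n x\<bar> powr p) \<partial>lborel)
          \<le> ennreal (C * (2 * e + 2 * \<epsilon> n) powr (p / 2))"
        using le
      proof eventually_elim
        case (elim n)
        show ?case
          using C(2)[OF Cc_infinity_punctured_C1[OF \<phi>(1)] _ elim] e \<epsilon>(1)[of n] by (simp add: wint_def)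
      qed
      show "(\<lambda>n. C * (2 * e + 2 * \<epsilon> n) powr (p / 2)) \<longlonglongrightarrow> C * (2 * e + 2 * 0) powr (p / 2)"
        by (intro tendsto_mult tendsto_const tendsto_powr' tendsto_add \<epsilon>(2)) (use p0 e \<epsilon>(1) in auto)
    qed measurable
    then show ?thesis using e by (simp add: powr_mult mult.assoc)
  qed
  then show ?thesis using C(1) by (intro exI[of _ "C * 2 powr (p / 2)"]) auto
qed

lemma D_pair_dilation_difference:
  fixes u :: "real ^ 'n \<Rightarrow> real"
  assumes u: "D_pair a u g" and e: "e \<ge> 0" "energy a g \<le> ennreal e"
    and s: "s = (real CARD('n) - 2 - 2 * a) / 2" "s > 0" and l: "l \<ge> 1"
  shows "wint (- 2 * a - 2) (\<lambda>x. (l powr s * u (l *\<^sub>R x) - u x)\<^sup>2) \<le> ennreal (8 * e * (l - 1)\<^sup>2)"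
proof -
  note [measurable] = D_pair_measurable[OF u]
  obtain \<phi> \<epsilon> where \<phi>: "\<And>n. \<phi> n \<in> Cc_infinity" "AE x in lborel. (\<lambda>n. \<phi> n x) \<longlonglongrightarrow> u x"
    and le: "\<forall>\<^sub>F n in sequentially. energy a (\<lambda>x. grad (\<phi> n) x) \<le> ennreal (2 * e + 2 * \<epsilon> n)"
    and \<epsilon>: "\<And>n. \<epsilon> n \<ge> 0" "\<epsilon> \<longlonglongrightarrow> (0::real)"
    by (rule D_pair_approximation[OF u e]) blast
  note [measurable] = Cc_infinity_measurable[OF \<phi>(1)]
  have l0: "l > 0" using l by simp
  have "wint (- 2 * a - 2) (\<lambda>x. (l powr s * u (l *\<^sub>R x) - u x)\<^sup>2) \<le> ennreal (4 * (l - 1)\<^sup>2 * (2 * e + 2 * 0))"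
    unfolding wint_def
  proof (rule nn_integral_Fatou_bound)
    show "AE x in lborel. (\<lambda>n. norm x powr (- 2 * a - 2) * (l powr s * \<phi> n (l *\<^sub>R x) - \<phi> n x)\<^sup>2)
        \<longlonglongrightarrow> norm x powr (- 2 * a - 2) * (l powr s * u (l *\<^sub>R x) - u x)\<^sup>2"
      using \<phi>(2) AE_dilation[OF \<phi>(2) l0] by eventually_elim (intro tendsto_intros)
    show "\<forall>\<^sub>F n in sequentially. (\<integral>\<^sup>+x. ennreal (norm x powr (- 2 * a - 2) * (l powr s * \<phi> n (l *\<^sub>R x) - \<phi> n x)\<^sup>2) \<partial>lborel)
        \<le> ennreal (4 * (l - 1)\<^sup>2 * (2 * e + 2 * \<epsilon> n))"
      using le
    proof eventually_elim
      case (elim n)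
      have "wint (- 2 * a - 2) (\<lambda>x. (l powr s * \<phi> n (l *\<^sub>R x) - \<phi> n x)\<^sup>2)
          \<le> ennreal (4 * (l - 1)\<^sup>2) * ennreal (2 * e + 2 * \<epsilon> n)"
        by (rule order_trans[OF dilation_difference[OF Cc_infinity_punctured_C1[OF \<phi>(1)] s l]])
           (intro mult_left_mono elim, simp)
      also have "\<dots> = ennreal (4 * (l - 1)\<^sup>2 * (2 * e + 2 * \<epsilon> n))"
        by (subst ennreal_mult'[symmetric]) auto
      finally show ?case by (simp add: wint_def)
    qed
    show "(\<lambda>n. 4 * (l - 1)\<^sup>2 * (2 * e + 2 * \<epsilon> n)) \<longlonglongrightarrow> 4 * (l - 1)\<^sup>2 * (2 * e + 2 * 0)"
      by (intro tendsto_intros \<epsilon>(2))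
  qed measurable
  then show ?thesis by (simp add: mult_ac)
qed

section \<open>Signed weighted integrals\<close>

definition wlint :: "real \<Rightarrow> (real ^ 'n \<Rightarrow> real) \<Rightarrow> real"
  where "wlint c f = (\<integral>x. norm x powr c * f x \<partial>lborel)"

abbreviation wintegrable :: "real \<Rightarrow> (real ^ 'n \<Rightarrow> real) \<Rightarrow> bool"
  where "wintegrable c f \<equiv> integrable lborel (\<lambda>x. norm x powr c * f x)"

lemma wlint_bound:
  assumes [measurable]: "f \<in> borel_measurable borel"
    and f: "wint c (\<lambda>x. \<bar>f x\<bar>) \<le> ennreal r" "r \<ge> 0"
  shows "wintegrable c f" "\<bar>wlint c f\<bar> \<le> r"
proof -
  have e: "(\<integral>\<^sup>+x. ennreal (norm (norm x powr c * f x)) \<partial>lborel) = wint c (\<lambda>x. \<bar>f x\<bar>)"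
    by (simp add: wint_def abs_mult)
  show i: "wintegrable c f"
    using f e by (intro integrableI_bounded) (auto intro: le_less_trans)
  have "ennreal (norm (wlint c f)) \<le> ennreal r"
    using integral_norm_bound_ennreal[OF i] e f(1) by (simp add: wlint_def)
  then show "\<bar>wlint c f\<bar> \<le> r" using f(2) by (simp add: ennreal_le_iff)
qed

lemma wintegrable_iff_finite:
  assumes [measurable]: "f \<in> borel_measurable borel"
  shows "wintegrable c f \<longleftrightarrow> wint c (\<lambda>x. \<bar>f x\<bar>) < \<infinity>"
  by (simp add: integrable_iff_bounded wint_def abs_mult)

lemma wint_eq_wlint:
  assumes "wintegrable c f" "\<And>x. f x \<ge> 0"
  shows "wint c f = ennreal (wlint c f)"
  unfolding wint_def wlint_def using assms by (intro nn_integral_eq_integral) auto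

lemma wlint_dilation:
  fixes f :: "real ^ 'n \<Rightarrow> real"
  assumes [measurable]: "f \<in> borel_measurable borel" and r: "r > 0"
  shows "wlint c (\<lambda>x. f (r *\<^sub>R x)) = r powr (- real CARD('n) - c) * wlint c f"
proof -
  have "wlint c (\<lambda>x. f (r *\<^sub>R x)) = (\<integral>x. r powr - c * (norm (r *\<^sub>R x) powr c * f (r *\<^sub>R x)) \<partial>lborel)"
    unfolding wlint_def using r
    by (intro Bochner_Integration.integral_cong) (auto simp: powr_mult powr_minus mult.assoc[symmetric])
  also have "\<dots> = r powr - c * (\<integral>x. norm (r *\<^sub>R x) powr c * f (r *\<^sub>R x) \<partial>lborel)"
    by simp
  also have "(\<integral>x. norm (r *\<^sub>R x) powr c * f (r *\<^sub>R x) \<partial>lborel) = r powr - real CARD('n) * wlint c f"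
    unfolding wlint_def by (rule integral_dilation[OF _ r, of "\<lambda>x. norm x powr c * f x"]) simp
  finally have "wlint c (\<lambda>x. f (r *\<^sub>R x)) = (r powr - c * r powr - real CARD('n)) * wlint c f" by simp
  also have "r powr - c * r powr - real CARD('n) = r powr (- real CARD('n) - c)"
    by (subst powr_add[symmetric], rule arg_cong[of _ _ "\<lambda>e. r powr e"]) simp
  finally show ?thesis .
qed

lemma wlint_diff:
  assumes "wintegrable c f" "wintegrable c g"
  shows "wintegrable c (\<lambda>x. f x - g x)" "wlint c (\<lambda>x. f x - g x) = wlint c f - wlint c g"
  using Bochner_Integration.integrable_diff[OF assms] Bochner_Integration.integral_diff[OF assms] by (simp_all add: wlint_def right_diff_distrib)

lemma wlint_add:
  assumes "wintegrable c f" "wintegrable c g"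
  shows "wintegrable c (\<lambda>x. f x + g x)" "wlint c (\<lambda>x. f x + g x) = wlint c f + wlint c g"
  using Bochner_Integration.integrable_add[OF assms] Bochner_Integration.integral_add[OF assms] by (simp_all add: wlint_def distrib_left)

lemma wlint_cmult:
  shows "wintegrable c f \<Longrightarrow> wintegrable c (\<lambda>x. k * f x)" "wlint c (\<lambda>x. k * f x) = k * wlint c f"
  by (simp_all add: wlint_def mult.left_commute)

lemma wint_Hoelder:
  assumes [measurable]: "F \<in> borel_measurable borel" "H \<in> borel_measurable borel"
    and "\<And>x. F x \<ge> 0" "\<And>x. H x \<ge> 0"
    and ab: "0 < \<alpha>" "0 < \<beta>" "\<alpha> + \<beta> = 1" and "A \<ge> 0" "B \<ge> 0"
    and F: "wint c F \<le> ennreal A" and H: "wint c H \<le> ennreal B"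
  shows "wint c (\<lambda>x. F x powr \<alpha> * H x powr \<beta>) \<le> ennreal (A powr \<alpha> * B powr \<beta>)"
proof -
  have "norm x powr c * (F x powr \<alpha> * H x powr \<beta>) = (norm x powr c * F x) powr \<alpha> * (norm x powr c * H x) powr \<beta>" for x
  proof -
    have "norm x powr c = norm x powr (c * \<alpha>) * norm x powr (c * \<beta>)"
      using ab(3) by (simp only: powr_add[symmetric] distrib_left[symmetric]) simp
    moreover have "(norm x powr c * F x) powr \<alpha> * (norm x powr c * H x) powr \<beta>
        = (norm x powr (c * \<alpha>) * norm x powr (c * \<beta>)) * (F x powr \<alpha> * H x powr \<beta>)"
      using assms(3,4)[of x] by (simp add: powr_mult powr_powr)
    ultimately show ?thesis by (simp only:)
  qed
  then have "wint c (\<lambda>x. F x powr \<alpha> * H x powr \<beta>) = (\<integral>\<^sup>+x. ennreal ((norm x powr c * F x) powr \<alpha> * (norm x powr c * H x) powr \<beta>) \<partial>lborel)"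
    by (simp add: wint_def)
  also have "\<dots> \<le> ennreal (A powr \<alpha> * B powr \<beta>)"
    using assms by (intro Hoelder_nn_integral) (auto simp: wint_def)
  finally show ?thesis .
qed

lemma wint_inner_bound:
  fixes g h :: "real ^ 'n \<Rightarrow> real ^ 'n"
  assumes [measurable]: "g \<in> borel_measurable borel" "h \<in> borel_measurable borel"
    and g: "wint c (\<lambda>x. (norm (g x))\<^sup>2) \<le> ennreal A" and h: "wint c (\<lambda>x. (norm (h x))\<^sup>2) \<le> ennreal B"
    and AB: "A \<ge> 0" "B \<ge> 0"
  shows "wint c (\<lambda>x. \<bar>inner (g x) (h x)\<bar>) \<le> ennreal (sqrt (A * B))"
proof -
  have "wint c (\<lambda>x. \<bar>inner (g x) (h x)\<bar>) \<le> wint c (\<lambda>x. ((norm (g x))\<^sup>2) powr (1/2) * ((norm (h x))\<^sup>2) powr (1/2))"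
    by (rule wint_mono) (simp add: powr_half_sqrt Cauchy_Schwarz_ineq2)
  also have "\<dots> \<le> ennreal (A powr (1/2) * B powr (1/2))"
    using g h AB by (intro wint_Hoelder) auto
  also have "A powr (1/2) * B powr (1/2) = sqrt (A * B)"
    using AB by (simp add: powr_half_sqrt real_sqrt_mult)
  finally show ?thesis .
qed

text \<open>
  Hoelder's inequality with exponents \<open>p/(p - r)\<close> and \<open>p/r\<close>; used with \<open>r = 1\<close> for the
  nonlinear term of the equation and with \<open>r = 2\<close> for its linearisation.
\<close>

lemma wint_Hoelder_power:
  fixes f v :: "real ^ 'n \<Rightarrow> real"
  assumes [measurable]: "f \<in> borel_measurable borel" "v \<in> borel_measurable borel"
    and f0: "\<And>x. f x \<ge> 0" and r: "0 < r" "r < p"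
    and f: "wint c (\<lambda>x. f x powr p) \<le> ennreal A" and v: "wint c (\<lambda>x. \<bar>v x\<bar> powr p) \<le> ennreal B"
    and AB: "A \<ge> 0" "B \<ge> 0"
  shows "wint c (\<lambda>x. f x powr (p - r) * \<bar>v x\<bar> powr r) \<le> ennreal (A powr ((p - r) / p) * B powr (r / p))"
proof -
  have "wint c (\<lambda>x. (f x powr p) powr ((p - r) / p) * (\<bar>v x\<bar> powr p) powr (r / p)) \<le> ennreal (A powr ((p - r) / p) * B powr (r / p))"
    using f v AB r by (intro wint_Hoelder) (auto simp: field_simps)
  then show ?thesis using r by (simp add: powr_powr)
qed

section \<open>Elementary inequalities for powers\<close>

lemma powr_mvt:
  fixes x y q :: real
  assumes xy: "x \<ge> 0" "y \<ge> 0" and q: "q > 0"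
  obtains \<xi> where "min x y \<le> \<xi>" "\<xi> \<le> max x y" "y powr q - x powr q = q * \<xi> powr (q - 1) * (y - x)"
proof -
  have *: "\<exists>\<xi>. x \<le> \<xi> \<and> \<xi> \<le> y \<and> y powr q - x powr q = q * \<xi> powr (q - 1) * (y - x)"
    if "0 \<le> x" "x < y" for x y :: real
  proof -
    have c: "continuous_on {x..y} (\<lambda>t. t powr q)"
      using that q by (intro continuous_on_powr' continuous_intros) auto
    have d: "((\<lambda>t. t powr q) has_derivative (\<lambda>h. q * t powr (q - 1) * h)) (at t)" if "x < t" "t < y" for t
      using has_real_derivative_powr[of t q] that \<open>0 \<le> x\<close> by (simp add: has_field_derivative_def)
    obtain \<xi> where "x < \<xi>" "\<xi> < y" "y powr q - x powr q = q * \<xi> powr (q - 1) * (y - x)"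
      by (rule mvt[OF \<open>x < y\<close> c d])
    then show ?thesis by (intro exI[of _ \<xi>]) auto
  qed
  consider "x < y" | "y < x" | "x = y" by linarith
  then show thesis
  proof cases
    case 1
    with *[of x y] xy obtain \<xi> where "x \<le> \<xi>" "\<xi> \<le> y" "y powr q - x powr q = q * \<xi> powr (q - 1) * (y - x)" by auto
    then show thesis using 1 by (intro that[of \<xi>]) auto
  next
    case 2
    with *[of y x] xy obtain \<xi> where "y \<le> \<xi>" "\<xi> \<le> x" "x powr q - y powr q = q * \<xi> powr (q - 1) * (x - y)" by auto
    then show thesis using 2 by (intro that[of \<xi>]) (auto simp: algebra_simps)
  next
    case 3
    then show thesis by (intro that[of x]) auto
  qed
qed

lemma powr_difference_bound:
  fixes x y q :: real
  assumes xy: "x \<ge> 0" "y \<ge> 0" and q: "q > 1"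
  shows "\<bar>y powr q - x powr q\<bar> \<le> q * max x y powr (q - 1) * \<bar>y - x\<bar>"
proof -
  obtain \<xi> where \<xi>: "min x y \<le> \<xi>" "\<xi> \<le> max x y" "y powr q - x powr q = q * \<xi> powr (q - 1) * (y - x)"
    using powr_mvt[OF xy, of q] q by auto
  have "\<xi> powr (q - 1) \<le> max x y powr (q - 1)" using \<xi> xy q by (intro powr_mono2) auto
  then have "q * \<xi> powr (q - 1) * \<bar>y - x\<bar> \<le> q * max x y powr (q - 1) * \<bar>y - x\<bar>"
    using q by (intro mult_right_mono mult_left_mono) auto
  then show ?thesis using \<xi>(3) q by (simp add: abs_mult)
qed

lemma max_powr_le:
  fixes x y r :: real
  shows "max x y powr r \<le> x powr r + y powr r"
  by (simp add: max_def)

lemma powr_Taylor_bound: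
  fixes x y p :: real
  assumes xy: "x \<ge> 0" "y \<ge> 0" and p: "p > 2"
  shows "\<bar>y powr p - x powr p - p * x powr (p - 1) * (y - x)\<bar> \<le> p * (p - 1) * ((x powr (p - 2) + y powr (p - 2)) * (y - x)\<^sup>2)"
proof -
  obtain \<xi> where \<xi>: "min x y \<le> \<xi>" "\<xi> \<le> max x y" "y powr p - x powr p = p * \<xi> powr (p - 1) * (y - x)"
    using powr_mvt[OF xy, of p] p by auto
  have \<xi>0: "\<xi> \<ge> 0" using \<xi>(1) xy by linarith
  have \<xi>x: "\<bar>\<xi> - x\<bar> \<le> \<bar>y - x\<bar>" using \<xi>(1,2) by (auto simp: min_def max_def split: if_splits)
  have "\<bar>\<xi> powr (p - 1) - x powr (p - 1)\<bar> \<le> (p - 1) * max x \<xi> powr (p - 1 - 1) * \<bar>\<xi> - x\<bar>"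
    by (rule powr_difference_bound) (use xy \<xi>0 p in auto)
  also have "\<dots> \<le> (p - 1) * max x y powr (p - 2) * \<bar>y - x\<bar>"
  proof -
    have "max x \<xi> powr (p - 2) \<le> max x y powr (p - 2)"
      using \<xi>(1,2) xy p by (intro powr_mono2) auto
    then show ?thesis using p \<xi>x by (intro mult_mono) auto
  qed
  also have "\<dots> \<le> (p - 1) * (x powr (p - 2) + y powr (p - 2)) * \<bar>y - x\<bar>"
    using p by (intro mult_right_mono mult_left_mono max_powr_le) auto
  finally have "p * \<bar>y - x\<bar> * \<bar>\<xi> powr (p - 1) - x powr (p - 1)\<bar>
      \<le> p * \<bar>y - x\<bar> * ((p - 1) * (x powr (p - 2) + y powr (p - 2)) * \<bar>y - x\<bar>)"
    using p by (intro mult_left_mono) auto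
  also have "\<dots> = p * (p - 1) * ((x powr (p - 2) + y powr (p - 2)) * (\<bar>y - x\<bar> * \<bar>y - x\<bar>))"
    by (simp only: mult_ac)
  also have "\<bar>y - x\<bar> * \<bar>y - x\<bar> = (y - x)\<^sup>2" by (simp add: power2_eq_square)
  also have "p * \<bar>y - x\<bar> * \<bar>\<xi> powr (p - 1) - x powr (p - 1)\<bar> = \<bar>p * (y - x) * (\<xi> powr (p - 1) - x powr (p - 1))\<bar>"
    using p by (simp add: abs_mult)
  also have "p * (y - x) * (\<xi> powr (p - 1) - x powr (p - 1)) = y powr p - x powr p - p * x powr (p - 1) * (y - x)"
    unfolding \<xi>(3) by (simp add: algebra_simps)
  finally show ?thesis .
qed

section \<open>The dilated solution\<close>

text \<open>
  The data of the theorem in terms of Borel functions \<open>u\<close>, \<open>g\<close>, with the boundedness of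
  \<open>\<nabla>K(x) \<bullet> x\<close> in the integrated form of a Lipschitz condition along rays. The equation is
  required for test functions; it extends to the completion below.
\<close>

locale weak_solution_setting =
  fixes a b p N s k\<^sub>0 L :: real and K u :: "real ^ 'n \<Rightarrow> real" and g :: "real ^ 'n \<Rightarrow> real ^ 'n"
  assumes N_eq: "N = real CARD('n)" and N: "N \<ge> 3"
    and a: "a < (N - 2) / 2" and b: "a \<le> b" "b < a + 1"
    and p: "p = 2 * N / (N - 2 * (1 + a - b))" and s_eq: "s = (N - 2 - 2 * a) / 2"
    and pair: "D_pair a u g" and u0: "\<And>x. u x \<ge> 0"
    and K_measurable [measurable]: "K \<in> borel_measurable borel" and K_bound: "\<And>x. \<bar>K x\<bar> \<le> k\<^sub>0"
    and L0: "L \<ge> 0" and K_Lipschitz: "\<And>x l. l \<ge> 1 \<Longrightarrow> \<bar>K (l *\<^sub>R x) - K x\<bar> \<le> L * (l - 1)"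
    and equation: "\<And>v. v \<in> Cc_infinity \<Longrightarrow>
      wlint (- 2 * a) (\<lambda>x. inner (g x) (grad v x)) = wlint (- b * p) (\<lambda>x. K x * u x powr (p - 1) * v x)"
begin

lemma u_measurable [measurable]: "u \<in> borel_measurable borel"
  and g_measurable [measurable]: "g \<in> borel_measurable borel"
  using D_pair_measurable[OF pair] by auto

lemma s: "s = (real CARD('n) - 2 - 2 * a) / 2" "s > 0"
  using a by (auto simp: s_eq N_eq)

lemma p2: "p > 2"
proof -
  have "N - 2 * (1 + a - b) > 0" "N - 2 * (1 + a - b) < N" using N b by auto
  then show ?thesis by (simp add: p field_simps)
qed

text \<open>
  The relation between the exponents that makes the dilations preserve \<open>\<integral> v\<^bsup>p\<^esup> / |x|\<^bsup>bp\<^esup>\<close>.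
\<close>

lemma scaling_exponent: "s * p = N - b * p"
proof -
  have "p * (N - 2 * (1 + a - b)) = 2 * N" using N b by (simp add: p)
  then show ?thesis by (simp add: s_eq field_simps)
qed

lemma k0: "k\<^sub>0 \<ge> 0" using K_bound[of 0] by linarith

definition A :: real where "A = enn2real (energy a g)"

lemma energy_eq:
  fixes v :: "real ^ 'n \<Rightarrow> real"
  assumes "D_pair a v h"
  shows "energy a h = ennreal (wlint (- 2 * a) (\<lambda>x. (norm (h x))\<^sup>2))"
    "wintegrable (- 2 * a) (\<lambda>x. (norm (h x))\<^sup>2)" "wlint (- 2 * a) (\<lambda>x. (norm (h x))\<^sup>2) \<ge> 0"
proof -
  note [measurable] = D_pair_measurable[OF assms]
  have "energy a h < \<infinity>" using D_pair_energy_finite[OF assms] a by (simp add: N_eq)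
  then show i: "wintegrable (- 2 * a) (\<lambda>x. (norm (h x))\<^sup>2)" by (subst wintegrable_iff_finite) auto
  then show "energy a h = ennreal (wlint (- 2 * a) (\<lambda>x. (norm (h x))\<^sup>2))" by (rule wint_eq_wlint) simp
  show "wlint (- 2 * a) (\<lambda>x. (norm (h x))\<^sup>2) \<ge> 0" unfolding wlint_def by (rule Bochner_Integration.integral_nonneg) auto
qed

lemma A: "energy a g = ennreal A" "A \<ge> 0"
  using energy_eq[OF pair] by (auto simp: A_def)

definition C\<^sub>S :: real where
  "C\<^sub>S = (SOME C. C \<ge> 0 \<and> (\<forall>(u::real^'n \<Rightarrow> real) g e. D_pair a u g \<longrightarrow> e \<ge> 0 \<longrightarrow>
    energy a g \<le> ennreal e \<longrightarrow>
    wint (- b * p) (\<lambda>x. \<bar>u x\<bar> powr p) \<le> ennreal (C * e powr (p / 2))))"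

lemma C\<^sub>S: "C\<^sub>S \<ge> 0" "\<And>(v::real^'n \<Rightarrow> real) h e. D_pair a v h \<Longrightarrow> e \<ge> 0 \<Longrightarrow> energy a h \<le> ennreal e \<Longrightarrow>
    wint (- b * p) (\<lambda>x. \<bar>v x\<bar> powr p) \<le> ennreal (C\<^sub>S * e powr (p / 2))"
proof -
  have "C\<^sub>S \<ge> 0 \<and> (\<forall>(u::real^'n \<Rightarrow> real) g e. D_pair a u g \<longrightarrow> e \<ge> 0 \<longrightarrow>
    energy a g \<le> ennreal e \<longrightarrow>
    wint (- b * p) (\<lambda>x. \<bar>u x\<bar> powr p) \<le> ennreal (C\<^sub>S * e powr (p / 2)))"
    unfolding C\<^sub>S_def by (rule someI_ex) (rule D_pair_CKN[where 'n='n, of a b p, folded N_eq, OF N a b p])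
  then show "C\<^sub>S \<ge> 0" "\<And>(v::real^'n \<Rightarrow> real) h e. D_pair a v h \<Longrightarrow> e \<ge> 0 \<Longrightarrow> energy a h \<le> ennreal e \<Longrightarrow>
    wint (- b * p) (\<lambda>x. \<bar>v x\<bar> powr p) \<le> ennreal (C\<^sub>S * e powr (p / 2))" by blast+
qed

definition U :: real where "U = C\<^sub>S * A powr (p / 2)"

lemma U: "wint (- b * p) (\<lambda>x. u x powr p) \<le> ennreal U" "U \<ge> 0"
  using C\<^sub>S(2)[OF pair A(2)] A(1) C\<^sub>S(1) u0 by (auto simp: U_def)

definition Z :: real where "Z = U powr ((p - 1) / p) * C\<^sub>S powr (1 / p)"

lemma Z0: "Z \<ge> 0" by (simp add: Z_def)

lemma nonlinear_pairing_bound: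
  assumes v: "D_pair a v h" and e: "e \<ge> 0" "energy a h \<le> ennreal e"
  shows "wint (- b * p) (\<lambda>x. u x powr (p - 1) * \<bar>v x\<bar>)
    \<le> ennreal (Z * sqrt e)"
proof -
  note [measurable] = D_pair_measurable[OF v]
  have "wint (- b * p) (\<lambda>x. u x powr (p - 1) * \<bar>v x\<bar> powr 1)
      \<le> ennreal (U powr ((p - 1) / p) * (C\<^sub>S * e powr (p / 2)) powr (1 / p))"
    by (rule wint_Hoelder_power) (use u0 p2 U C\<^sub>S(1) C\<^sub>S(2)[OF v e] in auto)
  also have "(C\<^sub>S * e powr (p / 2)) powr (1 / p) = C\<^sub>S powr (1 / p) * sqrt e"
    using C\<^sub>S(1) e p2 by (simp add: powr_mult powr_powr powr_half_sqrt)
  finally show ?thesis by (simp add: Z_def mult.assoc)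
qed

lemma nonlinear_integral_bound:
  assumes v: "D_pair a v h" and e: "e \<ge> 0" "energy a h \<le> ennreal e"
  shows "wintegrable (- b * p) (\<lambda>x. K x * u x powr (p - 1) * v x)"
    and "\<bar>wlint (- b * p) (\<lambda>x. K x * u x powr (p - 1) * v x)\<bar> \<le> k\<^sub>0 * (Z * sqrt e)"
proof -
  note [measurable] = D_pair_measurable[OF v]
  have "wint (- b * p) (\<lambda>x. \<bar>K x * u x powr (p - 1) * v x\<bar>) \<le> wint (- b * p) (\<lambda>x. k\<^sub>0 * (u x powr (p - 1) * \<bar>v x\<bar>))"
    by (rule wint_mono) (auto simp: abs_mult mult.assoc intro!: mult_right_mono K_bound)
  also have "\<dots> = ennreal k\<^sub>0 * wint (- b * p) (\<lambda>x. u x powr (p - 1) * \<bar>v x\<bar>)"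
    by (rule wint_cmult) (use k0 in auto)
  also have "\<dots> \<le> ennreal k\<^sub>0 * ennreal (Z * sqrt e)"
    by (intro mult_left_mono nonlinear_pairing_bound[OF v e]) simp
  also have "\<dots> = ennreal (k\<^sub>0 * (Z * sqrt e))" using k0 by (simp add: ennreal_mult')
  finally have bd: "wint (- b * p) (\<lambda>x. \<bar>K x * u x powr (p - 1) * v x\<bar>) \<le> ennreal (k\<^sub>0 * (Z * sqrt e))" .
  have nn: "k\<^sub>0 * (Z * sqrt e) \<ge> 0" using k0 e Z0 by simp
  show "wintegrable (- b * p) (\<lambda>x. K x * u x powr (p - 1) * v x)"
    "\<bar>wlint (- b * p) (\<lambda>x. K x * u x powr (p - 1) * v x)\<bar> \<le> k\<^sub>0 * (Z * sqrt e)"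
    by (rule wlint_bound[OF _ bd nn], measurable)+
qed

lemma nonlinear_integrable:
  assumes v: "D_pair a v h"
  shows "wintegrable (- b * p) (\<lambda>x. K x * u x powr (p - 1) * v x)"
  using nonlinear_integral_bound(1)[OF v energy_eq(3)[OF v]] energy_eq(1)[OF v] by simp

text \<open>
  Both sides are continuous in the test function with respect to the energy norm: the left
  side by the Cauchy--Schwarz inequality, the right side by the Hoelder and
  Caffarelli--Kohn--Nirenberg inequalities.
\<close>

lemma D_pair_equation:
  assumes v: "D_pair a v h"
  shows "wlint (- 2 * a) (\<lambda>x. inner (g x) (h x)) = wlint (- b * p) (\<lambda>x. K x * u x powr (p - 1) * v x)"
proof -
  note [measurable] = D_pair_measurable[OF v]
  let ?e = "wlint (- 2 * a) (\<lambda>x. (norm (h x))\<^sup>2)"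
  obtain \<phi> \<epsilon> where \<phi>: "\<And>n. \<phi> n \<in> Cc_infinity"
    and le: "\<forall>\<^sub>F n in sequentially. energy a (\<lambda>x. grad (\<phi> n) x - h x) \<le> ennreal (\<epsilon> n)"
    and \<epsilon>: "\<And>n. \<epsilon> n \<ge> 0" "\<epsilon> \<longlonglongrightarrow> (0::real)"
    by (rule D_pair_approximation[OF v, of ?e]) (use energy_eq[OF v] in auto)
  note [measurable] = Cc_infinity_measurable[OF \<phi>]
  have gi: "wintegrable (- 2 * a) (\<lambda>x. inner (g x) (f x))" if "D_pair a w f" for w f
  proof -
    note [measurable] = D_pair_measurable[OF that]
    show ?thesis
      by (rule wlint_bound(1)[OF _ wint_inner_bound[OF _ _ _ _ A(2) energy_eq(3)[OF that]]])
         (use energy_eq[OF that] A in auto)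
  qed
  have \<phi>p: "D_pair a (\<phi> n) (grad (\<phi> n))" for n by (rule D_pair_test_function[OF \<phi>])
  let ?l = "\<lambda>n. wlint (- 2 * a) (\<lambda>x. inner (g x) (grad (\<phi> n) x))"
  let ?r = "\<lambda>n. wlint (- b * p) (\<lambda>x. K x * u x powr (p - 1) * \<phi> n x)"
  have lim_l: "?l \<longlonglongrightarrow> wlint (- 2 * a) (\<lambda>x. inner (g x) (h x))"
  proof (rule LIM_zero_cancel, rule Lim_null_comparison)
    show "\<forall>\<^sub>F n in sequentially. norm (?l n - wlint (- 2 * a) (\<lambda>x. inner (g x) (h x))) \<le> sqrt (A * \<epsilon> n)"
      using le
    proof eventually_elim
      case (elim n)
      have "?l n - wlint (- 2 * a) (\<lambda>x. inner (g x) (h x)) = wlint (- 2 * a) (\<lambda>x. inner (g x) (grad (\<phi> n) x - h x))"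
        using wlint_diff(2)[OF gi[OF \<phi>p] gi[OF v]] by (simp add: inner_diff_right)
      moreover have "\<bar>wlint (- 2 * a) (\<lambda>x. inner (g x) (grad (\<phi> n) x - h x))\<bar> \<le> sqrt (A * \<epsilon> n)"
        by (intro wlint_bound(2) wint_inner_bound) (use A \<epsilon>(1) elim in auto)
      ultimately show ?case by simp
    qed
    have "(\<lambda>n. sqrt (A * \<epsilon> n)) \<longlonglongrightarrow> sqrt (A * 0)" by (intro tendsto_intros \<epsilon>(2))
    then show "(\<lambda>n. sqrt (A * \<epsilon> n)) \<longlonglongrightarrow> 0" by simp
  qed
  have lim_r: "?r \<longlonglongrightarrow> wlint (- b * p) (\<lambda>x. K x * u x powr (p - 1) * v x)"
  proof (rule LIM_zero_cancel, rule Lim_null_comparison)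
    show "\<forall>\<^sub>F n in sequentially. norm (?r n - wlint (- b * p) (\<lambda>x. K x * u x powr (p - 1) * v x)) \<le> k\<^sub>0 * (Z * sqrt (\<epsilon> n))"
      using le
    proof eventually_elim
      case (elim n)
      have "?r n - wlint (- b * p) (\<lambda>x. K x * u x powr (p - 1) * v x)
          = wlint (- b * p) (\<lambda>x. K x * u x powr (p - 1) * (\<phi> n x - v x))"
        using wlint_diff(2)[OF nonlinear_integrable[OF \<phi>p] nonlinear_integrable[OF v], symmetric] by (simp add: right_diff_distrib)
      then show ?case using nonlinear_integral_bound(2)[OF D_pair_diff[OF \<phi>p v] \<epsilon>(1) elim] by simp
    qed
    have "(\<lambda>n. k\<^sub>0 * (Z * sqrt (\<epsilon> n))) \<longlonglongrightarrow> k\<^sub>0 * (Z * sqrt 0)" by (intro tendsto_intros \<epsilon>(2))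
    then show "(\<lambda>n. k\<^sub>0 * (Z * sqrt (\<epsilon> n))) \<longlonglongrightarrow> 0" by simp
  qed
  have "?l = ?r" by (rule ext) (rule equation[OF \<phi>])
  with lim_l have "?r \<longlonglongrightarrow> wlint (- 2 * a) (\<lambda>x. inner (g x) (h x))" by (simp only:)
  from LIMSEQ_unique[OF this lim_r] show ?thesis .
qed

lemma wint_scale_invariant:
  fixes F :: "real ^ 'n \<Rightarrow> real"
  assumes [measurable]: "F \<in> borel_measurable borel" and l: "l > 0"
  shows "wint (- b * p) (\<lambda>x. l powr (s * p) * F (l *\<^sub>R x)) = wint (- b * p) F"
proof -
  have "wint (- b * p) (\<lambda>x. l powr (s * p) * F (l *\<^sub>R x)) = ennreal (l powr (s * p)) * (ennreal (l powr (- real CARD('n) - - b * p)) * wint (- b * p) F)"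
  proof -
    have "wint (- b * p) (\<lambda>x. l powr (s * p) * F (l *\<^sub>R x)) = ennreal (l powr (s * p)) * wint (- b * p) (\<lambda>x. F (l *\<^sub>R x))"
      by (rule wint_cmult) auto
    then show ?thesis by (simp only: wint_dilation[OF assms])
  qed
  also have "\<dots> = ennreal (l powr (s * p) * l powr (- real CARD('n) - - b * p)) * wint (- b * p) F"
    by (simp only: mult.assoc[symmetric] ennreal_mult'[OF powr_ge_zero])
  also have "l powr (s * p) * l powr (- real CARD('n) - - b * p) = 1"
    using l scaling_exponent by (simp add: powr_add[symmetric] N_eq)
  finally show ?thesis by simp
qed

lemma wlint_scale_invariant:
  fixes F :: "real ^ 'n \<Rightarrow> real"
  assumes [measurable]: "F \<in> borel_measurable borel" and l: "l > 0"
  shows "wlint (- b * p) (\<lambda>x. l powr (s * p) * F (l *\<^sub>R x)) = wlint (- b * p) F"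
proof -
  have "wlint (- b * p) (\<lambda>x. l powr (s * p) * F (l *\<^sub>R x)) = (l powr (s * p) * l powr (- real CARD('n) - - b * p)) * wlint (- b * p) F"
    by (simp add: wlint_cmult(2) wlint_dilation[OF assms])
  also have "l powr (s * p) * l powr (- real CARD('n) - - b * p) = 1"
    using l scaling_exponent by (simp add: powr_add[symmetric] N_eq)
  finally show ?thesis by simp
qed

lemma wlint_energy_scale_invariant:
  fixes F :: "real ^ 'n \<Rightarrow> real"
  assumes [measurable]: "F \<in> borel_measurable borel" and l: "l > 0"
  shows "wlint (- 2 * a) (\<lambda>x. (l powr (s + 1))\<^sup>2 * F (l *\<^sub>R x)) = wlint (- 2 * a) F"
proof -
  have "(l powr (s + 1))\<^sup>2 * l powr (- real CARD('n) - - 2 * a) = l powr ((s + 1) + (s + 1) + (- real CARD('n) - - 2 * a))"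
    by (simp only: power2_eq_square powr_add)
  also have "(s + 1) + (s + 1) + (- real CARD('n) - - 2 * a) = 0" by (simp add: s_eq N_eq field_simps)
  finally have "(l powr (s + 1))\<^sup>2 * l powr (- real CARD('n) - - 2 * a) = 1" using l by simp
  moreover have "wlint (- 2 * a) (\<lambda>x. (l powr (s + 1))\<^sup>2 * F (l *\<^sub>R x)) = ((l powr (s + 1))\<^sup>2 * l powr (- real CARD('n) - - 2 * a)) * wlint (- 2 * a) F"
    by (simp add: wlint_cmult(2) wlint_dilation[OF assms])
  ultimately show ?thesis by simp
qed

text \<open>
  The dilated solution \<open>w l\<close> with its gradient \<open>h l\<close>, the difference \<open>d l\<close> to the solution,
  and the energy \<open>E l\<close> of that difference.
\<close>

definition w :: "real \<Rightarrow> real ^ 'n \<Rightarrow> real" where "w l x = l powr s * u (l *\<^sub>R x)"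
definition h :: "real \<Rightarrow> real ^ 'n \<Rightarrow> real ^ 'n" where "h l x = l powr (s + 1) *\<^sub>R g (l *\<^sub>R x)"

lemma w_measurable [measurable]: "w l \<in> borel_measurable borel"
  and h_measurable [measurable]: "h l \<in> borel_measurable borel"
  unfolding w_def h_def by measurable

lemma w0: "w l x \<ge> 0" by (simp add: w_def u0)

lemma w_pair: "l > 0 \<Longrightarrow> D_pair a (w l) (h l)"
  unfolding w_def[abs_def] h_def[abs_def] by (rule D_pair_dilation[OF pair s(1)])

text \<open>
  Test the equation for \<open>u\<close> with the function \<open>v\<close> dilated by \<open>1/l\<close>, and change variables on
  both sides.
\<close>

lemma dilated_equation:
  assumes v: "D_pair a v f" and l: "l > 0"
  shows "wlint (- 2 * a) (\<lambda>x. inner (h l x) (f x)) = wlint (- b * p) (\<lambda>x. K (l *\<^sub>R x) * w l x powr (p - 1) * v x)"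
proof -
  note [measurable] = D_pair_measurable[OF v]
  define v' where "v' x = (1 / l) powr s * v ((1 / l) *\<^sub>R x)" for x
  define f' where "f' x = (1 / l) powr (s + 1) *\<^sub>R f ((1 / l) *\<^sub>R x)" for x
  have v': "D_pair a v' f'" unfolding v'_def[abs_def] f'_def[abs_def]
    by (rule D_pair_dilation[OF v s(1)]) (use l in simp)
  note [measurable] = D_pair_measurable[OF v']
  have "wlint (- 2 * a) (\<lambda>x. inner (h l x) (f x)) = wlint (- 2 * a) (\<lambda>x. (l powr (s + 1))\<^sup>2 * inner (g (l *\<^sub>R x)) (f' (l *\<^sub>R x)))"
  proof -
    have "inner (h l x) (f x) = (l powr (s + 1))\<^sup>2 * inner (g (l *\<^sub>R x)) (f' (l *\<^sub>R x))" for x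
      using l by (simp add: h_def f'_def powr_divide power2_eq_square)
    then show ?thesis by simp
  qed
  also have "\<dots> = wlint (- 2 * a) (\<lambda>x. inner (g x) (f' x))"
    by (rule wlint_energy_scale_invariant[OF _ l, of "\<lambda>x. inner (g x) (f' x)"]) measurable
  also have "\<dots> = wlint (- b * p) (\<lambda>x. K x * u x powr (p - 1) * v' x)"
    by (rule D_pair_equation[OF v'])
  also have "\<dots> = wlint (- b * p) (\<lambda>x. l powr (s * p) * (K (l *\<^sub>R x) * u (l *\<^sub>R x) powr (p - 1) * v' (l *\<^sub>R x)))"
    by (rule wlint_scale_invariant[OF _ l, of "\<lambda>x. K x * u x powr (p - 1) * v' x", symmetric]) measurable
  also have "\<dots> = wlint (- b * p) (\<lambda>x. K (l *\<^sub>R x) * w l x powr (p - 1) * v x)"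
  proof -
    have "l powr (s * p) * (K (l *\<^sub>R x) * u (l *\<^sub>R x) powr (p - 1) * v' (l *\<^sub>R x)) = K (l *\<^sub>R x) * w l x powr (p - 1) * v x" for x
    proof -
      have "s * p = s * (p - 1) + s" by (simp add: algebra_simps)
      then have "l powr (s * p) = l powr (s * (p - 1)) * l powr s" by (simp only: powr_add)
      then show ?thesis using l u0[of "l *\<^sub>R x"] by (simp add: w_def v'_def powr_mult powr_powr powr_divide)
    qed
    then show ?thesis by (simp only:)
  qed
  finally show ?thesis .
qed

definition d :: "real \<Rightarrow> real ^ 'n \<Rightarrow> real" where "d l x = w l x - u x"
definition E :: "real \<Rightarrow> real" where "E l = wlint (- 2 * a) (\<lambda>x. (norm (h l x - g x))\<^sup>2)"

lemma d_measurable [measurable]: "d l \<in> borel_measurable borel"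
  unfolding d_def by measurable

lemma d_pair: "l > 0 \<Longrightarrow> D_pair a (d l) (\<lambda>x. h l x - g x)"
  unfolding d_def[abs_def] by (rule D_pair_diff[OF w_pair pair])

lemma E: assumes "l > 0" shows "energy a (\<lambda>x. h l x - g x) = ennreal (E l)" "E l \<ge> 0"
  using energy_eq[OF d_pair[OF assms]] by (auto simp: E_def)

text \<open>
  Since \<open>g\<close> and \<open>h l\<close> have the same energy, the pairings of \<open>h l - g\<close> with \<open>h l\<close> and with
  \<open>g\<close> are opposite numbers, and their difference is \<open>E l\<close>. Both pairings are evaluated by
  the equations.
\<close>

lemma energy_identities:
  assumes l: "l > 0"
  shows "wlint (- b * p) (\<lambda>x. K (l *\<^sub>R x) * w l x powr (p - 1) * d l x) = E l / 2"
    and "wlint (- b * p) (\<lambda>x. K x * u x powr (p - 1) * d l x) = - (E l / 2)"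
proof -
  have ip: "wintegrable (- 2 * a) (\<lambda>x. inner (h l x) (g x))"
    by (rule wlint_bound(1)[OF _ wint_inner_bound[OF _ _ _ _ energy_eq(3)[OF w_pair[OF l]] A(2)]])
       (use energy_eq(1)[OF w_pair[OF l]] energy_eq(3)[OF w_pair[OF l]] A in auto)
  have ig: "wintegrable (- 2 * a) (\<lambda>x. (norm (g x))\<^sup>2)" by (rule energy_eq(2)[OF pair])
  have ih: "wintegrable (- 2 * a) (\<lambda>x. (norm (h l x))\<^sup>2)" by (rule energy_eq(2)[OF w_pair[OF l]])
  have same: "wlint (- 2 * a) (\<lambda>x. (norm (h l x))\<^sup>2) = wlint (- 2 * a) (\<lambda>x. (norm (g x))\<^sup>2)"
    using wlint_energy_scale_invariant[OF _ l, of "\<lambda>x. (norm (g x))\<^sup>2"] by (simp add: h_def power_mult_distrib)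
  have 1: "wlint (- 2 * a) (\<lambda>x. inner (h l x) (h l x - g x))
      = wlint (- 2 * a) (\<lambda>x. (norm (h l x))\<^sup>2) - wlint (- 2 * a) (\<lambda>x. inner (h l x) (g x))"
    using wlint_diff(2)[OF ih ip] by (simp add: inner_diff_right power2_norm_eq_inner)
  have 2: "wlint (- 2 * a) (\<lambda>x. inner (g x) (h l x - g x))
      = wlint (- 2 * a) (\<lambda>x. inner (h l x) (g x)) - wlint (- 2 * a) (\<lambda>x. (norm (g x))\<^sup>2)"
    using wlint_diff(2)[OF ip ig] by (simp add: inner_diff_right power2_norm_eq_inner inner_commute)
  have i1: "wintegrable (- 2 * a) (\<lambda>x. inner (h l x) (h l x - g x))"
    using wlint_diff(1)[OF ih ip] by (simp add: inner_diff_right power2_norm_eq_inner)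
  have i2: "wintegrable (- 2 * a) (\<lambda>x. inner (g x) (h l x - g x))"
    using wlint_diff(1)[OF ip ig] by (simp add: inner_diff_right power2_norm_eq_inner inner_commute)
  have "E l = wlint (- 2 * a) (\<lambda>x. inner (h l x) (h l x - g x)) - wlint (- 2 * a) (\<lambda>x. inner (g x) (h l x - g x))"
    unfolding E_def wlint_diff(2)[OF i1 i2, symmetric] by (simp add: power2_norm_eq_inner inner_diff_left)
  then have "wlint (- 2 * a) (\<lambda>x. inner (h l x) (h l x - g x)) = E l / 2"
      "wlint (- 2 * a) (\<lambda>x. inner (g x) (h l x - g x)) = - (E l / 2)"
    using 1 2 same by linarith+
  then show "wlint (- b * p) (\<lambda>x. K (l *\<^sub>R x) * w l x powr (p - 1) * d l x) = E l / 2"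
      "wlint (- b * p) (\<lambda>x. K x * u x powr (p - 1) * d l x) = - (E l / 2)"
    using dilated_equation[OF d_pair[OF l] l] D_pair_equation[OF d_pair[OF l]] by simp_all
qed

section \<open>The dilated solution depends on the parameter in a Lipschitz way\<close>

text \<open>
  Where \<open>|x|\<^bsup>2a+2-bp\<^esup> f\<^bsup>p-2\<^esup> \<le> M\<close>, the potential \<open>f\<^bsup>p-2\<^esup> / |x|\<^bsup>bp\<^esup>\<close> is at most
  \<open>M |x|\<^bsup>-2a-2\<^esup>\<close>. On the remaining set, Hoelder's inequality with exponents \<open>p/(p-2)\<close> and
  \<open>p/2\<close> brings out the factor \<open>T\<close>, which is small for large \<open>M\<close>.
\<close>

lemma potential_splitting:
  fixes f v :: "real ^ 'n \<Rightarrow> real"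
  defines "S \<equiv> \<lambda>M. {x. M < norm x powr (2 * a + 2 - b * p) * f x powr (p - 2)}"
  assumes [measurable]: "f \<in> borel_measurable borel" "v \<in> borel_measurable borel"
    and f0: "\<And>x. f x \<ge> 0" and nonneg: "M \<ge> 0" "T \<ge> 0" "V \<ge> 0" "W \<ge> 0"
    and T: "wint (- b * p) (\<lambda>x. indicator (S M) x * f x powr p) \<le> ennreal T"
    and V: "wint (- b * p) (\<lambda>x. \<bar>v x\<bar> powr p) \<le> ennreal V"
    and W: "wint (- 2 * a - 2) (\<lambda>x. (v x)\<^sup>2) \<le> ennreal W"
  shows "wint (- b * p) (\<lambda>x. f x powr (p - 2) * (v x)\<^sup>2) \<le> ennreal (M * W + T powr ((p - 2) / p) * V powr (2 / p))"
proof -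
  have [measurable]: "S M \<in> sets borel" unfolding S_def by measurable
  have [measurable]: "indicator (S M) \<in> borel_measurable (borel :: (real^'n) measure)"
    by (rule borel_measurable_indicator) measurable
  let ?F = "\<lambda>x. (indicator (S M) x * f x) powr (p - 2) * \<bar>v x\<bar> powr 2"
  have v2: "\<bar>v x\<bar> powr 2 = (v x)\<^sup>2" for x by (cases "v x = 0") (auto simp: powr_numeral)
  have "wint (- b * p) (\<lambda>x. f x powr (p - 2) * (v x)\<^sup>2)
      \<le> (\<integral>\<^sup>+x. ennreal M * ennreal (norm x powr (- 2 * a - 2) * (v x)\<^sup>2) + ennreal (norm x powr (- b * p) * ?F x) \<partial>lborel)"
    unfolding wint_def
  proof (rule nn_integral_mono_AE, rule eventually_mono[OF AE_lborel_singleton[of 0]])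
    fix x :: "real^'n" assume x: "x \<noteq> 0"
    show "ennreal (norm x powr (- b * p) * (f x powr (p - 2) * (v x)\<^sup>2))
        \<le> ennreal M * ennreal (norm x powr (- 2 * a - 2) * (v x)\<^sup>2) + ennreal (norm x powr (- b * p) * ?F x)"
    proof (cases "x \<in> S M")
      case True
      then show ?thesis by (simp add: v2)
    next
      case False
      then have le: "norm x powr (2 * a + 2 - b * p) * f x powr (p - 2) \<le> M" by (simp add: S_def)
      have "norm x powr (- b * p) = norm x powr (2 * a + 2 - b * p) * norm x powr (- 2 * a - 2)"
        by (simp add: powr_add[symmetric])
      then have "norm x powr (- b * p) * (f x powr (p - 2) * (v x)\<^sup>2)
          = (norm x powr (2 * a + 2 - b * p) * f x powr (p - 2)) * (norm x powr (- 2 * a - 2) * (v x)\<^sup>2)"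
        by (simp only: mult_ac)
      also have "\<dots> \<le> M * (norm x powr (- 2 * a - 2) * (v x)\<^sup>2)"
        by (rule mult_right_mono[OF le]) simp
      finally have "ennreal (norm x powr (- b * p) * (f x powr (p - 2) * (v x)\<^sup>2)) \<le> ennreal M * ennreal (norm x powr (- 2 * a - 2) * (v x)\<^sup>2)"
        using nonneg by (simp add: ennreal_mult'[symmetric] ennreal_leI)
      then show ?thesis by (rule order_trans) simp
    qed
  qed
  also have "\<dots> = ennreal M * wint (- 2 * a - 2) (\<lambda>x. (v x)\<^sup>2) + wint (- b * p) ?F"
    unfolding wint_def by (subst nn_integral_add) (auto simp: nn_integral_cmult)
  also have "\<dots> \<le> ennreal M * ennreal W + ennreal (T powr ((p - 2) / p) * V powr (2 / p))"
  proof (intro add_mono mult_left_mono W)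
    have "(indicator (S M) x * f x) powr p = indicator (S M) x * f x powr p" for x
      by (simp add: indicator_def)
    then have "wint (- b * p) (\<lambda>x. (indicator (S M) x * f x) powr p) \<le> ennreal T" using T by simp
    then show "wint (- b * p) ?F \<le> ennreal (T powr ((p - 2) / p) * V powr (2 / p))"
      using p2 f0 V nonneg by (intro wint_Hoelder_power) auto
  qed simp
  also have "\<dots> = ennreal (M * W + T powr ((p - 2) / p) * V powr (2 / p))"
    using nonneg by (simp add: ennreal_mult'[symmetric] ennreal_plus[symmetric] del: ennreal_plus)
  finally show ?thesis .
qed

text \<open>
  The set where the potential \<open>u\<^bsup>p-2\<^esup> / |x|\<^bsup>bp\<^esup>\<close> exceeds \<open>M |x|\<^bsup>-2a-2\<^esup>\<close>; the integral \<open>T M\<close>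
  of \<open>u\<^bsup>p\<^esup> / |x|\<^bsup>bp\<^esup>\<close> over it tends to \<open>0\<close> because the sets decrease to the empty set.
\<close>

definition S :: "nat \<Rightarrow> (real ^ 'n) set"
  where "S M = {x. real M < norm x powr (2 * a + 2 - b * p) * u x powr (p - 2)}"

lemma S_measurable [measurable]: "S M \<in> sets borel"
  unfolding S_def by measurable

lemma indicator_S_measurable [measurable]: "indicator (S M) \<in> borel_measurable (borel :: (real^'n) measure)"
  by (rule borel_measurable_indicator) measurable

definition T :: "nat \<Rightarrow> real"
  where "T M = enn2real (wint (- b * p) (\<lambda>x. indicator (S M) x * u x powr p))"

lemma T: "wint (- b * p) (\<lambda>x. indicator (S M) x * u x powr p) = ennreal (T M)" "T M \<ge> 0"
proof -
  have "wint (- b * p) (\<lambda>x. indicator (S M) x * u x powr p) \<le> wint (- b * p) (\<lambda>x. u x powr p)"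
    by (rule wint_mono) (auto simp: indicator_def)
  also note U(1)
  finally have "wint (- b * p) (\<lambda>x. indicator (S M) x * u x powr p) < top"
    by (rule le_less_trans) simp
  then show "wint (- b * p) (\<lambda>x. indicator (S M) x * u x powr p) = ennreal (T M)"
    by (simp add: T_def)
  show "T M \<ge> 0" by (simp add: T_def)
qed

lemma T_tendsto_0: "T \<longlonglongrightarrow> 0"
proof -
  have "(\<lambda>M. \<integral>\<^sup>+x. ennreal (norm x powr (- b * p) * (indicator (S M) x * u x powr p)) \<partial>lborel) \<longlonglongrightarrow> (\<integral>\<^sup>+x. 0 \<partial>(lborel :: (real^'n) measure))"
  proof (rule nn_integral_dominated_convergence[where w = "\<lambda>x. ennreal (norm x powr (- b * p) * u x powr p)"])
    show "(\<integral>\<^sup>+x. ennreal (norm x powr (- b * p) * u x powr p) \<partial>lborel) < \<infinity>"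
      using U(1) by (simp add: wint_def le_less_trans)
    show "AE x in lborel. ennreal (norm x powr (- b * p) * (indicator (S M) x * u x powr p)) \<le> ennreal (norm x powr (- b * p) * u x powr p)" for M
      by (rule AE_I2) (auto simp: indicator_def intro: ennreal_leI)
    show "AE x in lborel. (\<lambda>M. ennreal (norm x powr (- b * p) * (indicator (S M) x * u x powr p))) \<longlonglongrightarrow> 0"
    proof (rule AE_I2)
      fix x :: "real^'n"
      obtain M\<^sub>0 where M0: "norm x powr (2 * a + 2 - b * p) * u x powr (p - 2) \<le> real M\<^sub>0"
        using real_arch_simple by blast
      have "\<forall>\<^sub>F M in sequentially. ennreal (norm x powr (- b * p) * (indicator (S M) x * u x powr p)) = 0"
      proof (rule eventually_sequentiallyI[of M\<^sub>0])
        fix M assume "M \<ge> M\<^sub>0"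
        then have "x \<notin> S M" using M0 by (simp add: S_def)
        then show "ennreal (norm x powr (- b * p) * (indicator (S M) x * u x powr p)) = 0" by simp
      qed
      then show "(\<lambda>M. ennreal (norm x powr (- b * p) * (indicator (S M) x * u x powr p))) \<longlonglongrightarrow> 0"
        by (rule tendsto_eventually)
    qed
  qed measurable
  then have "(\<lambda>M. ennreal (T M)) \<longlonglongrightarrow> ennreal 0" by (simp add: T(1)[symmetric] wint_def)
  then have "(\<lambda>M. enn2real (ennreal (T M))) \<longlonglongrightarrow> 0" by (rule tendsto_enn2real) simp
  then show ?thesis using T(2) by simp
qed

text \<open>
  Bound for \<open>\<integral> (u\<^bsup>p-2\<^esup> + w\<^bsup>p-2\<^esup>) d\<^sup>2 / |x|\<^bsup>bp\<^esup>\<close> obtained by splitting the potential at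
  height \<open>M\<close>.
\<close>

definition Q :: "nat \<Rightarrow> real \<Rightarrow> real"
  where "Q M l = 2 * (real M * (8 * A * (l - 1)\<^sup>2) + T M powr ((p - 2) / p) * C\<^sub>S powr (2 / p) * E l)"

lemma Q0: "l > 0 \<Longrightarrow> Q M l \<ge> 0"
  using A(2) E(2)[of l] by (auto simp: Q_def)

text \<open>
  The quantity \<open>|x|\<^bsup>2a+2-bp\<^esup> u\<^bsup>p-2\<^esup>\<close> is invariant under the dilations, so the exceptional
  set of \<open>w l\<close> is a dilate of the one of \<open>u\<close> and carries the same mass \<open>T M\<close>. Hence one
  height \<open>M\<close> serves all \<open>l\<close>.
\<close>

lemma quadratic_bound:
  assumes l: "l \<ge> 1"
  shows "wint (- b * p) (\<lambda>x. (u x powr (p - 2) + w l x powr (p - 2)) * (d l x)\<^sup>2) \<le> ennreal (Q M l)"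
proof -
  have l0: "l > 0" using l by simp
  have V: "wint (- b * p) (\<lambda>x. \<bar>d l x\<bar> powr p) \<le> ennreal (C\<^sub>S * E l powr (p / 2))"
    using C\<^sub>S(2)[OF d_pair[OF l0] E(2)[OF l0]] E(1)[OF l0] by simp
  have W: "wint (- 2 * a - 2) (\<lambda>x. (d l x)\<^sup>2) \<le> ennreal (8 * A * (l - 1)\<^sup>2)"
    unfolding d_def w_def using D_pair_dilation_difference[OF pair A(2) _ s l] A(1) by simp
  have V2: "(C\<^sub>S * E l powr (p / 2)) powr (2 / p) = C\<^sub>S powr (2 / p) * E l"
    using C\<^sub>S(1) E(2)[OF l0] p2 by (simp add: powr_mult powr_powr)
  let ?q = "real M * (8 * A * (l - 1)\<^sup>2) + T M powr ((p - 2) / p) * C\<^sub>S powr (2 / p) * E l"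
  have q0: "?q \<ge> 0" using A(2) E(2)[OF l0] by auto
  have 1: "wint (- b * p) (\<lambda>x. u x powr (p - 2) * (d l x)\<^sup>2) \<le> ennreal ?q"
    using potential_splitting[of u "d l" "real M" "T M" "C\<^sub>S * E l powr (p / 2)" "8 * A * (l - 1)\<^sup>2"]
      u0 T[of M] V W A(2) C\<^sub>S(1) by (simp add: V2 S_def mult.assoc)
  have 2: "wint (- b * p) (\<lambda>x. w l x powr (p - 2) * (d l x)\<^sup>2) \<le> ennreal ?q"
  proof -
    have eq: "norm x powr (2 * a + 2 - b * p) * w l x powr (p - 2)
        = norm (l *\<^sub>R x) powr (2 * a + 2 - b * p) * u (l *\<^sub>R x) powr (p - 2)" for x
    proof -
      have "s * (p - 2) = 2 * a + 2 - b * p" using scaling_exponent by (simp add: s_eq field_simps)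
      then have "w l x powr (p - 2) = l powr (2 * a + 2 - b * p) * u (l *\<^sub>R x) powr (p - 2)"
        using u0[of "l *\<^sub>R x"] by (simp add: w_def powr_mult powr_powr)
      then show ?thesis using l by (simp add: powr_mult)
    qed
    have "wint (- b * p) (\<lambda>x. indicator {x. real M < norm x powr (2 * a + 2 - b * p) * w l x powr (p - 2)} x * w l x powr p)
        = wint (- b * p) (\<lambda>x. l powr (s * p) * (indicator (S M) (l *\<^sub>R x) * u (l *\<^sub>R x) powr p))"
    proof -
      have "indicator {x. real M < norm x powr (2 * a + 2 - b * p) * w l x powr (p - 2)} x * w l x powr p
          = l powr (s * p) * (indicator (S M) (l *\<^sub>R x) * u (l *\<^sub>R x) powr p)" for x
        unfolding eq using u0[of "l *\<^sub>R x"] by (simp add: w_def S_def indicator_def powr_mult powr_powr)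
      then show ?thesis by (simp only:)
    qed
    also have "\<dots> = ennreal (T M)"
      unfolding T(1)[symmetric] by (rule wint_scale_invariant[OF _ l0, of "\<lambda>x. indicator (S M) x * u x powr p"]) measurable
    finally show ?thesis
      using potential_splitting[of "w l" "d l" "real M" "T M" "C\<^sub>S * E l powr (p / 2)" "8 * A * (l - 1)\<^sup>2"]
        w0 T(2)[of M] V W A(2) C\<^sub>S(1) by (simp add: V2 mult.assoc)
  qed
  have "wint (- b * p) (\<lambda>x. (u x powr (p - 2) + w l x powr (p - 2)) * (d l x)\<^sup>2)
      = wint (- b * p) (\<lambda>x. u x powr (p - 2) * (d l x)\<^sup>2) + wint (- b * p) (\<lambda>x. w l x powr (p - 2) * (d l x)\<^sup>2)"
    unfolding distrib_right by (rule wint_add) auto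
  also have "\<dots> \<le> ennreal ?q + ennreal ?q" by (intro add_mono 1 2)
  also have "\<dots> = ennreal (Q M l)" unfolding Q_def mult_2 using q0 by (intro ennreal_plus[symmetric])
  finally show ?thesis .
qed

lemma linear_bound:
  assumes l: "l > 0"
  shows "wint (- b * p) (\<lambda>x. u x powr (p - 1) * \<bar>d l x\<bar>) \<le> ennreal (Z * sqrt (E l))"
  using nonlinear_pairing_bound[OF d_pair[OF l] E(2)[OF l]] E(1)[OF l] by simp

text \<open>
  Both uses below estimate an integrand by the same two terms, quadratic and linear in
  \<open>d l\<close>.
\<close>

lemma combined_bound:
  assumes [measurable]: "F \<in> borel_measurable borel" and l: "l \<ge> 1" and \<beta>: "\<beta> \<ge> 0" "\<gamma> \<ge> 0"
    and F: "\<And>x. \<bar>F x\<bar> \<le> \<beta> * ((u x powr (p - 2) + w l x powr (p - 2)) * (d l x)\<^sup>2) + \<gamma> * (u x powr (p - 1) * \<bar>d l x\<bar>)"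
  shows "wintegrable (- b * p) F" "\<bar>wlint (- b * p) F\<bar> \<le> \<beta> * Q M l + \<gamma> * (Z * sqrt (E l))"
proof -
  have l0: "l > 0" using l by simp
  have "wint (- b * p) (\<lambda>x. \<bar>F x\<bar>) \<le> wint (- b * p) (\<lambda>x. \<beta> * ((u x powr (p - 2) + w l x powr (p - 2)) * (d l x)\<^sup>2) + \<gamma> * (u x powr (p - 1) * \<bar>d l x\<bar>))"
    by (rule wint_mono) (rule F)
  also have "\<dots> = ennreal \<beta> * wint (- b * p) (\<lambda>x. (u x powr (p - 2) + w l x powr (p - 2)) * (d l x)\<^sup>2) + ennreal \<gamma> * wint (- b * p) (\<lambda>x. u x powr (p - 1) * \<bar>d l x\<bar>)"
    by (subst wint_add) (auto simp: wint_cmult \<beta>)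
  also have "\<dots> \<le> ennreal \<beta> * ennreal (Q M l) + ennreal \<gamma> * ennreal (Z * sqrt (E l))"
    by (intro add_mono mult_left_mono quadratic_bound l linear_bound l0) auto
  also have "\<dots> = ennreal (\<beta> * Q M l + \<gamma> * (Z * sqrt (E l)))"
    using \<beta> Q0[OF l0, of M] Z0 E(2)[OF l0] by (simp add: ennreal_mult'[symmetric] ennreal_plus[symmetric] del: ennreal_plus)
  finally have le: "wint (- b * p) (\<lambda>x. \<bar>F x\<bar>) \<le> ennreal (\<beta> * Q M l + \<gamma> * (Z * sqrt (E l)))" .
  have nn: "\<beta> * Q M l + \<gamma> * (Z * sqrt (E l)) \<ge> 0"
    using \<beta> Q0[OF l0, of M] Z0 E(2)[OF l0] by auto
  show "wintegrable (- b * p) F" "\<bar>wlint (- b * p) F\<bar> \<le> \<beta> * Q M l + \<gamma> * (Z * sqrt (E l))"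
    by (rule wlint_bound[OF _ le nn], measurable)+
qed

text \<open>
  The sum of the two energy identities, with
  \<open>K(l x) w\<^bsup>p-1\<^esup> - K u\<^bsup>p-1\<^esup> = K(l x) (w\<^bsup>p-1\<^esup> - u\<^bsup>p-1\<^esup>) + (K(l x) - K) u\<^bsup>p-1\<^esup>\<close>.
\<close>

lemma energy_absorbed:
  assumes l: "l \<ge> 1"
  shows "E l \<le> k\<^sub>0 * (p - 1) * Q M l + L * (l - 1) * (Z * sqrt (E l))"
proof -
  have l0: "l > 0" using l by simp
  let ?F = "\<lambda>x. (K (l *\<^sub>R x) * (w l x powr (p - 1) - u x powr (p - 1)) + (K (l *\<^sub>R x) - K x) * u x powr (p - 1)) * d l x"
  have F: "\<bar>?F x\<bar> \<le> (k\<^sub>0 * (p - 1)) * ((u x powr (p - 2) + w l x powr (p - 2)) * (d l x)\<^sup>2) + (L * (l - 1)) * (u x powr (p - 1) * \<bar>d l x\<bar>)" for x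
  proof -
    have "\<bar>w l x powr (p - 1) - u x powr (p - 1)\<bar> \<le> (p - 1) * max (u x) (w l x) powr (p - 1 - 1) * \<bar>d l x\<bar>"
      unfolding d_def by (rule powr_difference_bound) (use u0 w0 p2 in auto)
    also have "\<dots> \<le> (p - 1) * (u x powr (p - 2) + w l x powr (p - 2)) * \<bar>d l x\<bar>"
      using p2 max_powr_le[of "u x" "w l x" "p - 2"] by (intro mult_right_mono mult_left_mono) auto
    finally have 1: "\<bar>K (l *\<^sub>R x)\<bar> * \<bar>w l x powr (p - 1) - u x powr (p - 1)\<bar> \<le> k\<^sub>0 * ((p - 1) * (u x powr (p - 2) + w l x powr (p - 2)) * \<bar>d l x\<bar>)"
      using k0 by (intro mult_mono K_bound) auto
    have 2: "\<bar>K (l *\<^sub>R x) - K x\<bar> * u x powr (p - 1) \<le> (L * (l - 1)) * u x powr (p - 1)"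
      by (intro mult_right_mono K_Lipschitz l) simp
    have "\<bar>?F x\<bar> \<le> (\<bar>K (l *\<^sub>R x)\<bar> * \<bar>w l x powr (p - 1) - u x powr (p - 1)\<bar> + \<bar>K (l *\<^sub>R x) - K x\<bar> * u x powr (p - 1)) * \<bar>d l x\<bar>"
      unfolding abs_mult[of _ "d l x"]
      by (intro mult_right_mono order_trans[OF abs_triangle_ineq]) (auto simp: abs_mult)
    also have "\<dots> \<le> (k\<^sub>0 * ((p - 1) * (u x powr (p - 2) + w l x powr (p - 2)) * \<bar>d l x\<bar>) + (L * (l - 1)) * u x powr (p - 1)) * \<bar>d l x\<bar>"
      by (intro mult_right_mono add_mono 1 2) simp
    also have "\<dots> = (k\<^sub>0 * (p - 1)) * ((u x powr (p - 2) + w l x powr (p - 2)) * (\<bar>d l x\<bar> * \<bar>d l x\<bar>)) + (L * (l - 1)) * (u x powr (p - 1) * \<bar>d l x\<bar>)"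
      by (simp add: algebra_simps)
    also have "\<bar>d l x\<bar> * \<bar>d l x\<bar> = (d l x)\<^sup>2" by (simp add: power2_eq_square)
    finally show ?thesis .
  qed
  have mF: "?F \<in> borel_measurable borel" by measurable
  have cF: "k\<^sub>0 * (p - 1) \<ge> 0" "L * (l - 1) \<ge> 0" using k0 p2 L0 l by auto
  have iF: "wintegrable (- b * p) ?F" and bF: "\<bar>wlint (- b * p) ?F\<bar> \<le> k\<^sub>0 * (p - 1) * Q M l + L * (l - 1) * (Z * sqrt (E l))"
    using combined_bound[OF mF l cF F] by auto
  have iK: "wintegrable (- b * p) (\<lambda>x. K x * u x powr (p - 1) * d l x)"
    by (rule nonlinear_integrable[OF d_pair[OF l0]])
  have "wlint (- b * p) (\<lambda>x. ?F x + K x * u x powr (p - 1) * d l x) = wlint (- b * p) ?F + wlint (- b * p) (\<lambda>x. K x * u x powr (p - 1) * d l x)"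
    by (rule wlint_add(2)[OF iF iK])
  moreover have "(\<lambda>x. ?F x + K x * u x powr (p - 1) * d l x) = (\<lambda>x. K (l *\<^sub>R x) * w l x powr (p - 1) * d l x)"
    by (simp add: fun_eq_iff algebra_simps)
  ultimately have "wlint (- b * p) ?F = E l"
    using energy_identities[OF l0] by simp
  then show ?thesis using bF by simp
qed

text \<open>
  For large \<open>M\<close> the coefficient of \<open>E l\<close> in \<open>Q M l\<close> is small enough to be absorbed on the
  left, and so is the term linear in \<open>\<surd>E\<close> after completing a square.
\<close>

lemma energy_Lipschitz: "\<exists>B\<ge>0. \<forall>l\<ge>1. E l \<le> B * (l - 1)\<^sup>2"
proof -
  \<comment> \<open>the coefficient of \<open>T M powr ((p - 2) / p) * E l\<close> in \<open>k\<^sub>0 (p - 1) Q M l\<close>\<close>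
  define \<kappa> where "\<kappa> = k\<^sub>0 * (p - 1) * 2 * C\<^sub>S powr (2 / p)"
  have "(\<lambda>M. \<kappa> * T M powr ((p - 2) / p)) \<longlonglongrightarrow> \<kappa> * 0 powr ((p - 2) / p)"
    using p2 T(2) by (intro tendsto_mult tendsto_const tendsto_powr' T_tendsto_0) auto
  then have "\<forall>\<^sub>F M in sequentially. \<kappa> * T M powr ((p - 2) / p) < 1 / 4"
    by (intro order_tendstoD(2)) auto
  then obtain M where M: "\<kappa> * T M powr ((p - 2) / p) < 1 / 4"
    using eventually_happens'[OF sequentially_bot] by blast
  define B where "B = 2 * (k\<^sub>0 * (p - 1) * 16 * real M * A + (L * Z)\<^sup>2)"
  have "B \<ge> 0" using k0 p2 A(2) by (auto simp: B_def)
  moreover have "E l \<le> B * (l - 1)\<^sup>2" if l: "l \<ge> 1" for l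
  proof -
    have E0: "E l \<ge> 0" using E(2)[of l] l by simp
    have "k\<^sub>0 * (p - 1) * Q M l = k\<^sub>0 * (p - 1) * 16 * real M * A * (l - 1)\<^sup>2 + (\<kappa> * T M powr ((p - 2) / p)) * E l"
      by (simp add: Q_def \<kappa>_def algebra_simps)
    also have "\<dots> \<le> k\<^sub>0 * (p - 1) * 16 * real M * A * (l - 1)\<^sup>2 + 1 / 4 * E l"
      using M E0 by (intro add_left_mono mult_right_mono) auto
    finally have 1: "k\<^sub>0 * (p - 1) * Q M l \<le> k\<^sub>0 * (p - 1) * 16 * real M * A * (l - 1)\<^sup>2 + E l / 4" by simp
    have "(L * (l - 1) * Z) * sqrt (E l) \<le> (L * (l - 1) * Z)\<^sup>2 + E l / 4"
    proof -
      have "0 \<le> (L * (l - 1) * Z - sqrt (E l) / 2)\<^sup>2" by simp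
      also have "\<dots> = (L * (l - 1) * Z)\<^sup>2 - (L * (l - 1) * Z) * sqrt (E l) + (sqrt (E l))\<^sup>2 / 4"
        by (simp add: power2_diff power_divide)
      finally show ?thesis using E0 by simp
    qed
    then have 2: "L * (l - 1) * (Z * sqrt (E l)) \<le> (L * Z)\<^sup>2 * (l - 1)\<^sup>2 + E l / 4"
      by (simp add: power_mult_distrib mult_ac)
    have "E l \<le> k\<^sub>0 * (p - 1) * Q M l + L * (l - 1) * (Z * sqrt (E l))" by (rule energy_absorbed[OF l])
    then have "E l \<le> 2 * (k\<^sub>0 * (p - 1) * 16 * real M * A * (l - 1)\<^sup>2 + (L * Z)\<^sup>2 * (l - 1)\<^sup>2)"
    proof -
      have *: "e \<le> 2 * (x' + y')" if "e \<le> x + y" "x \<le> x' + e / 4" "y \<le> y' + e / 4" for e x y x' y' :: real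
        using that by (simp add: field_simps)
      show ?thesis by (rule *[OF \<open>E l \<le> _\<close> 1 2])
    qed
    then show ?thesis by (simp add: B_def algebra_simps)
  qed
  ultimately show ?thesis by blast
qed

section \<open>Vanishing of the first variation\<close>

lemma Kp_integrable:
  assumes [measurable]: "H \<in> borel_measurable borel" and H: "\<And>x. \<bar>H x\<bar> \<le> c"
  shows "wintegrable (- b * p) (\<lambda>x. H x * u x powr p)"
proof -
  have "wint (- b * p) (\<lambda>x. \<bar>H x * u x powr p\<bar>) \<le> wint (- b * p) (\<lambda>x. \<bar>c\<bar> * u x powr p)"
    by (rule wint_mono) (auto simp: abs_mult intro!: mult_right_mono order_trans[OF H])
  also have "\<dots> = ennreal \<bar>c\<bar> * wint (- b * p) (\<lambda>x. u x powr p)"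
    by (rule wint_cmult) auto
  also have "\<dots> < \<infinity>" using U(1) by (simp add: ennreal_mult_less_top le_less_trans)
  finally show ?thesis by (subst wintegrable_iff_finite) auto
qed

text \<open>
  The integrals of \<open>K(l x) w\<^bsup>p\<^esup> / |x|\<^bsup>bp\<^esup>\<close> and \<open>K u\<^bsup>p\<^esup> / |x|\<^bsup>bp\<^esup>\<close> agree. In their
  difference, the term of first order in \<open>d\<close> with coefficient \<open>K\<close> is \<open>p\<close> times
  \<open>\<integral> K u\<^bsup>p-1\<^esup> d / |x|\<^bsup>bp\<^esup>\<close>, that is \<open>- p E / 2\<close> by the second energy identity: criticality
  of \<open>u\<close> makes it quadratic in \<open>l - 1\<close>. The remaining terms \<open>?R\<close> are products of two small
  factors.
\<close>

lemma K_increment_bound: "\<exists>B\<ge>0. \<forall>l\<ge>1. \<bar>wlint (- b * p) (\<lambda>x. (K (l *\<^sub>R x) - K x) * u x powr p)\<bar> \<le> B * (l - 1)\<^sup>2"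
proof -
  obtain B where B: "B \<ge> 0" "\<And>l. l \<ge> 1 \<Longrightarrow> E l \<le> B * (l - 1)\<^sup>2" using energy_Lipschitz by auto
  define B' where "B' = p * B / 2 + k\<^sub>0 * (p * (p - 1)) * (2 * (T 0 powr ((p - 2) / p) * C\<^sub>S powr (2 / p) * B)) + p * L * (Z * sqrt B)"
  have "B' \<ge> 0" using B p2 k0 L0 Z0 by (auto simp: B'_def)
  moreover have "\<bar>wlint (- b * p) (\<lambda>x. (K (l *\<^sub>R x) - K x) * u x powr p)\<bar> \<le> B' * (l - 1)\<^sup>2" if l: "l \<ge> 1" for l
  proof -
    have l0: "l > 0" using l by simp
    let ?D = "\<lambda>x. (K (l *\<^sub>R x) - K x) * u x powr p"
    let ?N = "\<lambda>x. K x * u x powr (p - 1) * d l x"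
    let ?R = "\<lambda>x. K (l *\<^sub>R x) * (w l x powr p - u x powr p - p * u x powr (p - 1) * d l x) + p * (K (l *\<^sub>R x) - K x) * u x powr (p - 1) * d l x"
    have R: "\<bar>?R x\<bar> \<le> (k\<^sub>0 * (p * (p - 1))) * ((u x powr (p - 2) + w l x powr (p - 2)) * (d l x)\<^sup>2) + (p * (L * (l - 1))) * (u x powr (p - 1) * \<bar>d l x\<bar>)" for x
    proof -
      have "\<bar>K (l *\<^sub>R x)\<bar> * \<bar>w l x powr p - u x powr p - p * u x powr (p - 1) * d l x\<bar> \<le> k\<^sub>0 * (p * (p - 1) * ((u x powr (p - 2) + w l x powr (p - 2)) * (d l x)\<^sup>2))"
        unfolding d_def using k0 by (intro mult_mono K_bound powr_Taylor_bound u0 w0 p2) auto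
      moreover have "\<bar>p * (K (l *\<^sub>R x) - K x) * u x powr (p - 1) * d l x\<bar> \<le> p * (L * (l - 1)) * (u x powr (p - 1) * \<bar>d l x\<bar>)"
      proof -
        have "\<bar>p * (K (l *\<^sub>R x) - K x) * u x powr (p - 1) * d l x\<bar> = p * \<bar>K (l *\<^sub>R x) - K x\<bar> * (u x powr (p - 1) * \<bar>d l x\<bar>)"
          using p2 by (simp add: abs_mult)
        also have "\<dots> \<le> p * (L * (l - 1)) * (u x powr (p - 1) * \<bar>d l x\<bar>)"
          using p2 by (intro mult_right_mono mult_left_mono K_Lipschitz l) auto
        finally show ?thesis .
      qed
      ultimately show ?thesis
        using abs_triangle_ineq[of "K (l *\<^sub>R x) * (w l x powr p - u x powr p - p * u x powr (p - 1) * d l x)" "p * (K (l *\<^sub>R x) - K x) * u x powr (p - 1) * d l x"]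
        by (simp only: abs_mult[of "K (l *\<^sub>R x)"] mult.assoc)
    qed
    have mR: "?R \<in> borel_measurable borel" by measurable
    have cR: "k\<^sub>0 * (p * (p - 1)) \<ge> 0" "p * (L * (l - 1)) \<ge> 0" using k0 p2 L0 l by auto
    note R' = combined_bound[OF mR l cR R]
    have iK: "wintegrable (- b * p) ?N"
      by (rule nonlinear_integrable[OF d_pair[OF l0]])
    have iD: "wintegrable (- b * p) ?D"
      by (rule Kp_integrable[where c = "L * (l - 1)"]) (use K_Lipschitz[OF l] in auto)
    have iu: "wintegrable (- b * p) (\<lambda>x. K x * u x powr p)"
      by (rule Kp_integrable[where c = "k\<^sub>0"]) (use K_bound in auto)
    have i1: "wintegrable (- b * p) (\<lambda>x. (K (l *\<^sub>R x) - K x) * u x powr p + ?R x)" by (rule wlint_add(1)[OF iD R'(1)])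
    have i2: "wintegrable (- b * p) (\<lambda>x. p * (K x * u x powr (p - 1) * d l x))" by (rule wlint_cmult(1)[OF iK])
    have i3: "wintegrable (- b * p) (\<lambda>x. ((K (l *\<^sub>R x) - K x) * u x powr p + ?R x) + p * (K x * u x powr (p - 1) * d l x))" by (rule wlint_add(1)[OF i1 i2])
    have "wlint (- b * p) (\<lambda>x. K (l *\<^sub>R x) * w l x powr p) = wlint (- b * p) (\<lambda>x. K x * u x powr p)"
    proof -
      have "K (l *\<^sub>R x) * w l x powr p = l powr (s * p) * (K (l *\<^sub>R x) * u (l *\<^sub>R x) powr p)" for x
        using u0[of "l *\<^sub>R x"] by (simp add: w_def powr_mult powr_powr)
      then have "wlint (- b * p) (\<lambda>x. K (l *\<^sub>R x) * w l x powr p) = wlint (- b * p) (\<lambda>x. l powr (s * p) * (K (l *\<^sub>R x) * u (l *\<^sub>R x) powr p))"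
        by (simp only:)
      also have "\<dots> = wlint (- b * p) (\<lambda>x. K x * u x powr p)"
        by (rule wlint_scale_invariant[OF _ l0, of "\<lambda>x. K x * u x powr p"]) measurable
      finally show ?thesis .
    qed
    moreover have "(\<lambda>x. K (l *\<^sub>R x) * w l x powr p) = (\<lambda>x. (((K (l *\<^sub>R x) - K x) * u x powr p + ?R x) + p * (K x * u x powr (p - 1) * d l x)) + K x * u x powr p)"
      by (simp add: fun_eq_iff algebra_simps)
    ultimately have "wlint (- b * p) ?D + wlint (- b * p) ?R + p * wlint (- b * p) ?N = 0"
      using wlint_add(2)[OF i3 iu] wlint_add(2)[OF i1 i2] wlint_add(2)[OF iD R'(1)] by (simp add: wlint_cmult(2))
    then have "wlint (- b * p) ?D = p * (E l / 2) - wlint (- b * p) ?R"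
      using energy_identities(2)[OF l0] by (simp add: algebra_simps)
    then have "\<bar>wlint (- b * p) ?D\<bar> \<le> p * (E l / 2) + \<bar>wlint (- b * p) ?R\<bar>"
      using p2 E(2)[OF l0] abs_triangle_ineq4[of "p * (E l / 2)" "wlint (- b * p) ?R"] by simp
    \<comment> \<open>with the energy bound at hand, the trivial splitting height \<open>0\<close> is good enough\<close>
    also have "\<dots> \<le> p * (E l / 2) + (k\<^sub>0 * (p * (p - 1)) * Q 0 l + p * (L * (l - 1)) * (Z * sqrt (E l)))"
      using R'(2)[of 0] by (rule add_left_mono)
    also have "\<dots> \<le> p * (B * (l - 1)\<^sup>2 / 2) + (k\<^sub>0 * (p * (p - 1)) * (2 * (T 0 powr ((p - 2) / p) * C\<^sub>S powr (2 / p) * (B * (l - 1)\<^sup>2))) + p * (L * (l - 1)) * (Z * (sqrt B * (l - 1))))"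
    proof -
      have "sqrt (E l) \<le> sqrt (B * (l - 1)\<^sup>2)" using B(2)[OF l] by simp
      also have "\<dots> = sqrt B * (l - 1)" using l by (simp add: real_sqrt_mult)
      finally have "sqrt (E l) \<le> sqrt B * (l - 1)" .
      moreover have "Q 0 l \<le> 2 * (T 0 powr ((p - 2) / p) * C\<^sub>S powr (2 / p) * (B * (l - 1)\<^sup>2))"
        unfolding Q_def using B(2)[OF l] by (auto intro!: mult_left_mono)
      ultimately show ?thesis
        using B(2)[OF l] p2 k0 L0 Z0 l by (intro add_mono mult_left_mono divide_right_mono) auto
    qed
    also have "\<dots> = B' * (l - 1)\<^sup>2" unfolding B'_def power2_eq_square distrib_right by (simp add: mult_ac)
    finally show ?thesis .
  qed
  ultimately show ?thesis by blast
qed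

end

section \<open>The integral identity\<close>

lemma DERIV_along_ray:
  fixes K :: "real ^ 'n \<Rightarrow> real"
  assumes "K differentiable (at (r *\<^sub>R x))"
  shows "((\<lambda>r. K (r *\<^sub>R x)) has_real_derivative inner (grad K (r *\<^sub>R x)) x) (at r)"
proof -
  have "((\<lambda>r. r *\<^sub>R x) has_derivative (\<lambda>h. h *\<^sub>R x)) (at r)"
    by (auto intro!: derivative_eq_intros)
  from has_derivative_compose[OF this grad_has_derivative[OF assms]]
  show ?thesis unfolding has_field_derivative_def by (rule has_derivative_eq_rhs) (simp add: fun_eq_iff)
qed

text \<open>
  The difference quotients of \<open>K\<close> along dilations converge to \<open>\<nabla>K(x) \<bullet> x\<close> and are bounded by
  \<open>L\<close>, while their integrals against \<open>u\<^bsup>p\<^esup> / |x|\<^bsup>bp\<^esup>\<close> are of the order of the step.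
\<close>

lemma (in weak_solution_setting) Pohozaev_identity:
  assumes K: "Ck 1 K" and bound: "\<And>x. \<bar>inner (grad K x) x\<bar> \<le> L"
  shows "has_bochner_integral lborel (\<lambda>x. norm x powr (- b * p) * (inner (grad K x) x * u x powr p)) 0"
proof -
  have dK: "K differentiable (at x)" for x using K by simp
  have [measurable]: "grad K \<in> borel_measurable borel"
    using continuous_on_grad[OF K] by (rule borel_measurable_continuous_onI)
  let ?t = "\<lambda>n. inverse (real (Suc n))"
  let ?f = "\<lambda>n x. norm x powr (- b * p) * ((K ((1 + ?t n) *\<^sub>R x) - K x) / ?t n * u x powr p)"
  let ?F = "\<lambda>x. norm x powr (- b * p) * (inner (grad K x) x * u x powr p)"
  have t: "?t n > 0" for n by simp
  have lim: "AE x in lborel. (\<lambda>n. ?f n x) \<longlonglongrightarrow> ?F x"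
  proof (rule AE_I2, intro tendsto_mult tendsto_const)
    fix x :: "real^'n"
    have "((\<lambda>r. K (r *\<^sub>R x)) has_real_derivative inner (grad K x) x) (at 1)"
      using DERIV_along_ray[of K 1 x] dK by simp
    then have "((\<lambda>h. (K ((1 + h) *\<^sub>R x) - K x) / h) \<longlongrightarrow> inner (grad K x) x) (at 0)"
      by (simp add: DERIV_def)
    moreover have "filterlim ?t (at 0) sequentially"
      by (rule filterlim_atI[OF LIMSEQ_inverse_real_of_nat]) simp
    ultimately show "(\<lambda>n. (K ((1 + ?t n) *\<^sub>R x) - K x) / ?t n) \<longlonglongrightarrow> inner (grad K x) x"
      by (rule filterlim_compose)
  qed
  have dom: "AE x in lborel. norm (?f n x) \<le> L * (norm x powr (- b * p) * u x powr p)" for n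
  proof (rule AE_I2)
    fix x :: "real^'n"
    have "\<bar>K ((1 + ?t n) *\<^sub>R x) - K x\<bar> \<le> L * ?t n"
      using K_Lipschitz[of "1 + ?t n" x] t[of n] by simp
    then have "\<bar>(K ((1 + ?t n) *\<^sub>R x) - K x) / ?t n\<bar> \<le> L"
      unfolding abs_divide abs_of_pos[OF t[of n]] by (simp only: pos_divide_le_eq[OF t[of n]])
    then have "norm x powr (- b * p) * (\<bar>(K ((1 + ?t n) *\<^sub>R x) - K x) / ?t n\<bar> * u x powr p) \<le> norm x powr (- b * p) * (L * u x powr p)"
      by (intro mult_left_mono mult_right_mono) auto
    then show "norm (?f n x) \<le> L * (norm x powr (- b * p) * u x powr p)"
      by (simp add: abs_mult mult_ac)
  qed
  have "wintegrable (- b * p) (\<lambda>x. 1 * u x powr p)" by (rule Kp_integrable[where c = 1]) auto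
  then have int: "integrable lborel (\<lambda>x. L * (norm x powr (- b * p) * u x powr p))" by simp
  have mf: "?f n \<in> borel_measurable lborel" for n by measurable
  have mF: "?F \<in> borel_measurable lborel" by measurable
  note dct = integral_dominated_convergence[OF mF mf int lim dom]
  obtain B where B: "B \<ge> 0" "\<And>l. l \<ge> 1 \<Longrightarrow> \<bar>wlint (- b * p) (\<lambda>x. (K (l *\<^sub>R x) - K x) * u x powr p)\<bar> \<le> B * (l - 1)\<^sup>2"
    using K_increment_bound by auto
  have "(\<lambda>n. integral\<^sup>L lborel (?f n)) \<longlonglongrightarrow> 0"
  proof (rule Lim_null_comparison)
    show "\<forall>\<^sub>F n in sequentially. norm (integral\<^sup>L lborel (?f n)) \<le> B * ?t n"
    proof (intro always_eventually allI)
      fix n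
      have "integral\<^sup>L lborel (?f n) = wlint (- b * p) (\<lambda>x. inverse (?t n) * ((K ((1 + ?t n) *\<^sub>R x) - K x) * u x powr p))"
        unfolding wlint_def by (intro Bochner_Integration.integral_cong) (auto simp: divide_inverse mult_ac)
      also have "\<dots> = inverse (?t n) * wlint (- b * p) (\<lambda>x. (K ((1 + ?t n) *\<^sub>R x) - K x) * u x powr p)"
        by (rule wlint_cmult(2))
      finally have "norm (integral\<^sup>L lborel (?f n)) = inverse (?t n) * \<bar>wlint (- b * p) (\<lambda>x. (K ((1 + ?t n) *\<^sub>R x) - K x) * u x powr p)\<bar>"
        by (simp add: abs_mult)
      also have "\<dots> \<le> inverse (?t n) * (B * (?t n)\<^sup>2)"
        using B(2)[of "1 + ?t n"] t[of n] by (intro mult_left_mono) auto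
      also have "\<dots> = B * ?t n"
      proof -
        have "inverse y * (B * y\<^sup>2) = B * y" if "y > 0" for y :: real
          using that by (simp add: power2_eq_square)
        then show ?thesis using t[of n] by blast
      qed
      finally show "norm (integral\<^sup>L lborel (?f n)) \<le> B * ?t n" .
    qed
    have "(\<lambda>n. B * ?t n) \<longlonglongrightarrow> B * 0" by (intro tendsto_mult tendsto_const LIMSEQ_inverse_real_of_nat)
    then show "(\<lambda>n. B * ?t n) \<longlonglongrightarrow> 0" by simp
  qed
  from LIMSEQ_unique[OF this dct] have "integral\<^sup>L lborel ?F = 0" by simp
  moreover have "integrable lborel ?F" using integrable_dominated_convergence[OF mF mf int lim dom] .
  ultimately show ?thesis by (simp add: has_bochner_integral_iff)
qed

text \<open>
  The mean value theorem along the ray through \<open>x\<close>: at \<open>y = \<xi> x\<close> with \<open>\<xi> \<ge> 1\<close> the radial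
  derivative is \<open>\<nabla>K(y) \<bullet> y / \<xi>\<close>.
\<close>

lemma dilation_Lipschitz:
  fixes K :: "real ^ 'n \<Rightarrow> real"
  assumes K: "\<And>x. K differentiable (at x)" and bound: "\<And>x. \<bar>inner (grad K x) x\<bar> \<le> L" and l: "l \<ge> 1"
  shows "\<bar>K (l *\<^sub>R x) - K x\<bar> \<le> L * (l - 1)"
proof (cases "l = 1")
  case False
  then have "1 < l" using l by simp
  then obtain \<xi> where \<xi>: "1 < \<xi>" "\<xi> < l" "K (l *\<^sub>R x) - K (1 *\<^sub>R x) = (l - 1) * inner (grad K (\<xi> *\<^sub>R x)) x"
    using MVT2[of 1 l "\<lambda>r. K (r *\<^sub>R x)" "\<lambda>r. inner (grad K (r *\<^sub>R x)) x"] DERIV_along_ray[OF K] by blast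
  have "\<bar>inner (grad K (\<xi> *\<^sub>R x)) x\<bar> \<le> \<xi> * \<bar>inner (grad K (\<xi> *\<^sub>R x)) x\<bar>"
    using \<xi>(1) mult_right_mono[of 1 \<xi> "\<bar>inner (grad K (\<xi> *\<^sub>R x)) x\<bar>"] by simp
  also have "\<dots> = \<bar>inner (grad K (\<xi> *\<^sub>R x)) (\<xi> *\<^sub>R x)\<bar>" using \<xi>(1) by (simp add: abs_mult)
  also have "\<dots> \<le> L" by (rule bound)
  finally show ?thesis using \<xi>(3) \<open>1 < l\<close> by (simp add: abs_mult mult.commute[of L])
qed simp

lemma continuous_AE_bound:
  fixes K :: "'a::euclidean_space \<Rightarrow> real"
  assumes K: "continuous_on UNIV K" and AE: "AE x in lebesgue. \<bar>K x\<bar> \<le> C"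
  shows "\<bar>K x\<bar> \<le> C"
proof (rule ccontr)
  let ?S = "{x. C < \<bar>K x\<bar>}"
  assume "\<not> \<bar>K x\<bar> \<le> C"
  then have "x \<in> ?S" by simp
  then have "?S \<noteq> {}" by blast
  have o: "open ?S" by (intro open_Collect_less continuous_intros K)
  have "?S \<in> null_sets lebesgue"
    using AE o by (subst AE_iff_null_sets) (auto simp: not_less borel_open)
  then have "negligible ?S" by (simp add: negligible_iff_null_sets)
  with open_not_negligible[OF o \<open>?S \<noteq> {}\<close>] show False by simp
qed

lemma Borel_version_vector:
  fixes g :: "'a::euclidean_space \<Rightarrow> 'b::euclidean_space"
  assumes [measurable]: "g \<in> borel_measurable lebesgue"
  obtains g' where "g' \<in> borel_measurable borel" "AE x in lborel. g x = g' x"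
proof -
  have "\<exists>\<gamma>\<in>borel_measurable lborel. AE x in lborel. inner (g x) e = \<gamma> x" for e
    by (rule completion_ex_borel_measurable_real) measurable
  then obtain \<gamma> where \<gamma>: "\<And>e. \<gamma> e \<in> borel_measurable lborel" "\<And>e. AE x in lborel. inner (g x) e = \<gamma> e x" by metis
  have "AE x in lborel. \<forall>e\<in>Basis. inner (g x) e = \<gamma> e x"
    by (rule AE_finite_allI) (use \<gamma> in auto)
  then have "AE x in lborel. g x = (\<Sum>e\<in>Basis. \<gamma> e x *\<^sub>R e)"
  proof eventually_elim
    case (elim x)
    have "g x = (\<Sum>e\<in>Basis. inner (g x) e *\<^sub>R e)" by (simp add: euclidean_representation)
    also have "\<dots> = (\<Sum>e\<in>Basis. \<gamma> e x *\<^sub>R e)" using elim by (intro sum.cong) auto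
    finally show ?case .
  qed
  moreover have "(\<lambda>x. \<Sum>e\<in>Basis. \<gamma> e x *\<^sub>R e) \<in> borel_measurable borel"
    using \<gamma>(1) by (intro borel_measurable_sum borel_measurable_scaleR) auto
  ultimately show thesis using that by blast
qed

lemma lebesgue_measurable_of_borel: "f \<in> borel_measurable borel \<Longrightarrow> f \<in> borel_measurable lebesgue"
  by (rule measurable_completion) simp

theorem corollary2p3:
  fixes a b p N :: real
    and K u :: "real ^ 'n \<Rightarrow> real"
  assumes "N = real CARD('n)"
    and "N \<ge> 3"
    and "a < (N - 2) / 2"
    and "a \<le> b" and "b < a + 1"
    and "p = 2 * N / (N - 2 * (1 + a - b))"
    and "K \<in> L_infinity"
    and "Ck 1 K"
    and "bounded (range (\<lambda>x. inner (grad K x) x))"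
    and "weak_solution a u (\<lambda>x. K x * (u x powr (p - 1) / norm x powr (b * p)))"
    and "AE x in lebesgue. u x > 0"
  shows "has_bochner_integral lebesgue
           (\<lambda>x. inner (grad K x) x * (u x powr p / norm x powr (b * p))) 0"
proof -
  have K1: "Ck 1 K" by fact
  have dK: "K differentiable (at x)" for x using K1 by simp
  have cK: "continuous_on UNIV K" using dK by (intro continuous_at_imp_continuous_on ballI differentiable_imp_continuous_within) auto
  have [measurable]: "K \<in> borel_measurable borel" using cK by (rule borel_measurable_continuous_onI)
  have [measurable]: "grad K \<in> borel_measurable borel"
    using continuous_on_grad[OF K1] by (rule borel_measurable_continuous_onI)
  obtain C where "AE x in lebesgue. \<bar>K x\<bar> \<le> C" using \<open>K \<in> L_infinity\<close> by (auto simp: L_infinity_def)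
  then have K_bound: "\<bar>K x\<bar> \<le> C" for x by (rule continuous_AE_bound[OF cK])
  obtain L where "\<forall>x. \<bar>inner (grad K x) x\<bar> \<le> L"
    using \<open>bounded (range (\<lambda>x. inner (grad K x) x))\<close> by (auto simp: bounded_iff)
  then have L: "\<bar>inner (grad K x) x\<bar> \<le> L" for x by blast
  have L0: "L \<ge> 0" using L[of 0] by simp
  from \<open>weak_solution a u _\<close> obtain g where u_meas: "u \<in> borel_measurable lebesgue"
    and g: "is_D12_gradient a u g"
    and eq: "\<And>v. v \<in> Cc_infinity \<Longrightarrow> (LINT x|lebesgue. norm x powr (- 2 * a) * inner (g x) (grad v x)) =
        (LINT x|lebesgue. K x * (u x powr (p - 1) / norm x powr (b * p)) * v x)"
    by (auto simp: weak_solution_def D12_def)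
  from g obtain \<phi> where g_meas: "g \<in> borel_measurable lebesgue"
    and \<phi>: "D_Cauchy a \<phi>" "AE x in lebesgue. (\<lambda>n. \<phi> n x) \<longlonglongrightarrow> u x"
      "(\<lambda>n. \<integral>\<^sup>+x. ennreal (norm x powr (- 2 * a) * (norm (grad (\<phi> n) x - g x))\<^sup>2) \<partial>lebesgue) \<longlonglongrightarrow> 0"
    by (auto simp: is_D12_gradient_def)
  have \<phi>C: "\<phi> n \<in> Cc_infinity" for n using \<phi>(1) by (auto simp: D_Cauchy_def)
  \<comment> \<open>Borel versions of \<open>u\<close> and of its gradient leave all integrals unchanged and give access to
    Tonelli's theorem\<close>
  obtain g' where g' [measurable]: "g' \<in> borel_measurable borel" and gg': "AE x in lborel. g x = g' x"
    by (rule Borel_version_vector[OF g_meas])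
  obtain u\<^sub>1 where u1: "u\<^sub>1 \<in> borel_measurable borel" and uu1: "AE x in lborel. u x = u\<^sub>1 x"
    by (rule Borel_version_vector[OF u_meas])
  \<comment> \<open>the maximum makes the Borel version nonnegative everywhere, not just almost everywhere\<close>
  define u' where "u' x = max 0 (u\<^sub>1 x)" for x
  have [measurable]: "u' \<in> borel_measurable borel" unfolding u'_def using u1 by measurable
  have "AE x in lborel. u x > 0" using \<open>AE x in lebesgue. u x > 0\<close> by (simp add: AE_completion_iff)
  with uu1 have uu': "AE x in lborel. u x = u' x"
    by eventually_elim (simp add: u'_def)
  have pair: "D_pair a u' g'" unfolding D_pair_def
  proof (intro conjI exI[of _ \<phi>] allI \<phi>C)
    have "AE x in lborel. (\<lambda>n. \<phi> n x) \<longlonglongrightarrow> u x" using \<phi>(2) by (simp add: AE_completion_iff)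
    with uu' show "AE x in lborel. (\<lambda>n. \<phi> n x) \<longlonglongrightarrow> u' x" by eventually_elim simp
    have "energy a (\<lambda>x. grad (\<phi> n) x - g' x)
        = (\<integral>\<^sup>+x. ennreal (norm x powr (- 2 * a) * (norm (grad (\<phi> n) x - g x))\<^sup>2) \<partial>lebesgue)" for n
      unfolding wint_def nn_integral_completion
      by (rule nn_integral_cong_AE) (use gg' in eventually_elim, simp)
    then show "(\<lambda>n. energy a (\<lambda>x. grad (\<phi> n) x - g' x)) \<longlonglongrightarrow> 0" using \<phi>(3) by simp
  qed measurable
  have powr_meas: "(\<lambda>x. u x powr c) \<in> borel_measurable lebesgue" for c using u_meas by measurable
  have weight: "(c::real) / norm x powr (b * p) = norm x powr (- b * p) * c" for c and x :: "real^'n"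
    by (simp add: powr_minus_divide)
  have weak: "wlint (- 2 * a) (\<lambda>x. inner (g' x) (grad v x)) = wlint (- b * p) (\<lambda>x. K x * u' x powr (p - 1) * v x)"
    if v: "v \<in> Cc_infinity" for v
  proof -
    note [measurable] = Cc_infinity_measurable[OF v]
    have "wlint (- 2 * a) (\<lambda>x. inner (g' x) (grad v x)) = (LINT x|lebesgue. norm x powr (- 2 * a) * inner (g' x) (grad v x))"
      unfolding wlint_def by (rule integral_completion[symmetric]) simp
    also have "\<dots> = (LINT x|lebesgue. norm x powr (- 2 * a) * inner (g x) (grad v x))"
    proof (rule integral_cong_AE)
      show "(\<lambda>x. norm x powr (- 2 * a) * inner (g' x) (grad v x)) \<in> borel_measurable lebesgue"
        by (rule lebesgue_measurable_of_borel) measurable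
      show "(\<lambda>x. norm x powr (- 2 * a) * inner (g x) (grad v x)) \<in> borel_measurable lebesgue"
        by (intro borel_measurable_times borel_measurable_inner g_meas lebesgue_measurable_of_borel) measurable
      show "AE x in lebesgue. norm x powr (- 2 * a) * inner (g' x) (grad v x) = norm x powr (- 2 * a) * inner (g x) (grad v x)"
        using AE_completion[OF gg'] by eventually_elim simp
    qed
    also have "\<dots> = (LINT x|lebesgue. K x * (u x powr (p - 1) / norm x powr (b * p)) * v x)" by (rule eq[OF v])
    also have "\<dots> = (LINT x|lebesgue. norm x powr (- b * p) * (K x * u' x powr (p - 1) * v x))"
    proof (rule integral_cong_AE)
      show "(\<lambda>x. norm x powr (- b * p) * (K x * u' x powr (p - 1) * v x)) \<in> borel_measurable lebesgue"
        by (rule lebesgue_measurable_of_borel) measurable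
      show "(\<lambda>x. K x * (u x powr (p - 1) / norm x powr (b * p)) * v x) \<in> borel_measurable lebesgue"
        by (intro borel_measurable_times borel_measurable_divide powr_meas lebesgue_measurable_of_borel) measurable
      show "AE x in lebesgue. K x * (u x powr (p - 1) / norm x powr (b * p)) * v x = norm x powr (- b * p) * (K x * u' x powr (p - 1) * v x)"
        using AE_completion[OF uu'] by eventually_elim (simp add: weight mult_ac)
    qed
    also have "\<dots> = wlint (- b * p) (\<lambda>x. K x * u' x powr (p - 1) * v x)"
      unfolding wlint_def by (rule integral_completion) simp
    finally show ?thesis .
  qed
  interpret weak_solution_setting a b p N "(N - 2 - 2 * a) / 2" C L K u' g'
  proof
    show "\<bar>K (l *\<^sub>R x) - K x\<bar> \<le> L * (l - 1)" if "l \<ge> 1" for x l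
      by (rule dilation_Lipschitz[OF dK L that])
  qed (use assms pair K_bound L0 weak in \<open>auto simp: u'_def\<close>)
  let ?F = "\<lambda>x. norm x powr (- b * p) * (inner (grad K x) x * u' x powr p)"
  have F [measurable]: "?F \<in> borel_measurable borel" by measurable
  have "has_bochner_integral lborel ?F 0" by (rule Pohozaev_identity[OF K1 L])
  then have "has_bochner_integral lebesgue ?F 0"
    using F by (simp add: has_bochner_integral_iff integrable_completion integral_completion)
  moreover have "AE x in lebesgue. ?F x = inner (grad K x) x * (u x powr p / norm x powr (b * p))"
    using AE_completion[OF uu'] by eventually_elim (simp add: weight mult_ac)
  moreover have "?F \<in> borel_measurable lebesgue" using F by (rule lebesgue_measurable_of_borel)
  moreover have "(\<lambda>x. inner (grad K x) x * (u x powr p / norm x powr (b * p))) \<in> borel_measurable lebesgue"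
    by (intro borel_measurable_times borel_measurable_divide powr_meas lebesgue_measurable_of_borel) measurable
  ultimately show ?thesis by (subst has_bochner_integral_cong_AE[symmetric]) auto
qed

end
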